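(* Suppose $V_0\subseteq V_1$ are models of set theory, $\kappa$ is an infinite ordinal, $X,\mathscr{L}\in V_0$ with $X$ infinite and $\mathscr{L}$ a relational language, and let $\mu\in V_0$ be an invariant measure on $[\mathrm{Str}^\kappa_{\mathscr{L}}(X)]^{V_0}$. Then $\mu$ is dissociated in $V_0$ if and only if $\mu^{V_1}$ is dissociated in $V_1$.
   Context: A model of set theory is a transitive model of ZFC (contained in a fixed background model); $\kappa\in V_0$ need not be a cardinal in any given model. Structures and measures: $\mathrm{Str}_{\mathscr{L}}(X)$ is the set of $\mathscr{L}$-structures with underlying set $X$. An $\mathscr{L}$-literal is an atomic formula or a (possibly iterated) negation of one. $\sigma_\kappa(\mathrm{Str}_{\mathscr{L}}(X))$ is the smallest family of subsets of $\mathrm{Str}_{\mathscr{L}}(X)$ closed under complements and under unions of size $\le\kappa$ and containing all sets $\{\mathcal{M}:\mathcal{M}\models\varphi(\bar a)\}$ for $\varphi$ a literal and $\bar a$ a tuple from $X$. $\mathrm{Str}^\kappa_{\mathscr{L}}(X)$ is $\mathrm{Str}_{\mathscr{L}}(X)$ with this family of measurable sets. A probability $\kappa$-measure on it is a probability measure $\mu$ with $\mu(\bigcup_{i\in\kappa}A_i)=\sum_{i\in\kappa}\mu(A_i)$ for pairwise disjoint measurable $A_i$. $\mathrm{Sym}(X)$ acts by $g\mathcal{M}\models R(g(a_0),\dots)$ iff $\mathcal{M}\models R(a_0,\dots)$; $\mu$ is invariant if $\mu(g[A])=\mu(A)$ for all $g\in\mathrm{Sym}(X)$ and measurable $A$.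 "Invariant measure" means invariant probability $\kappa$-measure. Codes: for a set $Z$, $\mathbb{B}^\kappa_{\mathscr{L}:Z}$ is the smallest set containing the basic codes $\langle 0,\varphi,\bar a\rangle$ ($\varphi$ a finite conjunction of $\mathscr{L}$-literals, $\bar a$ a tuple from $Z$) and closed under formal negation $\neg\gamma$ and formal $\bigvee\Gamma$, $\bigwedge\Gamma$ for $\Gamma=\{\gamma_i\}_{i\in\kappa}$. If $Z\subseteq X$ then a code over $Z$ is also a code over $X$, interpreted (in a given model) as a subset of $\mathrm{Str}_{\mathscr{L}}(X)$: basic codes as $\{\mathcal{M}:\mathcal{M}\models\varphi(\bar a)\}$, and $\neg,\bigvee,\bigwedge$ as complement, union, intersection. $\mu(\gamma)$ is the $\mu$-measure of the interpretation of $\gamma$. $\mu$ is dissociated if for all disjoint finite $X_0,X_1\subseteq X$, all $\gamma_0\in\mathbb{B}^\kappa_{\mathscr{L}:X_0}$ and $\gamma_1\in\mathbb{B}^\kappa_{\mathscr{L}:X_1}$, $\mu(\gamma_0\wedge\gamma_1)=\mu(\gamma_0)\cdot\mu(\gamma_1)$. Relativization: $\mu^{V_1}$ denotes the relativization of $\mu$ to $V_1$, i.e. the unique probability $\kappa$-measure in $V_1$ on $[\mathrm{Str}^\kappa_{\mathscr{L}}(X)]^{V_1}$ with $\mu(\gamma)=\mu^{V_1}(\gamma)$ for all basic codes $\gamma\in V_0$. *)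

theory Defs
  imports "HOL-Analysis.Infinite_Sum"
begin


section \<open>Transitive models of ZFC\<close>

datatype fm = Member nat nat | Equal nat nat | Negation fm | Conj fm fm | Forall nat fm

primrec sat :: "('v \<Rightarrow> 'v set) \<Rightarrow> 'v set \<Rightarrow> (nat \<Rightarrow> 'v) \<Rightarrow> fm \<Rightarrow> bool" where
  "sat el M s (Member i j) \<longleftrightarrow> s i \<in> el (s j)"
| "sat el M s (Equal i j) \<longleftrightarrow> s i = s j"
| "sat el M s (Negation \<phi>) \<longleftrightarrow> \<not> sat el M s \<phi>"
| "sat el M s (Conj \<phi> \<psi>) \<longleftrightarrow> sat el M s \<phi> \<and> sat el M s \<psi>"
| "sat el M s (Forall i \<phi>) \<longleftrightarrow> (\<forall>x\<in>M. sat el M (s(i := x)) \<phi>)"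

text \<open>
  First-order ZFC in the structure with domain \<open>M\<close> and membership \<open>x \<in> el y\<close>. The conjuncts are:
  extensionality, foundation, pairing, union, power set, infinity, separation, replacement and
  choice. In the two schemata the formula may use the parameters \<open>s\<close>; variable 0 is the argument
  and variable 1 the value.
\<close>

definition zfc_model :: "('v \<Rightarrow> 'v set) \<Rightarrow> 'v set \<Rightarrow> bool" where
  "zfc_model el M \<longleftrightarrow>
     (\<forall>x\<in>M. \<forall>y\<in>M. (\<forall>z\<in>M. z \<in> el x \<longleftrightarrow> z \<in> el y) \<longrightarrow> x = y) \<and>
     (\<forall>x\<in>M. (\<exists>y\<in>M. y \<in> el x) \<longrightarrow> (\<exists>y\<in>M. y \<in> el x \<and> \<not> (\<exists>z\<in>M. z \<in> el x \<and> z \<in> el y))) \<and>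
     (\<forall>x\<in>M. \<forall>y\<in>M. \<exists>z\<in>M. \<forall>w\<in>M. w \<in> el z \<longleftrightarrow> w = x \<or> w = y) \<and>
     (\<forall>x\<in>M. \<exists>u\<in>M. \<forall>w\<in>M. w \<in> el u \<longleftrightarrow> (\<exists>y\<in>M. y \<in> el x \<and> w \<in> el y)) \<and>
     (\<forall>x\<in>M. \<exists>p\<in>M. \<forall>w\<in>M. w \<in> el p \<longleftrightarrow> (\<forall>z\<in>M. z \<in> el w \<longrightarrow> z \<in> el x)) \<and>
     (\<exists>w\<in>M. (\<exists>e\<in>M. e \<in> el w \<and> (\<forall>x\<in>M. x \<notin> el e)) \<and>
            (\<forall>x\<in>M. x \<in> el w \<longrightarrow>
               (\<exists>y\<in>M. y \<in> el w \<and> (\<forall>z\<in>M. z \<in> el y \<longleftrightarrow> z \<in> el x \<or> z = x)))) \<and>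
     (\<forall>\<phi> s. range s \<subseteq> M \<longrightarrow>
        (\<forall>a\<in>M. \<exists>b\<in>M. \<forall>x\<in>M. x \<in> el b \<longleftrightarrow> x \<in> el a \<and> sat el M (s(0 := x)) \<phi>)) \<and>
     (\<forall>\<phi> s. range s \<subseteq> M \<longrightarrow>
        (\<forall>a\<in>M. (\<forall>x\<in>M. x \<in> el a \<longrightarrow> (\<exists>!y. y \<in> M \<and> sat el M (s(0 := x, 1 := y)) \<phi>)) \<longrightarrow>
           (\<exists>b\<in>M. \<forall>y\<in>M. y \<in> el b \<longleftrightarrow>
              (\<exists>x\<in>M. x \<in> el a \<and> sat el M (s(0 := x, 1 := y)) \<phi>)))) \<and>
     (\<forall>F\<in>M. (\<forall>A\<in>M. A \<in> el F \<longrightarrow> (\<exists>x\<in>M. x \<in> el A)) \<and>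
            (\<forall>A\<in>M. \<forall>B\<in>M. A \<in> el F \<and> B \<in> el F \<and> A \<noteq> B \<longrightarrow> \<not> (\<exists>x\<in>M. x \<in> el A \<and> x \<in> el B)) \<longrightarrow>
            (\<exists>C\<in>M. \<forall>A\<in>M. A \<in> el F \<longrightarrow> (\<exists>x\<in>M. \<forall>y\<in>M. y \<in> el A \<and> y \<in> el C \<longleftrightarrow> y = x)))"

text \<open>
  The background model is the whole type; \<open>elts x\<close> is the extension of \<open>x\<close>. Its membership is
  well-founded, so (up to isomorphism) it and its transitive submodels are transitive models in the usual
  sense. In particular their natural numbers are standard and finiteness is absolute.
\<close>

class set_universe =
  fixes elts :: "'a \<Rightarrow> 'a set"
  assumes wf_elts: "wf {(x, y). x \<in> elts y}"
    and zfc_UNIV: "zfc_model elts UNIV"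

definition set_model :: "'v::set_universe set \<Rightarrow> bool" where
  "set_model V \<longleftrightarrow> (\<forall>x\<in>V. elts x \<subseteq> V) \<and> zfc_model elts V"

section \<open>Set-theoretic coding\<close>

text \<open>
  \<open>mkset S\<close> is the element with extension \<open>S\<close>; it is meaningful only if \<open>S\<close> is the extension of
  some element.
\<close>

definition mkset :: "'v::set_universe set \<Rightarrow> 'v" where
  "mkset S = (THE x. elts x = S)"

definition is_set_in :: "'v::set_universe set \<Rightarrow> 'v set \<Rightarrow> bool" where
  "is_set_in V S \<longleftrightarrow> (\<exists>x\<in>V. elts x = S)"

definition opair :: "'v::set_universe \<Rightarrow> 'v \<Rightarrow> 'v" where
  "opair x y = mkset {mkset {x}, mkset {x, y}}"

primrec num :: "nat \<Rightarrow> 'v::set_universe" where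
  "num 0 = mkset {}"
| "num (Suc n) = mkset (insert (num n) (elts (num n)))"

primrec tup :: "'v::set_universe list \<Rightarrow> 'v" where
  "tup [] = mkset {}"
| "tup (x # xs) = opair x (tup xs)"

text \<open>The restriction of \<open>f\<close> to \<open>D\<close> is, as a set of ordered pairs, an element of \<open>V\<close>.\<close>

definition fun_in :: "'v::set_universe set \<Rightarrow> 'v set \<Rightarrow> ('v \<Rightarrow> 'v) \<Rightarrow> bool" where
  "fun_in V D f \<longleftrightarrow> is_set_in V ((\<lambda>x. opair x (f x)) ` D)"

definition Ord :: "'v::set_universe \<Rightarrow> bool" where
  "Ord \<alpha> \<longleftrightarrow> (\<forall>x\<in>elts \<alpha>. elts x \<subseteq> elts \<alpha>) \<and> (\<forall>x\<in>elts \<alpha>. \<forall>y\<in>elts x. elts y \<subseteq> elts x)"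

text \<open>
  A nonnegative real is represented in a model by its Dedekind cut, a set of (fractions of)
  nonnegative rationals.
\<close>

definition cut :: "real \<Rightarrow> 'v::set_universe set" where
  "cut r = {opair (num p) (num q) | p q. q > 0 \<and> real p / real q < r}"

section \<open>Structures and literals\<close>

text \<open>
  A relational language is the set of pairs (relation symbol, arity). A structure on \<open>X\<close> is
  given by the set of all pairs \<open>(R, a)\<close> such that \<open>R(a)\<close> holds.
\<close>

definition rel_language :: "'v::set_universe \<Rightarrow> bool" where
  "rel_language L \<longleftrightarrow>
     (\<forall>x\<in>elts L. \<exists>R n. x = opair R (num n)) \<and>
     (\<forall>R m n. opair R (num m) \<in> elts L \<and> opair R (num n) \<in> elts L \<longrightarrow> m = n)"

definition Str :: "'v::set_universe set \<Rightarrow> 'v \<Rightarrow> 'v \<Rightarrow> 'v set" where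
  "Str V L X = {M\<in>V. elts M \<subseteq>
     {opair R (tup a) | R a. opair R (num (length a)) \<in> elts L \<and> set a \<subseteq> elts X}}"

datatype 'v literal = Rel 'v "nat list" | Eq nat nat | Neg "'v literal"

text \<open>Literals of \<open>L\<close> in the variables \<open>0, \<dots>, n - 1\<close>.\<close>

primrec lit_over :: "'v::set_universe \<Rightarrow> nat \<Rightarrow> 'v literal \<Rightarrow> bool" where
  "lit_over L n (Rel R is) \<longleftrightarrow> opair R (num (length is)) \<in> elts L \<and> (\<forall>i\<in>set is. i < n)"
| "lit_over L n (Eq i j) \<longleftrightarrow> i < n \<and> j < n"
| "lit_over L n (Neg \<phi>) \<longleftrightarrow> lit_over L n \<phi>"

primrec holds :: "'v::set_universe \<Rightarrow> 'v list \<Rightarrow> 'v literal \<Rightarrow> bool" where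
  "holds M a (Rel R is) \<longleftrightarrow> opair R (tup (map (\<lambda>i. a ! i) is)) \<in> elts M"
| "holds M a (Eq i j) \<longleftrightarrow> a ! i = a ! j"
| "holds M a (Neg \<phi>) \<longleftrightarrow> \<not> holds M a \<phi>"

primrec enc_lit :: "'v::set_universe literal \<Rightarrow> 'v" where
  "enc_lit (Rel R is) = opair (num 0) (opair R (tup (map num is)))"
| "enc_lit (Eq i j) = opair (num 1) (opair (num i) (num j))"
| "enc_lit (Neg \<phi>) = opair (num 2) (enc_lit \<phi>)"

section \<open>Measures\<close>

text \<open>
  \<open>S\<close> is, in \<open>V\<close>, a family of subsets of \<open>Str V L X\<close> with the closure properties that
  define \<open>\<sigma>\<^sub>\<kappa>\<close>. A family \<open>F\<close> has size at most \<open>\<kappa>\<close> in \<open>V\<close> if \<open>V\<close> has an injection of \<open>F\<close>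
  into \<open>\<kappa>\<close>.
\<close>

definition kappa_algebra :: "'v::set_universe set \<Rightarrow> 'v \<Rightarrow> 'v \<Rightarrow> 'v \<Rightarrow> 'v \<Rightarrow> bool" where
  "kappa_algebra V \<kappa> L X S \<longleftrightarrow>
     S \<in> V \<and>
     (\<forall>A\<in>elts S. elts A \<subseteq> Str V L X) \<and>
     (\<forall>\<phi> a. lit_over L (length a) \<phi> \<and> set a \<subseteq> elts X \<longrightarrow>
        mkset {M\<in>Str V L X. holds M a \<phi>} \<in> elts S) \<and>
     (\<forall>A\<in>elts S. mkset (Str V L X - elts A) \<in> elts S) \<and>
     (\<forall>F\<in>V. \<forall>h. elts F \<subseteq> elts S \<and> fun_in V (elts F) h \<and>
          inj_on h (elts F) \<and> h ` elts F \<subseteq> elts \<kappa> \<longrightarrow>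
        mkset (\<Union>A\<in>elts F. elts A) \<in> elts S)"

definition sigma_kappa :: "'v::set_universe set \<Rightarrow> 'v \<Rightarrow> 'v \<Rightarrow> 'v \<Rightarrow> 'v set" where
  "sigma_kappa V \<kappa> L X =
     {A\<in>V. elts A \<subseteq> Str V L X \<and> (\<forall>S. kappa_algebra V \<kappa> L X S \<longrightarrow> A \<in> elts S)}"

text \<open>
  \<open>\<mu>\<close> (only its values on \<open>\<sigma>\<^sub>\<kappa>\<close> matter) is an element of \<open>V\<close> which in \<open>V\<close> is a probability
  \<open>\<kappa>\<close>-measure. The first two conjuncts say that the real-valued function \<open>\<mu>\<close> is in \<open>V\<close>.
  Convergence to a sum of nonnegative reals is absolute.
\<close>

definition prob_kappa_measure ::
    "'v::set_universe set \<Rightarrow> 'v \<Rightarrow> 'v \<Rightarrow> 'v \<Rightarrow> ('v \<Rightarrow> real) \<Rightarrow> bool" where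
  "prob_kappa_measure V \<kappa> L X \<mu> \<longleftrightarrow>
     (\<forall>A\<in>sigma_kappa V \<kappa> L X. is_set_in V (cut (\<mu> A))) \<and>
     fun_in V (sigma_kappa V \<kappa> L X) (\<lambda>A. mkset (cut (\<mu> A))) \<and>
     (\<forall>A\<in>sigma_kappa V \<kappa> L X. 0 \<le> \<mu> A) \<and>
     \<mu> (mkset (Str V L X)) = 1 \<and>
     (\<forall>A. fun_in V (elts \<kappa>) A \<and> (\<forall>i\<in>elts \<kappa>. A i \<in> sigma_kappa V \<kappa> L X) \<and>
          (\<forall>i\<in>elts \<kappa>. \<forall>j\<in>elts \<kappa>. i \<noteq> j \<longrightarrow> elts (A i) \<inter> elts (A j) = {}) \<longrightarrow>
        ((\<lambda>i. \<mu> (A i)) has_sum \<mu> (mkset (\<Union>i\<in>elts \<kappa>. elts (A i)))) (elts \<kappa>))"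

definition act :: "('v \<Rightarrow> 'v) \<Rightarrow> 'v::set_universe \<Rightarrow> 'v" where
  "act g M = mkset {opair R (tup (map g a)) | R a. opair R (tup a) \<in> elts M}"

definition invariant_measure ::
    "'v::set_universe set \<Rightarrow> 'v \<Rightarrow> 'v \<Rightarrow> 'v \<Rightarrow> ('v \<Rightarrow> real) \<Rightarrow> bool" where
  "invariant_measure V \<kappa> L X \<mu> \<longleftrightarrow>
     prob_kappa_measure V \<kappa> L X \<mu> \<and>
     (\<forall>g. fun_in V (elts X) g \<and> bij_betw g (elts X) (elts X) \<longrightarrow>
        (\<forall>A\<in>sigma_kappa V \<kappa> L X. \<mu> (mkset (act g ` elts A)) = \<mu> A))"

section \<open>Codes\<close>

definition basic_code :: "'v::set_universe literal list \<Rightarrow> 'v list \<Rightarrow> 'v" where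
  "basic_code \<phi>s a = opair (num 0) (opair (tup (map enc_lit \<phi>s)) (tup a))"

definition code_neg :: "'v::set_universe \<Rightarrow> 'v" where
  "code_neg \<gamma> = opair (num 1) \<gamma>"

definition code_Or :: "'v::set_universe \<Rightarrow> 'v" where
  "code_Or \<Gamma> = opair (num 2) \<Gamma>"

definition code_And :: "'v::set_universe \<Rightarrow> 'v" where
  "code_And \<Gamma> = opair (num 3) \<Gamma>"

text \<open>The list \<open>\<phi>s\<close> stands for the conjunction of its members.\<close>

definition is_basic :: "'v::set_universe \<Rightarrow> 'v set \<Rightarrow> 'v literal list \<Rightarrow> 'v list \<Rightarrow> bool" where
  "is_basic L Z \<phi>s a \<longleftrightarrow> (\<forall>\<phi>\<in>set \<phi>s. lit_over L (length a) \<phi>) \<and> set a \<subseteq> Z"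

text \<open>
  The codes of \<open>V\<close> over \<open>Z\<close>; the families \<open>(\<gamma>\<^sub>i)\<close> range over those in \<open>V\<close>. As codes are built
  along the well-founded membership relation, the least set closed under the rules is the least
  such set in \<open>V\<close>.
\<close>

inductive_set codes :: "'v::set_universe set \<Rightarrow> 'v \<Rightarrow> 'v \<Rightarrow> 'v set \<Rightarrow> 'v set"
  for V :: "'v::set_universe set" and \<kappa> :: 'v and L :: 'v and Z :: "'v set" where
  basic: "is_basic L Z \<phi>s a \<Longrightarrow> basic_code \<phi>s a \<in> codes V \<kappa> L Z"
| neg: "\<gamma> \<in> codes V \<kappa> L Z \<Longrightarrow> code_neg \<gamma> \<in> codes V \<kappa> L Z"
| Or: "fun_in V (elts \<kappa>) \<gamma> \<Longrightarrow> (\<And>i. i \<in> elts \<kappa> \<Longrightarrow> \<gamma> i \<in> codes V \<kappa> L Z) \<Longrightarrow>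
       code_Or (mkset (\<gamma> ` elts \<kappa>)) \<in> codes V \<kappa> L Z"
| And: "fun_in V (elts \<kappa>) \<gamma> \<Longrightarrow> (\<And>i. i \<in> elts \<kappa> \<Longrightarrow> \<gamma> i \<in> codes V \<kappa> L Z) \<Longrightarrow>
       code_And (mkset (\<gamma> ` elts \<kappa>)) \<in> codes V \<kappa> L Z"

text \<open>Graph of the recursively defined interpretation of codes in \<open>V\<close>.\<close>

inductive denotes :: "'v::set_universe set \<Rightarrow> 'v \<Rightarrow> 'v \<Rightarrow> 'v \<Rightarrow> 'v set \<Rightarrow> bool"
  for V :: "'v::set_universe set" and L :: 'v and X :: 'v where
  basic: "denotes V L X (basic_code \<phi>s a) {M\<in>Str V L X. \<forall>\<phi>\<in>set \<phi>s. holds M a \<phi>}"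
| neg: "denotes V L X \<gamma> A \<Longrightarrow> denotes V L X (code_neg \<gamma>) (Str V L X - A)"
| Or: "(\<And>\<gamma>. \<gamma> \<in> elts \<Gamma> \<Longrightarrow> denotes V L X \<gamma> (A \<gamma>)) \<Longrightarrow>
       denotes V L X (code_Or \<Gamma>) (\<Union>\<gamma>\<in>elts \<Gamma>. A \<gamma>)"
| And: "(\<And>\<gamma>. \<gamma> \<in> elts \<Gamma> \<Longrightarrow> denotes V L X \<gamma> (A \<gamma>)) \<Longrightarrow>
       denotes V L X (code_And \<Gamma>) (Str V L X \<inter> (\<Inter>\<gamma>\<in>elts \<Gamma>. A \<gamma>))"

definition interp :: "'v::set_universe set \<Rightarrow> 'v \<Rightarrow> 'v \<Rightarrow> 'v \<Rightarrow> 'v" where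
  "interp V L X \<gamma> = mkset (THE A. denotes V L X \<gamma> A)"

definition dissociated ::
    "'v::set_universe set \<Rightarrow> 'v \<Rightarrow> 'v \<Rightarrow> 'v \<Rightarrow> ('v \<Rightarrow> real) \<Rightarrow> bool" where
  "dissociated V \<kappa> L X \<mu> \<longleftrightarrow>
     (\<forall>X0 X1. finite X0 \<and> finite X1 \<and> X0 \<subseteq> elts X \<and> X1 \<subseteq> elts X \<and> X0 \<inter> X1 = {} \<longrightarrow>
        (\<forall>\<gamma>0\<in>codes V \<kappa> L X0. \<forall>\<gamma>1\<in>codes V \<kappa> L X1.
           \<mu> (interp V L X (code_And (mkset {\<gamma>0, \<gamma>1}))) =
             \<mu> (interp V L X \<gamma>0) * \<mu> (interp V L X \<gamma>1)))"

text \<open>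
  \<open>\<nu>\<close> is the relativization of \<open>\<mu>\<close> to \<open>V1\<close>. It is determined on \<open>\<sigma>\<^sub>\<kappa>\<close>, as the basic codes give
  a \<open>\<pi>\<close>-system that generates it.
\<close>

definition relativization ::
    "'v::set_universe set \<Rightarrow> 'v set \<Rightarrow> 'v \<Rightarrow> 'v \<Rightarrow> 'v \<Rightarrow> ('v \<Rightarrow> real) \<Rightarrow> ('v \<Rightarrow> real) \<Rightarrow> bool" where
  "relativization V0 V1 \<kappa> L X \<mu> \<nu> \<longleftrightarrow>
     prob_kappa_measure V1 \<kappa> L X \<nu> \<and>
     (\<forall>\<phi>s a. is_basic L (elts X) \<phi>s a \<and> basic_code \<phi>s a \<in> V0 \<longrightarrow>
        \<mu> (interp V0 L X (basic_code \<phi>s a)) = \<nu> (interp V1 L X (basic_code \<phi>s a)))"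

end

theory Submission
  imports Defs "HOL-Analysis.Sigma_Algebra"
begin

text \<open>
  A measure and its relativization agree on basic codes, so it is enough to show that in every model
  dissociation is equivalent to the product formula for basic codes. In measure, the interpretation
  of any code over \<open>Z\<close> can be approximated by cylinder sets, the finite Boolean combinations of
  instances of literals over \<open>Z\<close>: the measure of a union of size \<open>\<kappa>\<close> is the supremum of the
  measures of its finite subunions, because it is a sum of nonnegative reals. A cylinder set is a
  finite disjoint union of sets given by basic codes, so the product formula extends from basic
  codes to cylinder sets and then, by continuity, to all codes.

  The set-theoretic part is that the model contains the families of sets needed for this, in
  particular the interpretations of the members of a family of codes. As the interpretation is
  defined by recursion, it is described in the model by facts that are derived from one another.
\<close>

section \<open>Definable predicates\<close>

text \<open>The relativization is tied to the given measure on basic codes only, and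
  \<open>V1\<close> may contain new structures, new codes and new families indexed by \<kappa>.
  Basic sets are closed under intersection by an operation on codes that does not depend on the
  model, so the product formula for basic codes involves values on basic codes alone. The obstacle
  is that closure under unions and additivity inside a model speak only of families that are
  elements of \<open>V\<close>. A family defined in the surrounding logic has to be produced by
  separation or replacement, hence from a formula, and the interpretation of codes is a recursion
  outside the model. Sets of facts supply the formula without a set of all codes; circular
  derivations do no harm, because each premise concerns a smaller object. Since \<kappa> may be
  uncountable, an argument by countable limits would not do; finite subunions approximate a union
  over any index set.\<close>

primrec ren :: "(nat \<Rightarrow> nat) \<Rightarrow> fm \<Rightarrow> fm" where
  "ren f (Member i j) = Member (f i) (f j)"
| "ren f (Equal i j) = Equal (f i) (f j)"
| "ren f (Negation \<phi>) = Negation (ren f \<phi>)"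
| "ren f (Conj \<phi> \<psi>) = Conj (ren f \<phi>) (ren f \<psi>)"
| "ren f (Forall i \<phi>) = Forall (f i) (ren f \<phi>)"

text \<open>Injectivity rules out capture: updating the assignment at \<open>f i\<close> changes the
  composite assignment at \<open>i\<close> and nowhere else.\<close>

lemma sat_ren:
  assumes "inj f"
  shows "sat el M s (ren f \<phi>) \<longleftrightarrow> sat el M (\<lambda>n. s (f n)) \<phi>"
proof (induction \<phi> arbitrary: s)
  case (Forall i \<phi>)
  have "(\<lambda>n. (s(f i := x)) (f n)) = (\<lambda>n. s (f n))(i := x)" for x
    using assms by (auto simp: fun_eq_iff inj_eq)
  then show ?case using Forall by simp
qed auto

text \<open>Supplies a bound beyond which a formula reads no variable; \<open>definable_all\<close>
  takes its bound variable from there.\<close>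

lemma sat_finite_support:
  "\<exists>N. \<forall>s t. (\<forall>n<N. s n = t n) \<longrightarrow> sat el M s \<phi> = sat el M t \<phi>"
proof (induction \<phi>)
  case (Member i j)
  show ?case by (rule exI[of _ "Suc (max i j)"]) auto
next
  case (Equal i j)
  show ?case by (rule exI[of _ "Suc (max i j)"]) auto
next
  case (Negation \<phi>)
  then show ?case by auto
next
  case (Conj \<phi> \<psi>)
  then obtain N1 N2 where
    N1: "\<And>s t. (\<forall>n<N1. s n = t n) \<Longrightarrow> sat el M s \<phi> = sat el M t \<phi>" and
    N2: "\<And>s t. (\<forall>n<N2. s n = t n) \<Longrightarrow> sat el M s \<psi> = sat el M t \<psi>" by blast
  show ?case
  proof (intro exI[of _ "max N1 N2"] allI impI)
    fix s t :: "nat \<Rightarrow> 'a" assume "\<forall>n<max N1 N2. s n = t n"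
    then show "sat el M s (Conj \<phi> \<psi>) = sat el M t (Conj \<phi> \<psi>)"
      using N1[of s t] N2[of s t] by simp
  qed
next
  case (Forall i \<phi>)
  then obtain N where N: "\<And>s t. (\<forall>n<N. s n = t n) \<Longrightarrow> sat el M s \<phi> = sat el M t \<phi>" by blast
  show ?case
  proof (intro exI[of _ N] allI impI)
    fix s t :: "nat \<Rightarrow> 'a" assume "\<forall>n<N. s n = t n"
    then have "sat el M (s(i := x)) \<phi> = sat el M (t(i := x)) \<phi>" for x
      by (intro N) auto
    then show "sat el M s (Forall i \<phi>) = sat el M t (Forall i \<phi>)" by simp
  qed
qed

text \<open>
  Formulas are handled through their semantics. An assignment \<open>s\<close> is a de Bruijn environment
  (\<open>s 0\<close> belongs to the innermost quantifier); its entries sit at the even positions, and the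
  parameters \<open>c\<close> at the odd ones.
\<close>

definition interleave :: "(nat \<Rightarrow> 'v) \<Rightarrow> (nat \<Rightarrow> 'v) \<Rightarrow> nat \<Rightarrow> 'v" where
  "interleave s c n = (if even n then s (n div 2) else c (n div 2))"

definition definable :: "'v::set_universe set \<Rightarrow> ((nat \<Rightarrow> 'v) \<Rightarrow> bool) \<Rightarrow> bool" where
  "definable V P \<longleftrightarrow> (\<exists>\<phi> c. range c \<subseteq> V \<and>
     (\<forall>s. range s \<subseteq> V \<longrightarrow> (sat elts V (interleave s c) \<phi> \<longleftrightarrow> P s)))"

text \<open>The graph is expressed with the value as a new innermost variable, so that a term can be
  substituted by means of an existential quantifier. Having its values in \<open>V\<close> keeps the
  term in the range of that quantifier.\<close>

definition definable_term :: "'v::set_universe set \<Rightarrow> ((nat \<Rightarrow> 'v) \<Rightarrow> 'v) \<Rightarrow> bool" where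
  "definable_term V t \<longleftrightarrow> (\<forall>s. range s \<subseteq> V \<longrightarrow> t s \<in> V) \<and> definable V (\<lambda>s. s 0 = t (\<lambda>n. s (Suc n)))"

lemma definableI:
  assumes "range c \<subseteq> V" "\<And>s. range s \<subseteq> V \<Longrightarrow> sat elts V (interleave s c) \<phi> \<longleftrightarrow> P s"
  shows "definable V P"
  using assms unfolding definable_def by blast

lemma definable_cong:
  assumes "definable V P" "\<And>s. range s \<subseteq> V \<Longrightarrow> P s \<longleftrightarrow> Q s"
  shows "definable V Q"
  using assms unfolding definable_def by metis

lemma definable_not: "definable V P \<Longrightarrow> definable V (\<lambda>s. \<not> P s)"
  unfolding definable_def by (metis sat.simps(3))

lemma definable_conj:
  assumes "definable V P" "definable V Q"
  shows "definable V (\<lambda>s. P s \<and> Q s)"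
proof -
  from assms(1) obtain \<phi> c where \<phi>: "range c \<subseteq> V"
    "\<And>s. range s \<subseteq> V \<Longrightarrow> sat elts V (interleave s c) \<phi> \<longleftrightarrow> P s" unfolding definable_def by blast
  from assms(2) obtain \<psi> d where \<psi>: "range d \<subseteq> V"
    "\<And>s. range s \<subseteq> V \<Longrightarrow> sat elts V (interleave s d) \<psi> \<longleftrightarrow> Q s" unfolding definable_def by blast
  \<comment> \<open>The parameter sequences of both formulas are merged into
    \<open>interleave c d\<close>: the parameter at \<open>2 * k + 1\<close> moves to
    \<open>4 * k + 1\<close> for \<phi> and to \<open>4 * k + 3\<close> for \<psi>. The positions of
    the environment stay.\<close>
  define f where "f n = (if even n then n else 2 * n - 1)" for n :: nat
  define g where "g n = (if even n then n else 2 * n + 1)" for n :: nat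
  have "inj f" unfolding inj_def f_def by presburger
  moreover have "inj g" unfolding inj_def g_def by presburger
  moreover have "interleave s (interleave c d) (f n) = interleave s c n" for s n
  proof (cases "even n")
    case False
    then obtain k where "n = Suc (2 * k)" by (auto elim: oddE)
    then show ?thesis by (simp add: interleave_def f_def)
  qed (simp add: interleave_def f_def)
  moreover have "interleave s (interleave c d) (g n) = interleave s d n" for s n
  proof (cases "even n")
    case False
    then obtain k where "n = Suc (2 * k)" by (auto elim: oddE)
    then show ?thesis by (simp add: interleave_def g_def)
  qed (simp add: interleave_def g_def)
  moreover have "range (interleave c d) \<subseteq> V"
    using \<phi>(1) \<psi>(1) by (auto simp: interleave_def)
  ultimately show ?thesis
    using \<phi>(2) \<psi>(2)
    by (intro definableI[where c = "interleave c d" and \<phi> = "Conj (ren f \<phi>) (ren g \<psi>)"])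
      (auto simp: sat_ren)
qed

lemma definable_rename:
  assumes "definable V P" "inj f"
  shows "definable V (\<lambda>s. P (\<lambda>n. s (f n)))"
proof -
  from assms(1) obtain \<phi> c where \<phi>: "range c \<subseteq> V"
    "\<And>s. range s \<subseteq> V \<Longrightarrow> sat elts V (interleave s c) \<phi> \<longleftrightarrow> P s" unfolding definable_def by blast
  define g where "g n = (if even n then 2 * f (n div 2) else n)" for n
  have "inj g"
  proof (rule injI)
    fix x y assume eq: "g x = g y"
    then have "even x \<longleftrightarrow> even y" unfolding g_def by (metis dvd_triv_left)
    moreover have "x div 2 = y div 2" if "even x" "even y"
      using eq that injD[OF assms(2), of "x div 2" "y div 2"] by (simp add: g_def)
    ultimately show "x = y"
      using eq unfolding g_def by (metis dvd_mult_div_cancel)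
  qed
  moreover have "(\<lambda>n. interleave s c (g n)) = interleave (\<lambda>n. s (f n)) c" for s
    by (auto simp: fun_eq_iff interleave_def g_def)
  ultimately show ?thesis
    using \<phi> by (intro definableI[where c = c and \<phi> = "ren g \<phi>"]) (auto simp: sat_ren image_subset_iff)
qed

lemma definable_all:
  assumes "definable V (\<lambda>s. Q (s 0) (\<lambda>n. s (Suc n)))"
  shows "definable V (\<lambda>s. \<forall>x\<in>V. Q x s)"
proof -
  from assms obtain \<phi> c where c: "range c \<subseteq> V"
    and \<phi>: "\<And>s. range s \<subseteq> V \<Longrightarrow> sat elts V (interleave s c) \<phi> \<longleftrightarrow> Q (s 0) (\<lambda>n. s (Suc n))"
    unfolding definable_def by blast
  obtain N where N: "\<And>s t. (\<forall>n<N. s n = t n) \<Longrightarrow> sat elts V s \<phi> = sat elts V t \<phi>"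
    using sat_finite_support by blast
  \<comment> \<open>In \<phi> the bound element sits at 0, but in the quantified formula position 0
    belongs to \<open>s 0\<close>. On the even positions up to \<open>m\<close> the map
    \<open>f\<close> is a cyclic shift: 0 goes to \<open>m\<close> and every other one goes down by
    2. As \<open>m\<close> exceeds \<open>N\<close>, all variables that \<phi> reads are
    shifted.\<close>
  define m where "m = 2 * Suc N"
  define f where "f n = (if odd n then n else if n = 0 then m else if n \<le> m then n - 2 else n)"
    for n :: nat
  have "inj f"
  proof (rule injI)
    fix x y assume "f x = f y"
    moreover have "a = b" if "even a" "even b" "0 < a" "0 < b" "a - 2 = b - 2" for a b :: nat
      using that by (auto elim!: dvdE)
    ultimately show "x = y"
      unfolding f_def m_def by (auto split: if_splits)
  qed
  have "sat elts V (interleave s c) (Forall m (ren f \<phi>)) \<longleftrightarrow> (\<forall>x\<in>V. Q x s)"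
    if s: "range s \<subseteq> V" for s
  proof -
    have "sat elts V ((interleave s c)(m := x)) (ren f \<phi>) \<longleftrightarrow> Q x s" if "x \<in> V" for x
    proof -
      have "sat elts V ((interleave s c)(m := x)) (ren f \<phi>)
          \<longleftrightarrow> sat elts V (interleave (case_nat x s) c) \<phi>"
        unfolding sat_ren[OF \<open>inj f\<close>]
      proof (intro N allI impI)
        fix n assume "n < N"
        show "((interleave s c)(m := x)) (f n) = interleave (case_nat x s) c n"
        proof (cases "odd n")
          case True
          then show ?thesis using \<open>n < N\<close> by (auto simp: f_def m_def interleave_def)
        next
          case False
          then obtain k where "n = 2 * k" by blast
          then show ?thesis using \<open>n < N\<close>
            by (cases k) (auto simp: f_def m_def interleave_def)
        qed
      qed
      also have "\<dots> \<longleftrightarrow> Q x s"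
        using \<phi>[of "case_nat x s"] s that by (auto simp: image_subset_iff split: nat.split)
      finally show ?thesis .
    qed
    then show ?thesis by simp
  qed
  with c show ?thesis by (rule definableI)
qed

text \<open>\<open>definable\<close> asks for a sequence of parameters in \<open>V\<close>; an
  element of \<open>V\<close> supplies a constant one.\<close>

lemma definable_var_mem: "V \<noteq> {} \<Longrightarrow> definable V (\<lambda>s. s i \<in> elts (s j))"
  by (rule definableI[where c = "\<lambda>_. SOME x. x \<in> V" and \<phi> = "Member (2 * i) (2 * j)"])
    (auto simp: interleave_def some_in_eq)

lemma definable_var_eq: "V \<noteq> {} \<Longrightarrow> definable V (\<lambda>s. s i = s j)"
  by (rule definableI[where c = "\<lambda>_. SOME x. x \<in> V" and \<phi> = "Equal (2 * i) (2 * j)"])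
    (auto simp: interleave_def some_in_eq)

lemma definable_var_param: "p \<in> V \<Longrightarrow> definable V (\<lambda>s. s i = p)"
  by (rule definableI[where c = "\<lambda>_. p" and \<phi> = "Equal (2 * i) 1"]) (auto simp: interleave_def)

lemma definable_disj: "definable V P \<Longrightarrow> definable V Q \<Longrightarrow> definable V (\<lambda>s. P s \<or> Q s)"
  using definable_not[OF definable_conj[OF definable_not definable_not], of V P Q] by (auto intro: definable_cong)

lemma definable_imp: "definable V P \<Longrightarrow> definable V Q \<Longrightarrow> definable V (\<lambda>s. P s \<longrightarrow> Q s)"
  using definable_disj[OF definable_not, of V P Q] by (auto intro: definable_cong)

lemma definable_iff: "definable V P \<Longrightarrow> definable V Q \<Longrightarrow> definable V (\<lambda>s. P s = Q s)"
  using definable_conj[OF definable_imp[of V P Q] definable_imp[of V Q P]] by (auto intro: definable_cong)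

lemma definable_ex: "definable V (\<lambda>s. Q (s 0) (\<lambda>n. s (Suc n))) \<Longrightarrow> definable V (\<lambda>s. \<exists>x\<in>V. Q x s)"
  using definable_not[OF definable_all[OF definable_not], of V Q] by (auto intro: definable_cong)

section \<open>Definable terms and their substitution\<close>

lemma definable_term_in: "definable_term V t \<Longrightarrow> range s \<subseteq> V \<Longrightarrow> t s \<in> V"
  unfolding definable_term_def by blast

text \<open>Needed below a quantifier, where \<open>s 0\<close> is the bound element and the old
  environment starts at index 1.\<close>

lemma definable_term_weaken:
  assumes "definable_term V t"
  shows "definable_term V (\<lambda>s. t (\<lambda>n. s (Suc n)))"
proof -
  have "definable V (\<lambda>s. s 0 = t (\<lambda>n. s (Suc n)))" using assms unfolding definable_term_def by blast
  \<comment> \<open>Index 0 still holds the value of the term; index 1 is the innermost variable,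
    which is skipped.\<close>
  then have "definable V (\<lambda>s. s (case_nat 0 (\<lambda>n. Suc (Suc n)) 0)
      = t (\<lambda>n. s (case_nat 0 (\<lambda>n. Suc (Suc n)) (Suc n))))"
    by (rule definable_rename) (auto simp: inj_def split: nat.splits)
  then show ?thesis
    using assms unfolding definable_term_def by (auto simp: image_subset_iff)
qed

text \<open>The term is replaced by a quantified variable equal to it. This variable may range over
  \<open>V\<close> because the values of \<open>t\<close> lie there.\<close>

lemma definable_subst:
  assumes "definable_term V t" "definable V (\<lambda>s. P (s 0) (\<lambda>n. s (Suc n)))"
  shows "definable V (\<lambda>s. P (t s) s)"
proof -
  have "definable V (\<lambda>s. s 0 = t (\<lambda>n. s (Suc n)))" using assms unfolding definable_term_def by blast
  then have "definable V (\<lambda>s. \<exists>x\<in>V. x = t s \<and> P x s)"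
    using assms by (intro definable_ex definable_conj)
  then show ?thesis by (rule definable_cong) (use definable_term_in[OF assms(1)] in auto)
qed

lemma definable_comp1:
  assumes "\<And>i. definable V (\<lambda>s. P (s i))" "definable_term V t"
  shows "definable V (\<lambda>s. P (t s))"
  by (rule definable_subst[where P = "\<lambda>x _. P x", OF assms(2,1)])

lemma definable_comp2:
  assumes "\<And>i j. definable V (\<lambda>s. P (s i) (s j))" "definable_term V t" "definable_term V u"
  shows "definable V (\<lambda>s. P (t s) (u s))"
proof (rule definable_subst[where P = "\<lambda>x s. P x (u s)", OF assms(2)])
  have "definable V (\<lambda>s. P (s (Suc 0)) (s 0))" by (rule assms(1))
  then show "definable V (\<lambda>s. P (s 0) (u (\<lambda>n. s (Suc n))))"
    by (rule definable_subst[where P = "\<lambda>x s. P (s 0) x", OF definable_term_weaken[OF assms(3)]])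
qed

lemma definable_comp3:
  assumes "\<And>i j k. definable V (\<lambda>s. P (s i) (s j) (s k))" "definable_term V t" "definable_term V u" "definable_term V w"
  shows "definable V (\<lambda>s. P (t s) (u s) (w s))"
proof (rule definable_subst[where P = "\<lambda>x s. P x (u s) (w s)", OF assms(2)])
  have "definable V (\<lambda>s. P (s (Suc (Suc 0))) (s (Suc 0)) (s 0))" by (rule assms(1))
  then have "definable V (\<lambda>s. P (s (Suc 0)) (s 0) (w (\<lambda>n. s (Suc (Suc n)))))"
    by (rule definable_subst[where P = "\<lambda>x s. P (s (Suc 0)) (s 0) x", OF definable_term_weaken[OF definable_term_weaken[OF assms(4)]]])
  then show "definable V (\<lambda>s. P (s 0) (u (\<lambda>n. s (Suc n))) (w (\<lambda>n. s (Suc n))))"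
    by (rule definable_subst[where P = "\<lambda>x s. P (s 0) x (w (\<lambda>n. s (Suc n)))", OF definable_term_weaken[OF assms(3)]])
qed

locale class_model =
  fixes V :: "'v::set_universe set"
  assumes nonempty: "V \<noteq> {}"
begin

lemma definable_term_var: "definable_term V (\<lambda>s. s i)"
  unfolding definable_term_def using definable_var_eq[OF nonempty] by (auto simp: image_subset_iff)

lemma definable_term_param: "p \<in> V \<Longrightarrow> definable_term V (\<lambda>s. p)"
  unfolding definable_term_def using definable_var_param by blast

lemma definable_term_comp1:
  assumes "\<And>i j. definable V (\<lambda>s. s i = F (s j))" "\<And>x. x \<in> V \<Longrightarrow> F x \<in> V" "definable_term V t"
  shows "definable_term V (\<lambda>s. F (t s))"
  unfolding definable_term_def
proof (intro conjI allI impI)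
  show "definable V (\<lambda>s. s 0 = F (t (\<lambda>n. s (Suc n))))"
    by (rule definable_comp2[where P = "\<lambda>x y. x = F y", OF assms(1) definable_term_var definable_term_weaken[OF assms(3)]])
qed (use assms definable_term_in in blast)

lemma definable_term_comp2:
  assumes "\<And>i j k. definable V (\<lambda>s. s i = F (s j) (s k))"
    "\<And>x y. x \<in> V \<Longrightarrow> y \<in> V \<Longrightarrow> F x y \<in> V" "definable_term V t" "definable_term V u"
  shows "definable_term V (\<lambda>s. F (t s) (u s))"
  unfolding definable_term_def
proof (intro conjI allI impI)
  show "definable V (\<lambda>s. s 0 = F (t (\<lambda>n. s (Suc n))) (u (\<lambda>n. s (Suc n))))"
    by (rule definable_comp3[where P = "\<lambda>x y z. x = F y z",
          OF assms(1) definable_term_var definable_term_weaken[OF assms(3)] definable_term_weaken[OF assms(4)]])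
qed (use assms definable_term_in in blast)

lemma definable_mem: "definable_term V t \<Longrightarrow> definable_term V u \<Longrightarrow> definable V (\<lambda>s. t s \<in> elts (u s))"
  by (rule definable_comp2[where P = "\<lambda>x y. x \<in> elts y", OF definable_var_mem[OF nonempty]])

lemma definable_eq: "definable_term V t \<Longrightarrow> definable_term V u \<Longrightarrow> definable V (\<lambda>s. t s = u s)"
  by (rule definable_comp2[where P = "(=)", OF definable_var_eq[OF nonempty]])

end

section \<open>Transitive models\<close>

lemma set_model_UNIV: "set_model (UNIV :: 'v::set_universe set)"
  unfolding set_model_def using zfc_UNIV by simp

lemma elts_inject: "elts x = elts y \<longleftrightarrow> x = (y :: 'v::set_universe)"
  using zfc_UNIV[unfolded zfc_model_def, THEN conjunct1] by blast

lemma mkset_elts [simp]: "mkset (elts x) = (x :: 'v::set_universe)"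
  unfolding mkset_def by (rule the_equality) (auto simp: elts_inject)

lemma is_set_in_iff: "is_set_in V S \<longleftrightarrow> mkset S \<in> V \<and> elts (mkset S) = (S :: 'v::set_universe set)"
  unfolding is_set_in_def by force

lemma is_set_inD: "is_set_in V S \<Longrightarrow> mkset S \<in> V" "is_set_in V S \<Longrightarrow> elts (mkset S) = S"
  for S :: "'v::set_universe set"
  by (auto simp: is_set_in_iff)

lemma is_set_in_elts: "x \<in> V \<Longrightarrow> is_set_in V (elts x)"
  unfolding is_set_in_def by blast

definition succ :: "'v::set_universe \<Rightarrow> 'v" where
  "succ x = mkset (insert x (elts x))"

definition prd :: "'v::set_universe \<Rightarrow> 'v \<Rightarrow> 'v" where
  "prd A B = mkset {opair x y | x y. x \<in> elts A \<and> y \<in> elts B}"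

named_theorems definable_intros

locale transitive_model =
  fixes V :: "'v::set_universe set"
  assumes model: "set_model V"
begin

lemma zfc: "zfc_model elts V"
  using model unfolding set_model_def by blast

lemma elts_subset: "x \<in> V \<Longrightarrow> elts x \<subseteq> V"
  using model unfolding set_model_def by blast

lemma trans_in: "y \<in> elts x \<Longrightarrow> x \<in> V \<Longrightarrow> y \<in> V"
  using elts_subset by blast

sublocale class_model V
  using zfc[unfolded zfc_model_def, THEN conjunct2, THEN conjunct2, THEN conjunct2, THEN conjunct2,
      THEN conjunct2, THEN conjunct1]
  by unfold_locales blast

lemmas [definable_intros] = definable_term_var definable_term_param definable_mem definable_eq definable_not definable_conj definable_disj definable_imp definable_iff
  definable_all definable_ex

text \<open>By transitivity all elements of \<open>t s\<close> lie in \<open>V\<close>, so the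
  bounded quantifier is a quantifier over \<open>V\<close> restricted by membership.\<close>

lemma definable_bex [definable_intros]:
  assumes "definable_term V t" "definable V (\<lambda>s. Q (s 0) (\<lambda>n. s (Suc n)))"
  shows "definable V (\<lambda>s. \<exists>x\<in>elts (t s). Q x s)"
proof -
  have "definable V (\<lambda>s. \<exists>x\<in>V. x \<in> elts (t s) \<and> Q x s)"
    by (intro definable_ex definable_conj definable_mem definable_term_var definable_term_weaken assms)
  then show ?thesis
    by (rule definable_cong) (use elts_subset[OF definable_term_in[OF assms(1)]] in blast)
qed

lemma definable_ball [definable_intros]:
  assumes "definable_term V t" "definable V (\<lambda>s. Q (s 0) (\<lambda>n. s (Suc n)))"
  shows "definable V (\<lambda>s. \<forall>x\<in>elts (t s). Q x s)"
proof -
  have "definable V (\<lambda>s. \<forall>x\<in>V. x \<in> elts (t s) \<longrightarrow> Q x s)"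
    by (intro definable_all definable_imp definable_mem definable_term_var definable_term_weaken assms)
  then show ?thesis
    by (rule definable_cong) (use elts_subset[OF definable_term_in[OF assms(1)]] in blast)
qed

lemma definable_subset [definable_intros]:
  assumes "definable_term V t" "definable_term V u"
  shows "definable V (\<lambda>s. elts (t s) \<subseteq> elts (u s))"
  unfolding subset_eq by (intro definable_ball definable_mem definable_term_var definable_term_weaken assms)

section \<open>Separation, replacement and elementary set operations\<close>

lemma separation_env:
  assumes "definable V (\<lambda>s. P (s 0) (\<lambda>n. s (Suc n)))" "range s \<subseteq> V" "a \<in> V"
  shows "is_set_in V {x\<in>elts a. P x s}"
proof -
  from assms(1) obtain \<phi> c where c: "range c \<subseteq> V"
    and \<phi>: "\<And>s. range s \<subseteq> V \<Longrightarrow> sat elts V (interleave s c) \<phi> \<longleftrightarrow> P (s 0) (\<lambda>n. s (Suc n))"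
    unfolding definable_def by blast
  define t where "t = interleave (case_nat a s) c"
  have "range t \<subseteq> V"
    using assms(2,3) c by (auto simp: t_def interleave_def image_subset_iff split: nat.split)
  then obtain b where b: "b \<in> V" "\<forall>x\<in>V. x \<in> elts b \<longleftrightarrow> x \<in> elts a \<and> sat elts V (t(0 := x)) \<phi>"
    using zfc[unfolded zfc_model_def, THEN conjunct2, THEN conjunct2, THEN conjunct2, THEN conjunct2,
      THEN conjunct2, THEN conjunct2, THEN conjunct1] assms(3) by blast
  have "t(0 := x) = interleave (case_nat x s) c" for x
    by (auto simp: t_def fun_eq_iff interleave_def split: nat.split)
  moreover have "range (case_nat x s) \<subseteq> V" if "x \<in> V" for x
    using that assms(2) by (auto simp: image_subset_iff split: nat.split)
  ultimately have "x \<in> elts b \<longleftrightarrow> x \<in> elts a \<and> P x s" if "x \<in> V" for x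
    using b(2) \<phi>[of "case_nat x s"] that by simp
  then have "elts b = {x\<in>elts a. P x s}"
    using elts_subset[OF b(1)] elts_subset[OF assms(3)] by blast
  with b(1) show ?thesis unfolding is_set_in_def by blast
qed

lemma separation:
  assumes "definable V (\<lambda>s. P (s 0))" "a \<in> V"
  shows "is_set_in V {x\<in>elts a. P x}"
  by (rule separation_env[where P = "\<lambda>x _. P x" and s = "\<lambda>_. a"]) (use assms in auto)

text \<open>\<open>P\<close> is the formula and \<open>f\<close> the function of the surrounding
  logic. They have to match only on \<open>elts a\<close>, so \<open>f\<close> may be arbitrary
  elsewhere.\<close>

lemma replacement:
  assumes "a \<in> V" "definable V (\<lambda>s. P (s 0) (s (Suc 0)))"
    "\<And>x. x \<in> elts a \<Longrightarrow> f x \<in> V" "\<And>x y. x \<in> elts a \<Longrightarrow> y \<in> V \<Longrightarrow> P x y \<longleftrightarrow> y = f x"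
  shows "is_set_in V (f ` elts a)"
proof -
  from assms(2) obtain \<phi> c where c: "range c \<subseteq> V"
    and \<phi>: "\<And>s. range s \<subseteq> V \<Longrightarrow> sat elts V (interleave s c) \<phi> \<longleftrightarrow> P (s 0) (s (Suc 0))"
    unfolding definable_def by blast
  \<comment> \<open>The schema has argument and value at variables 0 and 1, whereas the environment
    occupies the even positions, here 0 and 2. The renaming \<open>w\<close> therefore exchanges 1
    and 2.\<close>
  define w where "w n = (if n = 1 then 2 else if n = 2 then 1 else n)" for n :: nat
  have "inj w" unfolding inj_def w_def by auto
  define t where "t n = interleave (\<lambda>_. a) c (w n)" for n
  have rt: "range t \<subseteq> V"
    using assms(1) c by (auto simp: t_def interleave_def split: nat.split)
  have sat: "sat elts V (t(0 := x, 1 := y)) (ren w \<phi>) \<longleftrightarrow> P x y" if "x \<in> V" "y \<in> V" for x y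
  proof -
    have "(t(0 := x, 1 := y)) (w n) = interleave (case_nat x (case_nat y (\<lambda>_. a))) c n" for n
    proof -
      consider "n = 0" | "n = 1" | "n = 2" | "n > 2" by arith
      then show ?thesis
      proof cases
        case 4
        then have "w n = n" "n \<noteq> 0" "n \<noteq> 1" by (auto simp: w_def)
        moreover have "\<exists>k. n div 2 = Suc (Suc k)" if "even n"
          using that 4 by (intro exI[of _ "n div 2 - 2"]) presburger
        ultimately show ?thesis
          by (cases "even n") (auto simp: t_def interleave_def)
      qed (simp_all add: t_def w_def interleave_def)
    qed
    moreover have "range (case_nat x (case_nat y (\<lambda>_. a))) \<subseteq> V"
      using that assms(1) by (auto split: nat.split)
    ultimately show ?thesis
      using \<phi>[of "case_nat x (case_nat y (\<lambda>_. a))"] by (simp add: sat_ren[OF \<open>inj w\<close>])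
  qed
  have "\<exists>!y. y \<in> V \<and> sat elts V (t(0 := x, 1 := y)) (ren w \<phi>)" if "x \<in> elts a" for x
    using assms(3,4)[OF that] sat[OF trans_in[OF that assms(1)]] by (intro ex1I[of _ "f x"]) auto
  then have "\<exists>b\<in>V. \<forall>y\<in>V. y \<in> elts b \<longleftrightarrow>
      (\<exists>x\<in>V. x \<in> elts a \<and> sat elts V (t(0 := x, 1 := y)) (ren w \<phi>))"
    by (intro zfc[unfolded zfc_model_def, THEN conjunct2, THEN conjunct2, THEN conjunct2,
      THEN conjunct2, THEN conjunct2, THEN conjunct2, THEN conjunct2, THEN conjunct1,
      THEN spec[of _ "ren w \<phi>"], THEN spec[of _ t], THEN mp, OF rt, THEN bspec, OF assms(1),
      THEN mp] ballI impI)
  then obtain b where b: "b \<in> V" "\<And>y. y \<in> V \<Longrightarrow> y \<in> elts b \<longleftrightarrow>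
      (\<exists>x\<in>V. x \<in> elts a \<and> sat elts V (t(0 := x, 1 := y)) (ren w \<phi>))" by blast
  have "elts b = f ` elts a"
  proof (intro set_eqI)
    fix y
    show "y \<in> elts b \<longleftrightarrow> y \<in> f ` elts a"
    proof (cases "y \<in> V")
      case True
      then have "y \<in> elts b \<longleftrightarrow> (\<exists>x\<in>V. x \<in> elts a \<and> P x y)"
        using b(2) sat by blast
      also have "\<dots> \<longleftrightarrow> y \<in> f ` elts a"
        using assms(4)[OF _ True] elts_subset[OF assms(1)] by (auto simp: image_iff)
      finally show ?thesis .
    next
      case False
      then show ?thesis using elts_subset[OF b(1)] assms(3) by blast
    qed
  qed
  with b(1) show ?thesis unfolding is_set_in_def by blast
qed

lemma is_set_in_pair: "x \<in> V \<Longrightarrow> y \<in> V \<Longrightarrow> is_set_in V {x, y}"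
proof -
  assume "x \<in> V" "y \<in> V"
  then obtain z where z: "z \<in> V" "\<forall>w\<in>V. w \<in> elts z \<longleftrightarrow> w = x \<or> w = y"
    using zfc[unfolded zfc_model_def, THEN conjunct2, THEN conjunct2, THEN conjunct1] by blast
  then have "elts z = {x, y}" using elts_subset[of z] \<open>x \<in> V\<close> \<open>y \<in> V\<close> by blast
  with z(1) show ?thesis unfolding is_set_in_def by blast
qed

lemma is_set_in_singleton: "x \<in> V \<Longrightarrow> is_set_in V {x}"
  using is_set_in_pair[of x x] by simp

lemma is_set_in_Union: "x \<in> V \<Longrightarrow> is_set_in V (\<Union> (elts ` elts x))"
proof -
  assume "x \<in> V"
  then obtain u where u: "u \<in> V" "\<forall>w\<in>V. w \<in> elts u \<longleftrightarrow> (\<exists>y\<in>V. y \<in> elts x \<and> w \<in> elts y)"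
    using zfc[unfolded zfc_model_def, THEN conjunct2, THEN conjunct2, THEN conjunct2, THEN conjunct1]
    by blast
  have "elts y \<subseteq> V" if "y \<in> elts x" for y
    using elts_subset[OF trans_in[OF that \<open>x \<in> V\<close>]] .
  then have "w \<in> elts u \<longleftrightarrow> w \<in> \<Union> (elts ` elts x)" if "w \<in> V" for w
    using bspec[OF u(2) that] elts_subset[OF \<open>x \<in> V\<close>] by blast
  moreover have "\<Union> (elts ` elts x) \<subseteq> V"
    using \<open>\<And>y. y \<in> elts x \<Longrightarrow> elts y \<subseteq> V\<close> by (rule UN_least)
  ultimately have "elts u = \<Union> (elts ` elts x)"
    using elts_subset[OF u(1)] by (intro set_eqI) (meson subsetD)
  with u(1) show ?thesis unfolding is_set_in_def by blast
qed

lemma is_set_in_UN: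
  assumes "is_set_in V (f ` elts a)"
  shows "is_set_in V (\<Union>x\<in>elts a. elts (f x))"
  using is_set_in_Union[OF is_set_inD(1)[OF assms]] is_set_inD(2)[OF assms] by (simp add: image_image)

lemma is_set_in_Un:
  assumes "is_set_in V A" "is_set_in V B"
  shows "is_set_in V (A \<union> B)"
proof -
  have "is_set_in V {mkset A, mkset B}"
    using assms by (intro is_set_in_pair is_set_inD)
  from is_set_in_Union[OF is_set_inD(1)[OF this]] is_set_inD(2)[OF this] assms
  show ?thesis by (simp add: is_set_inD(2))
qed

lemma is_set_in_insert: "x \<in> V \<Longrightarrow> is_set_in V A \<Longrightarrow> is_set_in V (insert x A)"
  using is_set_in_Un[OF is_set_in_singleton, of x A] by simp

lemma is_set_in_Pow: "x \<in> V \<Longrightarrow> is_set_in V {y\<in>V. elts y \<subseteq> elts x}"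
proof -
  assume "x \<in> V"
  from zfc[unfolded zfc_model_def, THEN conjunct2, THEN conjunct2, THEN conjunct2, THEN conjunct2,
      THEN conjunct1, THEN bspec, OF this]
  obtain p where p: "p \<in> V" "\<forall>w\<in>V. w \<in> elts p \<longleftrightarrow> (\<forall>z\<in>V. z \<in> elts w \<longrightarrow> z \<in> elts x)"
    by (rule bexE)
  have "y \<in> elts p \<longleftrightarrow> elts y \<subseteq> elts x" if "y \<in> V" for y
    using p(2) that elts_subset[OF that] by blast
  then have "elts p = {y\<in>V. elts y \<subseteq> elts x}"
    using elts_subset[OF p(1)] by blast
  with p(1) show ?thesis unfolding is_set_in_def by blast
qed

lemma is_set_in_empty: "is_set_in V {}"
proof -
  obtain a where "a \<in> V" using nonempty by blast
  then have "is_set_in V {x\<in>elts a. x \<noteq> x}"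
    by (intro separation definable_intros)
  then show ?thesis by simp
qed

lemma definable_term_upair [definable_intros]: "definable_term V t \<Longrightarrow> definable_term V u \<Longrightarrow> definable_term V (\<lambda>s. mkset {t s, u s})"
proof (rule definable_term_comp2[where F = "\<lambda>x y. mkset {x, y}"])
  fix i j k :: nat
  have "definable V (\<lambda>s. \<forall>z\<in>V. z \<in> elts (s i) \<longleftrightarrow> z = s j \<or> z = s k)"
    by (intro definable_intros)
  then show "definable V (\<lambda>s. s i = mkset {s j, s k})"
  proof (rule definable_cong)
    fix s :: "nat \<Rightarrow> 'v" assume "range s \<subseteq> V"
    then have "s n \<in> V" for n by blast
    then have "s i = mkset {s j, s k} \<longleftrightarrow> elts (s i) = {s j, s k}"
      by (metis is_set_inD(2) is_set_in_pair mkset_elts)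
    then show "(\<forall>z\<in>V. z \<in> elts (s i) \<longleftrightarrow> z = s j \<or> z = s k) \<longleftrightarrow> s i = mkset {s j, s k}"
      using \<open>\<And>n. s n \<in> V\<close> elts_subset[of "s i"] by blast
  qed
qed (auto intro: is_set_inD is_set_in_pair)

lemma definable_term_singleton [definable_intros]: "definable_term V t \<Longrightarrow> definable_term V (\<lambda>s. mkset {t s})"
  using definable_term_upair[of t t] by simp

lemma definable_term_opair [definable_intros]: "definable_term V t \<Longrightarrow> definable_term V u \<Longrightarrow> definable_term V (\<lambda>s. opair (t s) (u s))"
  unfolding opair_def by (intro definable_term_upair definable_term_singleton)

text \<open>Lets a comprehension occur inside a formula, as in the clauses of
  \<open>code_rule\<close> whose values are sets of structures.\<close>

lemma definable_term_sep [definable_intros]: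
  assumes t: "definable_term V t" and Q: "definable V (\<lambda>s. Q (s 0) (\<lambda>n. s (Suc n)))"
  shows "definable_term V (\<lambda>s. mkset {x\<in>elts (t s). Q x s})"
  unfolding definable_term_def
proof (intro conjI allI impI)
  have sep: "is_set_in V {x\<in>elts (t s). Q x s}" if "range s \<subseteq> V" for s
    by (rule separation_env[OF Q that definable_term_in[OF t that]])
  then show "mkset {x\<in>elts (t s). Q x s} \<in> V" if "range s \<subseteq> V" for s
    using that is_set_inD by blast
  \<comment> \<open>Under the quantifier over \<open>x\<close> the candidate for the comprehension
    has index 1, which \<open>Q\<close> must skip.\<close>
  have "definable V (\<lambda>s. Q (s (case_nat 0 (\<lambda>n. Suc (Suc n)) 0))
      (\<lambda>n. s (case_nat 0 (\<lambda>n. Suc (Suc n)) (Suc n))))"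
    using Q by (rule definable_rename) (auto simp: inj_def split: nat.splits)
  then have "definable V (\<lambda>s. \<forall>x\<in>V. x \<in> elts (s 0) \<longleftrightarrow>
      x \<in> elts (t (\<lambda>n. s (Suc n))) \<and> Q x (\<lambda>n. s (Suc n)))"
    by (intro definable_all definable_iff definable_mem definable_conj definable_term_var definable_term_weaken t) simp
  then show "definable V (\<lambda>s. s 0 = mkset {x\<in>elts (t (\<lambda>n. s (Suc n))). Q x (\<lambda>n. s (Suc n))})"
  proof (rule definable_cong)
    fix s :: "nat \<Rightarrow> 'v" assume s: "range s \<subseteq> V"
    let ?s = "\<lambda>n. s (Suc n)"
    have s': "range ?s \<subseteq> V" using s by blast
    have "s 0 = mkset {x\<in>elts (t ?s). Q x ?s} \<longleftrightarrow> elts (s 0) = {x\<in>elts (t ?s). Q x ?s}"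
      using is_set_inD(2)[OF sep[OF s']] by (metis mkset_elts)
    moreover have "elts (s 0) \<subseteq> V" "elts (t ?s) \<subseteq> V"
      using s elts_subset definable_term_in[OF t s'] by (blast, blast)
    ultimately show "(\<forall>x\<in>V. x \<in> elts (s 0) \<longleftrightarrow> x \<in> elts (t ?s) \<and> Q x ?s)
        \<longleftrightarrow> s 0 = mkset {x\<in>elts (t ?s). Q x ?s}"
      by blast
  qed
qed

lemma opair_in: "x \<in> V \<Longrightarrow> y \<in> V \<Longrightarrow> opair x y \<in> V"
  unfolding opair_def by (intro is_set_inD is_set_in_pair is_set_in_singleton)

lemma is_set_in_succ: "x \<in> V \<Longrightarrow> is_set_in V (insert x (elts x))"
  by (intro is_set_in_insert is_set_in_elts)

lemma succ_in: "x \<in> V \<Longrightarrow> succ x \<in> V"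
  unfolding succ_def by (intro is_set_inD is_set_in_succ)

lemma definable_term_succ [definable_intros]: "definable_term V t \<Longrightarrow> definable_term V (\<lambda>s. succ (t s))"
proof (rule definable_term_comp1[where F = succ])
  fix i j :: nat
  have "definable V (\<lambda>s. \<forall>z\<in>V. z \<in> elts (s i) \<longleftrightarrow> z = s j \<or> z \<in> elts (s j))"
    by (intro definable_intros)
  then show "definable V (\<lambda>s. s i = succ (s j))"
  proof (rule definable_cong)
    fix s :: "nat \<Rightarrow> 'v" assume "range s \<subseteq> V"
    then have s: "s n \<in> V" for n by blast
    then have "s i = succ (s j) \<longleftrightarrow> elts (s i) = insert (s j) (elts (s j))"
      unfolding succ_def by (metis is_set_inD(2) is_set_in_succ mkset_elts)
    then show "(\<forall>z\<in>V. z \<in> elts (s i) \<longleftrightarrow> z = s j \<or> z \<in> elts (s j)) \<longleftrightarrow> s i = succ (s j)"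
      using s elts_subset[OF s] by blast
  qed
qed (auto intro: succ_in)

lemma fun_inI:
  assumes "a \<in> V" "definable V (\<lambda>s. P (s 0) (s (Suc 0)))"
    "\<And>x. x \<in> elts a \<Longrightarrow> f x \<in> V" "\<And>x y. x \<in> elts a \<Longrightarrow> y \<in> V \<Longrightarrow> P x y \<longleftrightarrow> y = f x"
  shows "fun_in V (elts a) f"
  unfolding fun_in_def
proof (rule replacement[OF assms(1), where P = "\<lambda>x z. \<exists>y\<in>V. z = opair x y \<and> P x y"])
  \<comment> \<open>The quantifier over \<open>y\<close> makes \<open>y\<close> index 0 and the
    argument index 1, so the two variables of \<open>P\<close> are exchanged.\<close>
  have "definable V (\<lambda>s. P (s (case_nat 1 (case_nat 0 (\<lambda>n. Suc (Suc n))) 0))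
      (s (case_nat 1 (case_nat 0 (\<lambda>n. Suc (Suc n))) (Suc 0))))"
    using assms(2) by (rule definable_rename) (auto simp: inj_def split: nat.splits)
  then have "definable V (\<lambda>s. P (s (Suc 0)) (s 0))" by simp
  then show "definable V (\<lambda>s. \<exists>y\<in>V. s (Suc 0) = opair (s 0) y \<and> P (s 0) y)"
    by (intro definable_intros)
qed (use assms opair_in trans_in in auto)

end

section \<open>Facts on the coding that do not depend on a model, read off in the background
  model\<close>

interpretation UNIV: transitive_model "UNIV :: 'v::set_universe set"
  by unfold_locales (rule set_model_UNIV)

lemma elts_mkset_UNIV [simp]:
  fixes x y :: "'v::set_universe"
  shows "elts (mkset {} :: 'v) = {}" "elts (mkset {x}) = {x}" "elts (mkset {x, y}) = {x, y}"
    "elts (succ x) = insert x (elts x)"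
  unfolding succ_def
  by (intro is_set_inD(2)[of UNIV] UNIV.is_set_in_empty UNIV.is_set_in_singleton
      UNIV.is_set_in_pair UNIV.is_set_in_succ UNIV_I)+

lemma opair_inject [simp]:
  "opair x y = opair x' y' \<longleftrightarrow> x = x' \<and> y = (y' :: 'v::set_universe)"
proof
  assume "opair x y = opair x' y'"
  then have "elts (opair x y) = elts (opair x' y')" by simp
  then have *: "{mkset {x}, mkset {x, y}} = {mkset {x'}, mkset {x', y'}}"
    by (simp add: opair_def)
  have pair: "mkset {a, b} = mkset {c, d} \<longleftrightarrow> {a, b} = {c, d}"
    "mkset {a} = mkset {c, d} \<longleftrightarrow> {a} = {c, d}" "mkset {c, d} = mkset {a} \<longleftrightarrow> {c, d} = {a}"
    "mkset {a} = mkset {c} \<longleftrightarrow> a = c" for a b c d :: 'v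
    by (metis elts_mkset_UNIV(2,3) singleton_inject)+
  from * show "x = x' \<and> y = y'"
    unfolding doubleton_eq_iff pair by auto
qed simp

lemma opair_nonempty [simp]: "opair x y \<noteq> mkset {}" "mkset {} \<noteq> opair x (y :: 'v::set_universe)"
  by (metis elts_mkset_UNIV(1,3) insert_not_empty opair_def)+

lemma mem_irrefl [simp]: "x \<notin> elts (x :: 'v::set_universe)"
  using wf_not_refl[OF wf_elts] by simp

lemma mem_asym: "x \<in> elts y \<Longrightarrow> y \<notin> elts (x :: 'v::set_universe)"
  using wf_not_sym[OF wf_elts] by simp

lemma succ_inject [simp]: "succ x = succ y \<longleftrightarrow> x = (y :: 'v::set_universe)"
  by (metis elts_mkset_UNIV(4) insert_iff mem_asym)

lemma num_Suc: "num (Suc n) = succ (num n)"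
  by (simp add: succ_def)

lemma elts_num: "elts (num n :: 'v::set_universe) = num ` {..<n}"
  by (induction n) (auto simp: num_Suc lessThan_Suc simp del: num.simps(2))

lemma num_inject [simp]: "num m = num n \<longleftrightarrow> m = n" for m n :: nat
proof
  assume *: "num m = (num n :: 'v::set_universe)"
  show "m = n"
    by (rule ccontr) (metis * elts_num imageI lessThan_iff linorder_neqE_nat mem_irrefl)
qed simp

lemma num_neq_succ [simp]: "num 0 \<noteq> succ (x :: 'v::set_universe)" "succ x \<noteq> num 0"
  by (metis elts_mkset_UNIV(1,4) empty_not_insert num.simps(1))+

lemma tup_inject [simp]: "tup xs = tup ys \<longleftrightarrow> xs = (ys :: 'v::set_universe list)"
proof (induction xs arbitrary: ys)
  case Nil
  show ?case by (cases ys) auto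
next
  case (Cons x xs)
  then show ?case by (cases ys) auto
qed

lemma mem_opairD:
  assumes "opair x y \<in> V" "set_model V"
  shows "x \<in> V" "y \<in> (V :: 'v::set_universe set)"
proof -
  interpret transitive_model V by unfold_locales fact
  have "mkset {x, y} \<in> V" using assms(1) trans_in[of "mkset {x, y}" "opair x y"] by (simp add: opair_def)
  then show "x \<in> V" "y \<in> V" using trans_in[of _ "mkset {x, y}"] by simp_all
qed

section \<open>Inductively generated classes\<close>

text \<open>
  A fact \<open>z\<close> may be derived from a set \<open>p\<close> of facts if \<open>R z p\<close>. As in the model there is no set of
  all facts, derivability is witnessed by sets in which each element is derived from other elements.
\<close>

definition justified :: "'v::set_universe set \<Rightarrow> ('v \<Rightarrow> 'v \<Rightarrow> bool) \<Rightarrow> 'v \<Rightarrow> bool" where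
  "justified V R F \<longleftrightarrow> (\<forall>z\<in>elts F. \<exists>p\<in>V. R z p \<and> elts p \<subseteq> elts F)"

definition facts :: "'v::set_universe set \<Rightarrow> ('v \<Rightarrow> 'v \<Rightarrow> bool) \<Rightarrow> 'v set" where
  "facts V R = {z\<in>V. \<exists>F\<in>V. justified V R F \<and> z \<in> elts F}"

lemma facts_subset: "facts V R \<subseteq> V"
  unfolding facts_def by blast

context transitive_model
begin

lemma num_in: "num n \<in> V"
  by (induction n) (auto simp: num_Suc simp del: num.simps(2) intro: succ_in is_set_inD is_set_in_empty)

lemma tup_in: "set xs \<subseteq> V \<Longrightarrow> tup xs \<in> V"
  by (induction xs) (auto intro: opair_in is_set_inD is_set_in_empty)

lemma definable_justified:
  assumes "\<And>i j. definable V (\<lambda>s. R (s i) (s j))"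
  shows "definable_term V t \<Longrightarrow> definable V (\<lambda>s. justified V R (t s))"
  by (rule definable_comp1) (unfold justified_def, intro definable_intros assms)

text \<open>The purpose of the construction: derivability becomes a predicate that may be used in
  separation and replacement, although the recursion it mirrors lives outside
  \<open>V\<close>.\<close>

lemma definable_facts:
  assumes "\<And>i j. definable V (\<lambda>s. R (s i) (s j))"
  shows "definable_term V t \<Longrightarrow> definable V (\<lambda>s. t s \<in> facts V R)"
proof (rule definable_comp1[where P = "\<lambda>x. x \<in> facts V R"])
  fix i
  have "definable V (\<lambda>s. \<exists>F\<in>V. justified V R F \<and> s i \<in> elts F)"
    by (intro definable_intros definable_justified[where R = R] assms)
  then show "definable V (\<lambda>s. s i \<in> facts V R)"
    by (rule definable_cong) (auto simp: facts_def)
qed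

lemma justified_subset_facts:
  assumes "F \<in> V" "justified V R F"
  shows "elts F \<subseteq> facts V R"
  using assms elts_subset unfolding facts_def by blast

lemma facts_cases:
  assumes "z \<in> facts V R"
  obtains p where "p \<in> V" "R z p" "elts p \<subseteq> facts V R"
proof -
  obtain F where F: "F \<in> V" "justified V R F" "z \<in> elts F"
    using assms unfolding facts_def by blast
  then obtain p where "p \<in> V" "R z p" "elts p \<subseteq> elts F"
    unfolding justified_def by blast
  then show ?thesis using that justified_subset_facts[OF F(1,2)] by blast
qed

text \<open>
  If a fact has only one derivation, the intersection of all justified sets containing it is
  justified. Replacement can then collect these least sets for all the premises \<open>p\<close>.
\<close>

lemma facts_intro:
  assumes R: "\<And>i j. definable V (\<lambda>s. R (s i) (s j))"
    and det: "\<And>z p q. z \<in> facts V R \<Longrightarrow> p \<in> V \<Longrightarrow> q \<in> V \<Longrightarrow> R z p \<Longrightarrow> R z q \<Longrightarrow>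
      elts p \<subseteq> facts V R \<Longrightarrow> elts q \<subseteq> facts V R \<Longrightarrow> p = q"
    and z: "z \<in> V" "p \<in> V" "R z p" "elts p \<subseteq> facts V R"
  shows "z \<in> facts V R"
proof -
  define least where
    "least y = {x\<in>V. \<forall>F\<in>V. justified V R F \<and> y \<in> elts F \<longrightarrow> x \<in> elts F}" for y
  have least: "is_set_in V (least y)" "justified V R (mkset (least y))" "y \<in> least y"
    if y: "y \<in> facts V R" for y
  proof -
    obtain F where F: "F \<in> V" "justified V R F" "y \<in> elts F" "y \<in> V"
      using y unfolding facts_def by blast
    \<comment> \<open>A single justified \<open>F\<close> bounds the intersection, so separation
      applies although the justified sets need not form a set.\<close>
    have "is_set_in V {x\<in>elts F. \<forall>F\<in>V. justified V R F \<and> y \<in> elts F \<longrightarrow> x \<in> elts F}"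
      by (intro separation definable_intros definable_justified R F)
    also have "{x\<in>elts F. \<forall>F\<in>V. justified V R F \<and> y \<in> elts F \<longrightarrow> x \<in> elts F} = least y"
      using F elts_subset[OF F(1)] unfolding least_def by blast
    finally show *: "is_set_in V (least y)" .
    show "y \<in> least y" unfolding least_def using F(4) by blast
    show "justified V R (mkset (least y))"
      unfolding justified_def is_set_inD(2)[OF *]
    proof
      fix x assume x: "x \<in> least y"
      then have "x \<in> elts F" using F unfolding least_def by blast
      then obtain q where q: "q \<in> V" "R x q" "elts q \<subseteq> elts F"
        using F(2) unfolding justified_def by blast
      have "elts q \<subseteq> elts G" if G: "G \<in> V" "justified V R G" "y \<in> elts G" for G
      proof -
        have "x \<in> elts G" using x G unfolding least_def by blast
        then obtain r where r: "r \<in> V" "R x r" "elts r \<subseteq> elts G"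
          using G(2) unfolding justified_def by blast
        have "q = r"
          using det[of x q r] q r justified_subset_facts[OF F(1,2)] justified_subset_facts[OF G(1,2)]
            \<open>x \<in> elts F\<close> by blast
        then show ?thesis using r(3) by simp
      qed
      then have "elts q \<subseteq> least y"
        using elts_subset[OF q(1)] unfolding least_def by blast
      with q show "\<exists>q\<in>V. R x q \<and> elts q \<subseteq> least y" by blast
    qed
  qed
  define U where "U = (\<Union>y\<in>elts p. elts (mkset (least y)))"
  have "is_set_in V ((\<lambda>y. mkset (least y)) ` elts p)"
  proof (rule replacement[where P = "\<lambda>y G. \<forall>x\<in>V. x \<in> elts G \<longleftrightarrow>
        (\<forall>F\<in>V. justified V R F \<and> y \<in> elts F \<longrightarrow> x \<in> elts F)"])
    fix y G assume "y \<in> elts p" "G \<in> V"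
    have "G = mkset (least y) \<longleftrightarrow> elts G = least y"
      using least(1)[of y] \<open>y \<in> elts p\<close> z(4) by (metis is_set_inD(2) mkset_elts subsetD)
    then show "(\<forall>x\<in>V. x \<in> elts G \<longleftrightarrow>
        (\<forall>F\<in>V. justified V R F \<and> y \<in> elts F \<longrightarrow> x \<in> elts F)) \<longleftrightarrow> G = mkset (least y)"
      using elts_subset[OF \<open>G \<in> V\<close>] unfolding least_def by blast
  qed (use least z in \<open>auto intro!: definable_intros definable_justified R is_set_inD\<close>)
  then have U: "is_set_in V U" unfolding U_def by (rule is_set_in_UN)
  have F: "is_set_in V (insert z U)" by (intro is_set_in_insert z U)
  have U_eq: "U = (\<Union>y\<in>elts p. least y)"
    unfolding U_def using least(1) z(4) by (intro SUP_cong refl is_set_inD(2)) blast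
  have "elts p \<subseteq> U"
    unfolding U_eq using least(3) z(4) by blast
  have "justified V R (mkset (insert z U))"
    unfolding justified_def is_set_inD(2)[OF F]
  proof
    fix x assume "x \<in> insert z U"
    then consider "x = z" | y where "y \<in> elts p" "x \<in> least y" unfolding U_eq by blast
    then show "\<exists>q\<in>V. R x q \<and> elts q \<subseteq> insert z U"
    proof cases
      case 1
      then show ?thesis using z \<open>elts p \<subseteq> U\<close> by blast
    next
      case 2
      then have "y \<in> facts V R" using z(4) by blast
      with 2(2) least(1,2)[of y] obtain q where "q \<in> V" "R x q" "elts q \<subseteq> least y"
        unfolding justified_def by (metis is_set_inD(2))
      then show ?thesis using 2(1) unfolding U_eq by blast
    qed
  qed
  then show ?thesis
    using justified_subset_facts[OF is_set_inD(1)[OF F]] is_set_inD(2)[OF F] by blast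
qed

end

section \<open>The set of structures\<close>

definition tuples :: "'v::set_universe \<Rightarrow> nat \<Rightarrow> 'v set" where
  "tuples X n = {tup a | a. length a = n \<and> set a \<subseteq> elts X}"

lemma tuples_0: "tuples X 0 = {mkset {}}"
  unfolding tuples_def by auto

lemma tuples_Suc: "tuples X (Suc n) = {opair x t | x t. x \<in> elts X \<and> t \<in> tuples X n}"
proof (intro set_eqI iffI)
  fix z assume "z \<in> tuples X (Suc n)"
  then obtain a where "z = tup a" "length a = Suc n" "set a \<subseteq> elts X" unfolding tuples_def by blast
  then show "z \<in> {opair x t | x t. x \<in> elts X \<and> t \<in> tuples X n}"
    unfolding tuples_def by (cases a) auto
next
  fix z assume "z \<in> {opair x t | x t. x \<in> elts X \<and> t \<in> tuples X n}"
  then obtain x a where "z = tup (x # a)" "length (x # a) = Suc n" "set (x # a) \<subseteq> elts X"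
    unfolding tuples_def by auto
  then show "z \<in> tuples X (Suc n)" unfolding tuples_def by blast
qed

text \<open>The atomic statements over \<open>X\<close>: the structures of \<open>V\<close> are
  those subsets of \<open>base L X\<close> that belong to \<open>V\<close>.\<close>

definition base :: "'v::set_universe \<Rightarrow> 'v \<Rightarrow> 'v set" where
  "base L X = {opair R (tup a) | R a. opair R (num (length a)) \<in> elts L \<and> set a \<subseteq> elts X}"

text \<open>Derives the pairs of \<open>n\<close> and the set of \<open>n\<close>-tuples. Arities
  are unbounded, so the set of all tuples is obtained by replacement along this sequence. Here
  \<open>num 0\<close> is the number zero, the empty tuple and, as a value of \<open>p\<close>, the
  empty set of premises.\<close>

definition pow_rule :: "'v::set_universe set \<Rightarrow> 'v \<Rightarrow> 'v \<Rightarrow> 'v \<Rightarrow> bool" where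
  "pow_rule V X z p \<longleftrightarrow>
     z = opair (num 0) (mkset {num 0}) \<and> p = num 0 \<or>
     (\<exists>i\<in>V. \<exists>w\<in>V. z = opair (succ i) (prd X w) \<and> p = mkset {opair i w})"

section \<open>Natural numbers, products and finite powers in the model\<close>

context transitive_model
begin

text \<open>The axiom of infinity gives an inductive set, and the intersection \<open>W\<close> of
  all inductive sets of \<open>V\<close> contains every numeral. A membership-minimal element
  \<open>x\<close> of \<open>W\<close> that is no numeral would be neither zero nor the successor of
  an element of \<open>W\<close>, so \<open>W - {x}\<close> would still be inductive. Thus
  well-foundedness in the background makes the natural numbers of \<open>V\<close> standard.\<close>

lemma is_set_in_omega: "is_set_in V (range num)"
proof -
  define ind where "ind u \<longleftrightarrow> num 0 \<in> elts u \<and> (\<forall>x\<in>elts u. succ x \<in> elts u)" for u :: 'v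
  obtain w where w: "w \<in> V" "\<exists>e\<in>V. e \<in> elts w \<and> (\<forall>x\<in>V. x \<notin> elts e)"
    "\<forall>x\<in>V. x \<in> elts w \<longrightarrow> (\<exists>y\<in>V. y \<in> elts w \<and> (\<forall>z\<in>V. z \<in> elts y \<longleftrightarrow> z \<in> elts x \<or> z = x))"
    using zfc[unfolded zfc_model_def, THEN conjunct2, THEN conjunct2, THEN conjunct2, THEN conjunct2,
      THEN conjunct2, THEN conjunct1] by (rule bexE) (erule conjE, rule that)
  have "ind w"
    unfolding ind_def
  proof (intro conjI ballI)
    obtain e where e: "e \<in> V" "e \<in> elts w" "\<forall>x\<in>V. x \<notin> elts e" using w(2) by blast
    then have "elts e = elts (num 0)" using elts_subset[OF e(1)] by auto
    with e(2) show "num 0 \<in> elts w" by (metis mkset_elts)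
  next
    fix x assume x: "x \<in> elts w"
    then obtain y where y: "y \<in> V" "y \<in> elts w" "\<forall>z\<in>V. z \<in> elts y \<longleftrightarrow> z \<in> elts x \<or> z = x"
      using w(3) trans_in[OF x w(1)] by blast
    then have "elts y = elts (succ x)"
      using elts_subset[OF y(1)] elts_subset[OF trans_in[OF x w(1)]] trans_in[OF x w(1)] by auto
    with y(2) show "succ x \<in> elts w" by (metis mkset_elts)
  qed
  have ind_num: "num n \<in> elts u" if "ind u" for u n
    using that unfolding ind_def by (induction n) (simp_all add: num_Suc del: num.simps)
  define W where "W = {x\<in>elts w. \<forall>u\<in>V. ind u \<longrightarrow> x \<in> elts u}"
  have definable_ind: "definable V (\<lambda>s. ind (s i))" for i
    unfolding ind_def by (intro definable_intros num_in)
  have W: "is_set_in V W"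
    unfolding W_def by (intro separation definable_intros definable_ind w(1))
  have W_ind: "num 0 \<in> W" "x \<in> W \<Longrightarrow> succ x \<in> W" for x
    using \<open>ind w\<close> unfolding W_def ind_def by blast+
  have "range num \<subseteq> W"
    unfolding W_def using ind_num \<open>ind w\<close> by blast
  moreover have "W \<subseteq> range num"
  proof (rule ccontr)
    assume "\<not> W \<subseteq> range num"
    then obtain x0 where "x0 \<in> W - range num" by blast
    then obtain x where x: "x \<in> W - range num" and min: "\<And>y. y \<in> elts x \<Longrightarrow> y \<notin> W - range num"
      by (rule wfE_min[OF wf_elts]) simp
    have D: "is_set_in V (W - {x})"
      using separation[OF _ is_set_inD(1)[OF W], of "\<lambda>y. y \<noteq> x"] x trans_in[OF _ is_set_inD(1)[OF W], of x]
      by (simp add: is_set_inD(2)[OF W] set_diff_eq definable_intros)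
    have "succ y \<noteq> x" if "y \<in> W" for y
    proof
      assume "succ y = x"
      then have "y \<in> elts x" by auto
      then have "y \<in> range num" using min that by blast
      then obtain n where "y = num n" by blast
      then show False using \<open>succ y = x\<close> x by (metis DiffD2 num_Suc rangeI)
    qed
    then have "ind (mkset (W - {x}))"
      unfolding ind_def is_set_inD(2)[OF D] using W_ind x by blast
    then show False
      using x is_set_inD[OF D] unfolding W_def by blast
  qed
  ultimately show ?thesis using W by simp
qed

lemma is_set_in_prd:
  assumes "A \<in> V" "B \<in> V"
  shows "is_set_in V {opair x y | x y. x \<in> elts A \<and> y \<in> elts B}"
proof -
  have row: "is_set_in V (opair x ` elts B)" if "x \<in> V" for x
    by (rule replacement[where P = "\<lambda>y z. z = opair x y"])
      (use that assms in \<open>auto intro!: definable_intros opair_in intro: trans_in\<close>)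
  have "is_set_in V ((\<lambda>x. mkset (opair x ` elts B)) ` elts A)"
  proof (rule replacement[where P = "\<lambda>x z. \<forall>w\<in>V. w \<in> elts z \<longleftrightarrow> (\<exists>y\<in>elts B. w = opair x y)"])
    fix x z assume x: "x \<in> elts A" and z: "z \<in> V"
    have row: "is_set_in V (opair x ` elts B)" using row trans_in[OF x assms(1)] .
    have "z = mkset (opair x ` elts B) \<longleftrightarrow> elts z = opair x ` elts B"
      by (metis is_set_inD(2)[OF row] mkset_elts)
    moreover have "opair x ` elts B \<subseteq> V"
      using elts_subset[OF is_set_inD(1)[OF row]] is_set_inD(2)[OF row] by simp
    ultimately show "(\<forall>w\<in>V. w \<in> elts z \<longleftrightarrow> (\<exists>y\<in>elts B. w = opair x y)) \<longleftrightarrow>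
        z = mkset (opair x ` elts B)"
      using elts_subset[OF z] by blast
  next
    show "definable V (\<lambda>s. \<forall>w\<in>V. w \<in> elts (s (Suc 0)) \<longleftrightarrow> (\<exists>y\<in>elts B. w = opair (s 0) y))"
      by (intro definable_intros assms)
  next
    fix x assume "x \<in> elts A"
    then show "mkset (opair x ` elts B) \<in> V"
      using row[OF trans_in[OF _ assms(1)]] is_set_inD(1) by blast
  qed fact
  then have "is_set_in V (\<Union>x\<in>elts A. elts (mkset (opair x ` elts B)))"
    by (rule is_set_in_UN)
  also have "(\<Union>x\<in>elts A. elts (mkset (opair x ` elts B))) = (\<Union>x\<in>elts A. opair x ` elts B)"
    using is_set_inD(2)[OF row[OF trans_in[OF _ assms(1)]]] by simp
  also have "\<dots> = {opair x y | x y. x \<in> elts A \<and> y \<in> elts B}" by blast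
  finally show ?thesis .
qed

lemmas prd_in = is_set_in_prd[THEN is_set_inD(1), folded prd_def]

lemma elts_prd: "elts (prd A B) = {opair x y | x y. x \<in> elts A \<and> y \<in> elts B}"
  unfolding prd_def
  by (rule is_set_inD(2)[of UNIV, OF transitive_model.is_set_in_prd]) (auto simp: UNIV.transitive_model_axioms)

lemma definable_term_prd [definable_intros]: "definable_term V t \<Longrightarrow> definable_term V u \<Longrightarrow> definable_term V (\<lambda>s. prd (t s) (u s))"
proof (rule definable_term_comp2[where F = prd])
  fix i j k :: nat
  have "definable V (\<lambda>s. \<forall>w\<in>V. w \<in> elts (s i) \<longleftrightarrow> (\<exists>x\<in>elts (s j). \<exists>y\<in>elts (s k). w = opair x y))"
    by (intro definable_intros)
  then show "definable V (\<lambda>s. s i = prd (s j) (s k))"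
  proof (rule definable_cong)
    fix s :: "nat \<Rightarrow> 'v" assume "range s \<subseteq> V"
    then have s: "s n \<in> V" for n by blast
    have "s i = prd (s j) (s k) \<longleftrightarrow> elts (s i) = elts (prd (s j) (s k))"
      by (simp add: elts_inject)
    then show "(\<forall>w\<in>V. w \<in> elts (s i) \<longleftrightarrow> (\<exists>x\<in>elts (s j). \<exists>y\<in>elts (s k). w = opair x y))
        \<longleftrightarrow> s i = prd (s j) (s k)"
      using elts_subset[OF s[of i]] elts_subset[OF prd_in[OF s s], of j k] unfolding elts_prd by blast
  qed
qed (rule prd_in)

lemma is_set_in_tuples: "X \<in> V \<Longrightarrow> is_set_in V (tuples X n)"
proof (induction n)
  case 0
  then show ?case
    unfolding tuples_0 by (intro is_set_in_singleton is_set_inD is_set_in_empty)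
next
  case (Suc n)
  then have "is_set_in V (elts (prd X (mkset (tuples X n))))"
    by (intro is_set_in_elts prd_in is_set_inD)
  then show ?case
    unfolding tuples_Suc elts_prd using Suc by (simp add: is_set_inD(2))
qed

lemma prd_tuples: "X \<in> V \<Longrightarrow> prd X (mkset (tuples X n)) = mkset (tuples X (Suc n))"
  unfolding tuples_Suc prd_def using is_set_inD(2)[OF is_set_in_tuples] by simp

lemma definable_pow_facts:
  assumes "X \<in> V" "definable_term V t"
  shows "definable V (\<lambda>s. t s \<in> facts V (pow_rule V X))"
  by (rule definable_facts) (unfold pow_rule_def, intro definable_intros assms num_in, rule assms)

text \<open>A point of \<open>X\<close> recovers \<open>w\<close> from \<open>prd X w\<close>; hence
  a fact has only one set of premises, as \<open>facts_intro\<close> requires.\<close>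

lemma pow_facts_intro:
  assumes "X \<in> V" "elts X \<noteq> {}" "z \<in> V" "p \<in> V" "pow_rule V X z p"
    "elts p \<subseteq> facts V (pow_rule V X)"
  shows "z \<in> facts V (pow_rule V X)"
proof (rule facts_intro[OF _ _ assms(3-)])
  show "definable V (\<lambda>s. pow_rule V X (s i) (s j))" for i j
    unfolding pow_rule_def by (intro definable_intros assms num_in)
  fix z p q assume "pow_rule V X z p" "pow_rule V X z q"
  moreover have inj: "v = w" if "prd X v = prd X w" for v w
  proof -
    obtain x where "x \<in> elts X" using assms(2) by blast
    then have "y \<in> elts v \<longleftrightarrow> y \<in> elts w" for y
      using arg_cong[OF that, of "\<lambda>A. opair x y \<in> elts A"] unfolding elts_prd by auto
    then show ?thesis using elts_inject by blast
  qed
  ultimately show "p = q"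
    unfolding pow_rule_def by (auto simp del: num.simps dest!: inj)
qed

lemma pow_facts_iff:
  assumes "X \<in> V" "elts X \<noteq> {}"
  shows "opair (num n) v \<in> facts V (pow_rule V X) \<longleftrightarrow> v = mkset (tuples X n)"
proof (induction n arbitrary: v)
  case 0
  show ?case
  proof
    assume "opair (num 0) v \<in> facts V (pow_rule V X)"
    then obtain p where "pow_rule V X (opair (num 0) v) p" by (rule facts_cases)
    then show "v = mkset (tuples X 0)"
      unfolding pow_rule_def tuples_0 num.simps(1)[symmetric] by (auto simp del: num.simps)
  next
    assume "v = mkset (tuples X 0)"
    then have "pow_rule V X (opair (num 0) v) (num 0)" "v \<in> V"
      unfolding pow_rule_def tuples_0 by (auto intro: is_set_inD is_set_in_singleton is_set_in_empty)
    then show "opair (num 0) v \<in> facts V (pow_rule V X)"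
      by (intro pow_facts_intro[OF assms, of _ "num 0"] opair_in num_in) auto
  qed
next
  case (Suc n)
  show ?case
  proof
    assume "opair (num (Suc n)) v \<in> facts V (pow_rule V X)"
    then obtain p where "pow_rule V X (opair (num (Suc n)) v) p" "elts p \<subseteq> facts V (pow_rule V X)"
      by (rule facts_cases)
    then obtain w where "v = prd X w" "opair (num n) w \<in> facts V (pow_rule V X)"
      unfolding pow_rule_def num_Suc by (auto simp del: num.simps)
    then show "v = mkset (tuples X (Suc n))" using Suc prd_tuples[OF assms(1)] by simp
  next
    assume v: "v = mkset (tuples X (Suc n))"
    let ?w = "mkset (tuples X n)"
    have w: "?w \<in> V" using is_set_inD(1)[OF is_set_in_tuples[OF assms(1)]] .
    have "pow_rule V X (opair (num (Suc n)) v) (mkset {opair (num n) ?w})"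
      unfolding pow_rule_def num_Suc v prd_tuples[OF assms(1), symmetric] using num_in w by blast
    moreover have "v \<in> V" unfolding v using is_set_inD(1)[OF is_set_in_tuples[OF assms(1)]] .
    ultimately show "opair (num (Suc n)) v \<in> facts V (pow_rule V X)"
      using Suc[of ?w] w
      by (intro pow_facts_intro[OF assms, of _ "mkset {opair (num n) ?w}"] opair_in num_in)
        (auto intro: is_set_inD is_set_in_singleton opair_in num_in)
  qed
qed

lemma is_set_in_base:
  assumes "X \<in> V" "elts X \<noteq> {}" "L \<in> V"
  shows "is_set_in V (base L X)"
proof -
  let ?F = "facts V (pow_rule V X)"
  define \<omega> where "\<omega> = mkset (range num :: 'v set)"
  have \<omega>: "\<omega> \<in> V" "elts \<omega> = range num"
    unfolding \<omega>_def using is_set_inD[OF is_set_in_omega] by auto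
  have T: "mkset (tuples X n) \<in> V" "elts (mkset (tuples X n)) = tuples X n" for n
    using is_set_inD[OF is_set_in_tuples[OF assms(1)]] by auto
  define f where "f c = mkset (tuples X (inv num c))" for c :: 'v
  have f: "f (num n) = mkset (tuples X n)" for n
    unfolding f_def by (simp add: inj_def inv_f_f)
  \<comment> \<open>Derivability provides the formula for the graph of the sequence of powers, to
    which replacement is applied.\<close>
  have "is_set_in V (f ` elts \<omega>)"
  proof (rule replacement[where P = "\<lambda>c v. opair c v \<in> ?F"])
    show "definable V (\<lambda>s. opair (s 0) (s (Suc 0)) \<in> ?F)"
      by (intro definable_pow_facts definable_intros assms)
  qed (use \<omega> f T pow_facts_iff[OF assms(1,2)] in auto)
  then have TS: "is_set_in V (\<Union>c\<in>elts \<omega>. elts (f c))" by (rule is_set_in_UN)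
  define S where "S = mkset (\<Union>c\<in>elts \<omega>. elts (f c))"
  have S: "S \<in> V" "\<And>a. set a \<subseteq> elts X \<Longrightarrow> tup a \<in> elts S"
    unfolding S_def using is_set_inD[OF TS] \<omega>(2) f T(2) by (auto simp: tuples_def)
  \<comment> \<open>Since \<open>{R}\<close> is an element of \<open>opair R c\<close>, every
    relation symbol lies in the double union of \<open>L\<close>.\<close>
  define U where "U = mkset (\<Union> (elts ` elts (mkset (\<Union> (elts ` elts L)))))"
  have "is_set_in V (\<Union> (elts ` elts L))"
    by (rule is_set_in_Union[OF assms(3)])
  note U1 = is_set_inD[OF this]
  note U2 = is_set_inD[OF is_set_in_Union[OF U1(1)], folded U_def, unfolded U1(2)]
  have U: "R \<in> elts U" if "opair R c \<in> elts L" for R c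
  proof -
    have "mkset {R} \<in> elts (opair R c)" by (simp add: opair_def)
    then show ?thesis unfolding U2(2) using that by force
  qed
  \<comment> \<open>The candidates come from \<open>prd U S\<close>; the condition matches the arity
    of \<open>R\<close> with the length of the tuple.\<close>
  have "is_set_in V {z\<in>elts (prd U S). \<exists>R\<in>V. \<exists>t\<in>V. \<exists>c\<in>elts \<omega>. \<exists>v\<in>V.
      z = opair R t \<and> opair R c \<in> elts L \<and> opair c v \<in> ?F \<and> t \<in> elts v}"
    by (intro separation definable_intros definable_pow_facts assms \<omega> prd_in U2 S)
  also have "{z\<in>elts (prd U S). \<exists>R\<in>V. \<exists>t\<in>V. \<exists>c\<in>elts \<omega>. \<exists>v\<in>V.
      z = opair R t \<and> opair R c \<in> elts L \<and> opair c v \<in> ?F \<and> t \<in> elts v} = base L X" (is "?A = _")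
  proof (intro set_eqI iffI)
    fix z assume "z \<in> ?A"
    then obtain R t n where "z = opair R t" "opair R (num n) \<in> elts L" "t \<in> tuples X n"
      using \<omega>(2) pow_facts_iff[OF assms(1,2)] T(2) by auto
    then show "z \<in> base L X" unfolding base_def tuples_def by blast
  next
    fix z assume "z \<in> base L X"
    then obtain R a where z: "z = opair R (tup a)" "opair R (num (length a)) \<in> elts L" "set a \<subseteq> elts X"
      unfolding base_def by blast
    have "R \<in> elts U" "tup a \<in> elts S" using U[OF z(2)] S(2)[OF z(3)] by auto
    moreover have "R \<in> V" "tup a \<in> V"
      using trans_in[OF \<open>R \<in> elts U\<close> U2(1)] trans_in[OF \<open>tup a \<in> elts S\<close> S(1)] by auto
    moreover have "tup a \<in> elts (mkset (tuples X (length a)))"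
      unfolding T(2) using z(3) by (auto simp: tuples_def)
    ultimately show "z \<in> ?A"
      using z pow_facts_iff[OF assms(1,2), of "length a"] T(1) \<omega>(2) unfolding elts_prd
      by blast
  qed
  finally show ?thesis .
qed

lemma is_set_in_Str:
  assumes "X \<in> V" "elts X \<noteq> {}" "L \<in> V"
  shows "is_set_in V (Str V L X)"
  using is_set_in_Pow[OF is_set_inD(1)[OF is_set_in_base[OF assms]]] is_set_inD(2)[OF is_set_in_base[OF assms]]
  unfolding Str_def base_def by simp

end

section \<open>Definability of the interpretation of codes\<close>

text \<open>
  The fact \<open>code_fact c t a v\<close> says that the object with code \<open>c\<close>, evaluated at the tuple \<open>a\<close>,
  has the value \<open>v\<close>; here \<open>c\<close> is a variable (\<open>t = 0\<close>), a list of variables (\<open>t = 1\<close>), a literal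
  (\<open>t = 2\<close>), a conjunction of literals (\<open>t = 3\<close>) or, with the dummy tuple \<open>num 0\<close>, a code of
  \<open>codes\<close> (\<open>t = 4\<close>). The values for \<open>t \<ge> 2\<close> are subsets of the set \<open>S\<close> of structures.
\<close>

definition code_fact :: "'v::set_universe \<Rightarrow> nat \<Rightarrow> 'v \<Rightarrow> 'v \<Rightarrow> 'v" where
  "code_fact c t a v = opair c (opair (num t) (opair a v))"

text \<open>The sets of premises for the two infinitary connectives. Each member of \<Gamma> gets at
  least one value; that it gets only one is a consequence of \<open>code_facts_unique\<close> for
  derivable facts.\<close>

definition family_of :: "'v::set_universe set \<Rightarrow> 'v \<Rightarrow> 'v \<Rightarrow> bool" where
  "family_of V \<Gamma> p \<longleftrightarrow>
     (\<forall>y\<in>elts p. \<exists>\<gamma>\<in>elts \<Gamma>. \<exists>w\<in>V. y = code_fact \<gamma> 4 (num 0) w) \<and>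
     (\<forall>\<gamma>\<in>elts \<Gamma>. \<exists>w\<in>V. code_fact \<gamma> 4 (num 0) w \<in> elts p)"

text \<open>One clause for each step of the evaluation: variables, lists of variables, the three
  forms of literals, conjunctions, basic codes and the three connectives. Splitting it this finely
  makes every clause first-order, while \<open>tup\<close>, \<open>holds\<close> and
  \<open>denotes\<close> are recursions outside the model. The kind \<open>t\<close> separates
  objects with overlapping codes, such as an equality literal and a negated code, both tagged
  \<open>num 1\<close>.\<close>

definition code_rule :: "'v::set_universe set \<Rightarrow> 'v \<Rightarrow> 'v \<Rightarrow> 'v \<Rightarrow> bool" where
  "code_rule V S z p \<longleftrightarrow>
     (\<exists>y\<in>V. \<exists>r\<in>V. z = code_fact (num 0) 0 (opair y r) y \<and> p = num 0) \<or>
     (\<exists>i\<in>V. \<exists>x\<in>V. \<exists>r\<in>V. \<exists>y\<in>V.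
        z = code_fact (succ i) 0 (opair x r) y \<and> p = mkset {code_fact i 0 r y}) \<or>
     (\<exists>a\<in>V. z = code_fact (num 0) 1 a (num 0) \<and> p = num 0) \<or>
     (\<exists>i\<in>V. \<exists>is\<in>V. \<exists>a\<in>V. \<exists>y\<in>V. \<exists>ys\<in>V.
        z = code_fact (opair i is) 1 a (opair y ys) \<and>
        p = mkset {code_fact i 0 a y, code_fact is 1 a ys}) \<or>
     (\<exists>R\<in>V. \<exists>is\<in>V. \<exists>a\<in>V. \<exists>ys\<in>V.
        z = code_fact (opair (num 0) (opair R is)) 2 a (mkset {M\<in>elts S. opair R ys \<in> elts M}) \<and>
        p = mkset {code_fact is 1 a ys}) \<or>
     (\<exists>i\<in>V. \<exists>j\<in>V. \<exists>a\<in>V. \<exists>x\<in>V. \<exists>y\<in>V.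
        z = code_fact (opair (num 1) (opair i j)) 2 a (mkset {M\<in>elts S. x = y}) \<and>
        p = mkset {code_fact i 0 a x, code_fact j 0 a y}) \<or>
     (\<exists>e\<in>V. \<exists>a\<in>V. \<exists>w\<in>V.
        z = code_fact (opair (num 2) e) 2 a (mkset {M\<in>elts S. M \<notin> elts w}) \<and>
        p = mkset {code_fact e 2 a w}) \<or>
     (\<exists>a\<in>V. z = code_fact (num 0) 3 a S \<and> p = num 0) \<or>
     (\<exists>e\<in>V. \<exists>es\<in>V. \<exists>a\<in>V. \<exists>u\<in>V. \<exists>w\<in>V.
        z = code_fact (opair e es) 3 a (mkset {M\<in>elts S. M \<in> elts u \<and> M \<in> elts w}) \<and>
        p = mkset {code_fact e 2 a u, code_fact es 3 a w}) \<or>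
     (\<exists>es\<in>V. \<exists>a\<in>V. \<exists>w\<in>V.
        z = code_fact (opair (num 0) (opair es a)) 4 (num 0) w \<and> p = mkset {code_fact es 3 a w}) \<or>
     (\<exists>\<gamma>\<in>V. \<exists>w\<in>V.
        z = code_fact (opair (num 1) \<gamma>) 4 (num 0) (mkset {M\<in>elts S. M \<notin> elts w}) \<and>
        p = mkset {code_fact \<gamma> 4 (num 0) w}) \<or>
     (\<exists>\<Gamma>\<in>V. family_of V \<Gamma> p \<and>
        z = code_fact (opair (num 2) \<Gamma>) 4 (num 0)
          (mkset {M\<in>elts S. \<exists>y\<in>elts p. \<exists>\<gamma>\<in>V. \<exists>w\<in>V. y = code_fact \<gamma> 4 (num 0) w \<and> M \<in> elts w})) \<or>
     (\<exists>\<Gamma>\<in>V. family_of V \<Gamma> p \<and>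
        z = code_fact (opair (num 3) \<Gamma>) 4 (num 0)
          (mkset {M\<in>elts S. \<forall>y\<in>elts p. \<forall>\<gamma>\<in>V. \<forall>w\<in>V. y = code_fact \<gamma> 4 (num 0) w \<longrightarrow> M \<in> elts w}))"

section \<open>Uniqueness of the derived values\<close>

definition below :: "('v::set_universe \<times> 'v) set" where
  "below = {(x, y). x \<in> elts y}\<^sup>+"

lemma wf_below: "wf below"
  unfolding below_def by (rule wf_trancl[OF wf_elts])

lemma below_trans: "(x, y) \<in> below \<Longrightarrow> (y, z) \<in> below \<Longrightarrow> (x, z) \<in> below"
  unfolding below_def by (rule trancl_trans)

lemma below_elts: "x \<in> elts y \<Longrightarrow> (x, y) \<in> below"
  unfolding below_def by blast

lemma below_opair: "(x, opair x y) \<in> below" "(y, opair x y) \<in> below"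
  by (rule below_trans[OF below_elts below_elts, of _ "mkset {x, y}"]; simp add: opair_def)+

lemma below_opair2: "(x, opair u (opair x y)) \<in> below" "(y, opair u (opair x y)) \<in> below"
  by (rule below_trans[OF below_opair(1) below_opair(2)], rule below_trans[OF below_opair(2) below_opair(2)])

lemma below_opair_elts: "x \<in> elts y \<Longrightarrow> (x, opair u y) \<in> below"
  by (rule below_trans[OF below_elts below_opair(2)])

lemmas belows = below_opair below_opair2 below_opair_elts below_elts

lemma num_0_neq_opair [simp]: "num 0 \<noteq> opair x (y :: 'v::set_universe)" "opair x y \<noteq> num 0"
  by simp_all

lemma code_fact_inject [simp]:
  "code_fact c t a v = code_fact c' t' a' v' \<longleftrightarrow> c = c' \<and> t = t' \<and> a = a' \<and> v = (v' :: 'v::set_universe)"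
  unfolding code_fact_def by auto

context transitive_model
begin

lemma mkset_empty_in [simp]: "mkset {} \<in> V"
  by (rule is_set_inD[OF is_set_in_empty])

lemma code_fact_in: "c \<in> V \<Longrightarrow> a \<in> V \<Longrightarrow> v \<in> V \<Longrightarrow> code_fact c t a v \<in> V"
  unfolding code_fact_def by (intro opair_in num_in)

lemma code_factD:
  assumes "code_fact c t a v \<in> V"
  shows "c \<in> V" "a \<in> V" "v \<in> V"
  using assms mem_opairD[OF _ model] unfolding code_fact_def by blast+

lemma definable_term_code_fact [definable_intros]:
  "definable_term V c \<Longrightarrow> definable_term V a \<Longrightarrow> definable_term V v \<Longrightarrow> definable_term V (\<lambda>s. code_fact (c s) t (a s) (v s))"
  unfolding code_fact_def by (intro definable_intros num_in)

lemma definable_code_rule: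
  assumes "S \<in> V"
  shows "definable V (\<lambda>s. code_rule V S (s i) (s j))"
  unfolding code_rule_def family_of_def by (intro definable_intros num_in assms)

lemma family_of_eq:
  assumes "family_of V \<Gamma> p" "family_of V \<Gamma> q" "elts p \<subseteq> I" "elts q \<subseteq> I"
    and fn: "\<And>\<gamma> v w. \<gamma> \<in> elts \<Gamma> \<Longrightarrow> code_fact \<gamma> 4 (num 0) v \<in> I \<Longrightarrow> code_fact \<gamma> 4 (num 0) w \<in> I \<Longrightarrow> v = w"
  shows "p = q"
proof -
  have "elts p \<subseteq> elts q" if pq: "family_of V \<Gamma> p" "family_of V \<Gamma> q" "elts p \<subseteq> I" "elts q \<subseteq> I" for p q
  proof
    fix y assume y: "y \<in> elts p"
    with pq(1) obtain \<gamma> w where w: "\<gamma> \<in> elts \<Gamma>" "y = code_fact \<gamma> 4 (num 0) w"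
      unfolding family_of_def by blast
    with pq(2) obtain w' where "code_fact \<gamma> 4 (num 0) w' \<in> elts q"
      unfolding family_of_def by blast
    then show "y \<in> elts q" using fn[OF w(1), of w w'] w y pq(3,4) by blast
  qed
  then show ?thesis using assms(1-4) elts_inject by (metis subset_antisym)
qed

text \<open>The shape of \<open>c\<close> together with \<open>t\<close> singles out the clause, and
  the induction hypothesis fixes the values in the premises. Equality of the values serves
  \<open>code_facts_unique\<close>, equality of the sets of premises serves
  \<open>facts_intro\<close>.\<close>

lemma code_rule_unique:
  assumes IH: "\<And>c' t a v w. (c', c) \<in> below \<Longrightarrow> code_fact c' t a v \<in> I \<Longrightarrow> code_fact c' t a w \<in> I \<Longrightarrow> v = w"
    and p: "code_rule V S (code_fact c t a v) p" "elts p \<subseteq> I"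
    and q: "code_rule V S (code_fact c t a w) q" "elts q \<subseteq> I"
  shows "v = w \<and> p = q"
proof -
  have fam: "p = q" if "c = opair u \<Gamma>" "family_of V \<Gamma> p" "family_of V \<Gamma> q" for u \<Gamma>
    by (rule family_of_eq[OF that(2,3) p(2) q(2)]) (use IH that(1) belows in blast)
  show ?thesis
    using p(1) unfolding code_rule_def[of V S _ p]
    \<comment> \<open>With the clause for \<open>p\<close> fixed, injectivity of the coding leaves
      only the same clause for \<open>q\<close>.\<close>
    apply (elim disjE bexE conjE)
                apply (insert p(2) q fam)
                apply (simp_all del: num.simps add: code_rule_def[of V S _ q])
           apply (auto simp del: num.simps)
    apply (metis IH below_opair below_opair2 below_elts elts_mkset_UNIV(4) insertI1)+
    done
qed

text \<open>A justified set might support itself in a circle, so uniqueness is not immediate from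
  the definition. It holds because every premise concerns a code that is lower with respect to
  \<open>below\<close>.\<close>

lemma code_facts_unique:
  assumes "code_fact c t a v \<in> facts V (code_rule V S)" "code_fact c t a w \<in> facts V (code_rule V S)"
  shows "v = w"
  using assms
proof (induction c arbitrary: t a v w rule: wf_induct_rule[OF wf_below])
  case (1 c)
  from 1(2) obtain p where p: "code_rule V S (code_fact c t a v) p" "elts p \<subseteq> facts V (code_rule V S)"
    by (rule facts_cases)
  from 1(3) obtain q where q: "code_rule V S (code_fact c t a w) q" "elts q \<subseteq> facts V (code_rule V S)"
    by (rule facts_cases)
  show ?case
    using code_rule_unique[where I = "facts V (code_rule V S)", OF _ p q] 1(1) by blast
qed

lemma code_facts_intro:
  assumes "S \<in> V" "z \<in> V" "p \<in> V" "code_rule V S z p" "elts p \<subseteq> facts V (code_rule V S)"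
  shows "z \<in> facts V (code_rule V S)"
proof (rule facts_intro[OF definable_code_rule[OF assms(1)] _ assms(2-)])
  fix z p q assume pq: "code_rule V S z p" "code_rule V S z q"
    "elts p \<subseteq> facts V (code_rule V S)" "elts q \<subseteq> facts V (code_rule V S)"
  obtain c t a v where "z = code_fact c t a v"
    using pq(1) unfolding code_rule_def by blast
  then show "p = q"
    using code_rule_unique[where I = "facts V (code_rule V S)"] pq code_facts_unique by blast
qed

lemma definable_code_facts:
  "S \<in> V \<Longrightarrow> definable_term V t \<Longrightarrow> definable V (\<lambda>s. t s \<in> facts V (code_rule V S))"
  by (rule definable_facts) (rule definable_code_rule)

end

locale structure_space = transitive_model V for V :: "'v::set_universe set" +
  fixes \<kappa> L X :: 'v
  assumes \<kappa>_in: "\<kappa> \<in> V" and Ord_\<kappa>: "Ord \<kappa>" and infinite_\<kappa>: "infinite (elts \<kappa>)"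
    and X_in: "X \<in> V" and infinite_X: "infinite (elts X)" and L_in: "L \<in> V"
begin

definition S :: 'v where
  "S = mkset (Str V L X)"

lemma S_in: "S \<in> V" and elts_S: "elts S = Str V L X"
  unfolding S_def using is_set_in_Str[OF X_in _ L_in] infinite_X is_set_inD by force+

abbreviation "code_facts \<equiv> facts V (code_rule V S)"

lemma is_set_in_Collect_S:
  "definable V (\<lambda>s. P (s 0)) \<Longrightarrow> is_set_in V {M\<in>Str V L X. P M}"
  using separation[OF _ S_in, of P] by (simp add: elts_S)

section \<open>Derivations of the intended values, up to basic codes\<close>

lemma nth_fact:
  assumes "set a \<subseteq> V" "i < length a"
  shows "code_fact (num i) 0 (tup a) (a ! i) \<in> code_facts"
  using assms
proof (induction a arbitrary: i)
  case (Cons x a)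
  have in_V: "x \<in> V" "tup a \<in> V" "(x # a) ! i \<in> V"
    using Cons.prems tup_in[of a] nth_mem[OF Cons.prems(2)] by auto
  show ?case
  proof (cases i)
    case 0
    have "code_rule V S (code_fact (num i) 0 (tup (x # a)) ((x # a) ! i)) (num 0)"
      unfolding code_rule_def using in_V 0 by simp
    then show ?thesis
      by (rule code_facts_intro[OF S_in, rotated 2])
        (use in_V in \<open>auto intro!: code_fact_in num_in opair_in\<close>)
  next
    case (Suc j)
    have IH: "code_fact (num j) 0 (tup a) (a ! j) \<in> code_facts"
      using Cons Suc by simp
    have "code_rule V S (code_fact (num i) 0 (tup (x # a)) ((x # a) ! i))
        (mkset {code_fact (num j) 0 (tup a) (a ! j)})"
      unfolding code_rule_def Suc num_Suc using in_V Suc num_in[of j] by auto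
    then show ?thesis
      by (rule code_facts_intro[OF S_in, rotated 2])
        (use in_V IH Suc in \<open>auto intro!: code_fact_in num_in opair_in is_set_inD is_set_in_singleton
          simp del: num.simps\<close>)
  qed
qed simp

lemma map_fact:
  assumes "set a \<subseteq> V" "\<forall>i\<in>set is. i < length a"
  shows "code_fact (tup (map num is)) 1 (tup a) (tup (map (\<lambda>i. a ! i) is)) \<in> code_facts"
  using assms(2)
proof (induction "is")
  case Nil
  have "code_rule V S (code_fact (num 0) 1 (tup a) (num 0)) (num 0)"
    unfolding code_rule_def using tup_in[OF assms(1)] by auto
  then have "code_fact (num 0) 1 (tup a) (num 0) \<in> code_facts"
    by (rule code_facts_intro[OF S_in, rotated 2])
      (use tup_in[OF assms(1)] in \<open>auto intro!: code_fact_in num_in\<close>)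
  then show ?case by simp
next
  case (Cons i "is")
  let ?p = "{code_fact (num i) 0 (tup a) (a ! i),
    code_fact (tup (map num is)) 1 (tup a) (tup (map (\<lambda>i. a ! i) is))}"
  have in_V: "tup a \<in> V" "tup (map num is) \<in> V" "a ! i \<in> V" "tup (map (\<lambda>i. a ! i) is) \<in> V"
    using assms(1) Cons.prems by (auto intro!: tup_in num_in subsetD[OF assms(1) nth_mem])
  have p: "?p \<subseteq> code_facts" using nth_fact[OF assms(1)] Cons by simp
  have "code_rule V S (code_fact (tup (map num (i # is))) 1 (tup a) (tup (map (\<lambda>i. a ! i) (i # is))))
      (mkset ?p)"
    unfolding code_rule_def using in_V num_in[of i] by auto
  then show ?case
    by (rule code_facts_intro[OF S_in, rotated 2])
      (use in_V p in \<open>auto intro!: code_fact_in num_in opair_in is_set_inD is_set_in_pair\<close>)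
qed

lemma opair_in_LD: "opair R n \<in> elts L \<Longrightarrow> R \<in> V"
  using mem_opairD(1)[OF _ model] trans_in[OF _ L_in] by blast

lemma enc_lit_in: "lit_over L n \<phi> \<Longrightarrow> enc_lit \<phi> \<in> V"
proof (induction \<phi>)
  case (Rel R "is")
  then have "R \<in> V" using opair_in_LD by auto
  then show ?case by (auto intro!: opair_in num_in tup_in simp del: num.simps)
qed (auto intro!: opair_in num_in simp del: num.simps)

text \<open>That the set lies in \<open>V\<close> is proved in the same induction, because in the
  case of \<open>Neg\<close> the set for \<phi> is a parameter of the separation.\<close>

lemma holds_fact:
  assumes "set a \<subseteq> elts X" "lit_over L (length a) \<phi>"
  shows "code_fact (enc_lit \<phi>) 2 (tup a) (mkset {M\<in>Str V L X. holds M a \<phi>}) \<in> code_facts \<and>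
    is_set_in V {M\<in>Str V L X. holds M a \<phi>}"
  using assms(2)
proof (induction \<phi>)
  case (Rel R "is")
  let ?ys = "tup (map (\<lambda>i. a ! i) is)"
  have aV: "set a \<subseteq> V" using assms(1) elts_subset[OF X_in] by blast
  have in_V: "tup a \<in> V" "tup (map num is) \<in> V" "?ys \<in> V" "R \<in> V"
    using aV Rel opair_in_LD[of R] by (auto intro!: tup_in num_in subsetD[OF aV nth_mem])
  have set: "is_set_in V {M\<in>Str V L X. holds M a (Rel R is)}"
    using in_V by (auto intro!: is_set_in_Collect_S definable_intros opair_in)
  have p: "code_fact (tup (map num is)) 1 (tup a) ?ys \<in> code_facts"
    using map_fact[OF aV] Rel by simp
  have "code_rule V S (code_fact (enc_lit (Rel R is)) 2 (tup a) (mkset {M\<in>Str V L X. holds M a (Rel R is)}))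
      (mkset {code_fact (tup (map num is)) 1 (tup a) ?ys})"
    unfolding code_rule_def elts_S using in_V by auto
  then have "code_fact (enc_lit (Rel R is)) 2 (tup a) (mkset {M\<in>Str V L X. holds M a (Rel R is)}) \<in> code_facts"
    by (rule code_facts_intro[OF S_in, rotated 2])
      (use in_V p Rel set in \<open>auto intro!: code_fact_in enc_lit_in is_set_inD is_set_in_singleton
        simp del: holds.simps enc_lit.simps\<close>)
  with set show ?case by blast
next
  case (Eq i j)
  have aV: "set a \<subseteq> V" using assms(1) elts_subset[OF X_in] by blast
  have in_V: "tup a \<in> V" "a ! i \<in> V" "a ! j \<in> V"
    using aV Eq by (auto intro!: tup_in)
  have set: "is_set_in V {M\<in>Str V L X. holds M a (Eq i j)}"
    using in_V by (auto intro!: is_set_in_Collect_S definable_intros)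
  let ?p = "{code_fact (num i) 0 (tup a) (a ! i), code_fact (num j) 0 (tup a) (a ! j)}"
  have p: "?p \<subseteq> code_facts" using nth_fact[OF aV] Eq by simp
  have "code_rule V S (code_fact (enc_lit (Eq i j)) 2 (tup a) (mkset {M\<in>Str V L X. holds M a (Eq i j)})) (mkset ?p)"
    unfolding code_rule_def elts_S using in_V num_in[of i] num_in[of j] by auto
  then have "code_fact (enc_lit (Eq i j)) 2 (tup a) (mkset {M\<in>Str V L X. holds M a (Eq i j)}) \<in> code_facts"
    by (rule code_facts_intro[OF S_in, rotated 2])
      (use in_V p Eq set in \<open>auto intro!: code_fact_in enc_lit_in num_in is_set_inD is_set_in_pair
        simp del: holds.simps enc_lit.simps\<close>)
  with set show ?case by blast
next
  case (Neg \<phi>)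
  let ?w = "mkset {M\<in>Str V L X. holds M a \<phi>}"
  have aV: "set a \<subseteq> V" using assms(1) elts_subset[OF X_in] by blast
  have IH: "code_fact (enc_lit \<phi>) 2 (tup a) ?w \<in> code_facts" "?w \<in> V"
    "elts ?w = {M\<in>Str V L X. holds M a \<phi>}"
    using Neg is_set_inD[of V "{M\<in>Str V L X. holds M a \<phi>}"] by auto
  have in_V: "tup a \<in> V" "enc_lit \<phi> \<in> V" using aV Neg by (auto intro!: tup_in enc_lit_in)
  have eq: "{M\<in>Str V L X. holds M a (Neg \<phi>)} = {M\<in>Str V L X. M \<notin> elts ?w}" using IH(3) by auto
  have set: "is_set_in V {M\<in>Str V L X. holds M a (Neg \<phi>)}"
    unfolding eq using IH by (intro is_set_in_Collect_S definable_intros)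
  have "code_rule V S (code_fact (enc_lit (Neg \<phi>)) 2 (tup a) (mkset {M\<in>Str V L X. holds M a (Neg \<phi>)}))
      (mkset {code_fact (enc_lit \<phi>) 2 (tup a) ?w})"
    unfolding code_rule_def elts_S eq using in_V IH(2) by auto
  then have "code_fact (enc_lit (Neg \<phi>)) 2 (tup a) (mkset {M\<in>Str V L X. holds M a (Neg \<phi>)}) \<in> code_facts"
    by (rule code_facts_intro[OF S_in, rotated 2])
      (use in_V IH(1,2) Neg set in \<open>auto intro!: code_fact_in enc_lit_in is_set_inD is_set_in_singleton
        simp del: holds.simps enc_lit.simps\<close>)
  with set show ?case by blast
qed

lemma conj_fact:
  assumes "set a \<subseteq> elts X" "\<forall>\<phi>\<in>set \<phi>s. lit_over L (length a) \<phi>"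
  shows "code_fact (tup (map enc_lit \<phi>s)) 3 (tup a) (mkset {M\<in>Str V L X. \<forall>\<phi>\<in>set \<phi>s. holds M a \<phi>}) \<in> code_facts \<and>
    is_set_in V {M\<in>Str V L X. \<forall>\<phi>\<in>set \<phi>s. holds M a \<phi>}"
  using assms(2)
proof (induction \<phi>s)
  case Nil
  have "set a \<subseteq> V" using assms(1) elts_subset[OF X_in] by blast
  then have in_V: "tup a \<in> V" by (rule tup_in)
  then have "code_rule V S (code_fact (num 0) 3 (tup a) S) (num 0)"
    unfolding code_rule_def by auto
  then have "code_fact (num 0) 3 (tup a) S \<in> code_facts"
    by (rule code_facts_intro[OF S_in, rotated 2])
      (use in_V S_in in \<open>auto intro!: code_fact_in num_in\<close>)
  then show ?case using is_set_in_elts[OF S_in, unfolded elts_S] by (simp add: S_def)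
next
  case (Cons \<phi> \<phi>s)
  let ?u = "mkset {M\<in>Str V L X. holds M a \<phi>}"
  let ?w = "mkset {M\<in>Str V L X. \<forall>\<phi>\<in>set \<phi>s. holds M a \<phi>}"
  let ?v = "{M\<in>Str V L X. \<forall>\<phi>\<in>set (\<phi> # \<phi>s). holds M a \<phi>}"
  have aV: "set a \<subseteq> V" using assms(1) elts_subset[OF X_in] by blast
  have u: "code_fact (enc_lit \<phi>) 2 (tup a) ?u \<in> code_facts" "?u \<in> V"
    "elts ?u = {M\<in>Str V L X. holds M a \<phi>}"
    using holds_fact[OF assms(1), of \<phi>] Cons.prems is_set_inD[of V "{M\<in>Str V L X. holds M a \<phi>}"] by auto
  have w: "code_fact (tup (map enc_lit \<phi>s)) 3 (tup a) ?w \<in> code_facts" "?w \<in> V"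
    "elts ?w = {M\<in>Str V L X. \<forall>\<phi>\<in>set \<phi>s. holds M a \<phi>}"
    using Cons is_set_inD[of V "{M\<in>Str V L X. \<forall>\<phi>\<in>set \<phi>s. holds M a \<phi>}"] by auto
  have in_V: "tup a \<in> V" "enc_lit \<phi> \<in> V" "tup (map enc_lit \<phi>s) \<in> V"
    using aV Cons.prems by (auto intro!: tup_in enc_lit_in)
  have eq: "?v = {M\<in>Str V L X. M \<in> elts ?u \<and> M \<in> elts ?w}" using u(3) w(3) by auto
  have set: "is_set_in V ?v"
    unfolding eq using u w by (intro is_set_in_Collect_S definable_intros)
  have "code_rule V S (code_fact (tup (map enc_lit (\<phi> # \<phi>s))) 3 (tup a) (mkset ?v))
      (mkset {code_fact (enc_lit \<phi>) 2 (tup a) ?u, code_fact (tup (map enc_lit \<phi>s)) 3 (tup a) ?w})"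
    unfolding code_rule_def elts_S eq using in_V u(2) w(2) by auto
  then have "code_fact (tup (map enc_lit (\<phi> # \<phi>s))) 3 (tup a) (mkset ?v) \<in> code_facts"
    by (rule code_facts_intro[OF S_in, rotated 2])
      (use in_V u(1,2) w(1,2) is_set_inD(1)[OF set] in
        \<open>auto intro!: code_fact_in opair_in is_set_inD is_set_in_pair\<close>)
  with set show ?case by blast
qed

lemma basic_fact:
  assumes "is_basic L (elts X) \<phi>s a"
  shows "code_fact (basic_code \<phi>s a) 4 (num 0) (mkset {M\<in>Str V L X. \<forall>\<phi>\<in>set \<phi>s. holds M a \<phi>}) \<in> code_facts"
    "is_set_in V {M\<in>Str V L X. \<forall>\<phi>\<in>set \<phi>s. holds M a \<phi>}"
    "basic_code \<phi>s a \<in> V"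
proof -
  let ?v = "{M\<in>Str V L X. \<forall>\<phi>\<in>set \<phi>s. holds M a \<phi>}"
  have a: "set a \<subseteq> elts X" "\<forall>\<phi>\<in>set \<phi>s. lit_over L (length a) \<phi>"
    using assms unfolding is_basic_def by auto
  note conj = conj_fact[OF a]
  then show set: "is_set_in V ?v" by blast
  have "set a \<subseteq> V" using a(1) elts_subset[OF X_in] by blast
  then have in_V: "tup a \<in> V" "tup (map enc_lit \<phi>s) \<in> V"
    using a(2) by (auto intro!: tup_in enc_lit_in)
  then show b: "basic_code \<phi>s a \<in> V" unfolding basic_code_def by (intro opair_in num_in)
  have "code_rule V S (code_fact (basic_code \<phi>s a) 4 (num 0) (mkset ?v))
      (mkset {code_fact (tup (map enc_lit \<phi>s)) 3 (tup a) (mkset ?v)})"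
    unfolding code_rule_def basic_code_def using in_V is_set_inD(1)[OF set] by auto
  then show "code_fact (basic_code \<phi>s a) 4 (num 0) (mkset ?v) \<in> code_facts"
    by (rule code_facts_intro[OF S_in, rotated 2])
      (use in_V b conj is_set_inD(1)[OF set] in
        \<open>auto intro!: code_fact_in is_set_inD is_set_in_singleton is_set_in_empty\<close>)
qed

end

section \<open>Measurable sets\<close>

text \<open>Gives sense to the definite description in \<open>interp\<close>. The codings are
  injective, and the choice of the sets \<open>A\<close> in an infinitary rule matters only on the
  members of \<Gamma>.\<close>

lemma denotes_unique:
  fixes V :: "'v::set_universe set"
  assumes "denotes V L X \<gamma> A" "denotes V L X \<gamma> B"
  shows "A = B"
proof -
  have nums: "map num is = (map num js :: 'v list) \<longleftrightarrow> is = js" for "is" js :: "nat list"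
    by (rule inj_map_eq_map) (simp add: inj_def)
  have inj: "inj (enc_lit :: 'v literal \<Rightarrow> 'v)"
  proof (rule injI)
    fix \<phi> \<psi> :: "'v literal"
    show "enc_lit \<phi> = enc_lit \<psi> \<Longrightarrow> \<phi> = \<psi>"
    proof (induction \<phi> arbitrary: \<psi>)
      case (Rel R "is")
      then show ?case by (cases \<psi>) (simp_all add: nums del: num.simps)
    next
      case (Eq i j)
      then show ?case by (cases \<psi>) (simp_all del: num.simps)
    next
      case (Neg \<phi>)
      then show ?case by (cases \<psi>) (simp_all del: num.simps)
    qed
  qed
  have basic_eq: "basic_code \<phi>s a = basic_code \<psi>s b \<longleftrightarrow> \<phi>s = \<psi>s \<and> a = b"
    for \<phi>s \<psi>s and a b :: "'v list"
    unfolding basic_code_def using inj_map_eq_map[OF inj] by auto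
  note codes = code_neg_def code_Or_def code_And_def basic_code_def
  from assms show ?thesis
  proof (induction arbitrary: B rule: denotes.induct)
    case (basic \<phi>s a)
    then show ?case
      by cases (auto simp: basic_eq, auto simp: codes simp del: num.simps)
  next
    case (neg \<gamma> A)
    from neg.prems show ?case
      by cases (use neg.IH in \<open>auto simp: codes simp del: num.simps\<close>)
  next
    case (Or \<Gamma> A)
    from Or.prems show ?case
    proof cases
      case (Or \<Gamma>' A')
      then have "A \<gamma> = A' \<gamma>" if "\<gamma> \<in> elts \<Gamma>" for \<gamma>
        using Or.IH that by (auto simp: codes)
      then show ?thesis using Or by (auto simp: codes)
    qed (auto simp: codes simp del: num.simps)
  next
    case (And \<Gamma> A)
    from And.prems show ?case
    proof cases
      case (And \<Gamma>' A')
      then have "A \<gamma> = A' \<gamma>" if "\<gamma> \<in> elts \<Gamma>" for \<gamma>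
        using And.IH that by (auto simp: codes)
      then show ?thesis using And by (auto simp: codes)
    qed (auto simp: codes simp del: num.simps)
  qed
qed

lemma interp_eq:
  assumes "denotes V L X \<gamma> A"
  shows "interp V L X \<gamma> = mkset A"
  unfolding interp_def using assms denotes_unique by (metis the_equality)

text \<open>\<open>Ord\<close> states transitivity only. By double induction along membership, two
  incomparable elements, minimal as such, would have the same elements and hence be equal.\<close>

lemma Ord_linear:
  fixes \<kappa> :: "'v::set_universe"
  assumes "Ord \<kappa>" "x \<in> elts \<kappa>" "y \<in> elts \<kappa>"
  shows "x \<in> elts y \<or> x = y \<or> y \<in> elts x"
proof -
  have tr: "b \<in> elts \<kappa>" if "a \<in> elts \<kappa>" "b \<in> elts a" for a b
    using assms(1) that unfolding Ord_def by blast
  have tr': "c \<in> elts a" if "a \<in> elts \<kappa>" "b \<in> elts a" "c \<in> elts b" for a b c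
    using assms(1) that unfolding Ord_def by blast
  have "\<forall>y\<in>elts \<kappa>. x \<in> elts \<kappa> \<longrightarrow> x \<in> elts y \<or> x = y \<or> y \<in> elts x" for x
  proof (induction x rule: wf_induct_rule[OF wf_elts])
    case (1 x)
    have "y \<in> elts \<kappa> \<longrightarrow> x \<in> elts \<kappa> \<longrightarrow> x \<in> elts y \<or> x = y \<or> y \<in> elts x" for y
    proof (induction y rule: wf_induct_rule[OF wf_elts])
      case (1 y)
      note IHy = this
      show ?case
      proof (intro impI, rule ccontr)
        assume k: "y \<in> elts \<kappa>" "x \<in> elts \<kappa>" and n: "\<not> (x \<in> elts y \<or> x = y \<or> y \<in> elts x)"
        have "z \<in> elts y" if "z \<in> elts x" for z
          using \<open>\<And>y. (y, x) \<in> _ \<Longrightarrow> _\<close>[of z] that k n tr[of x z] tr'[of x z y] by auto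
        moreover have "z \<in> elts x" if "z \<in> elts y" for z
          using IHy[of z] that k n tr[of y z] tr'[of y z x] by auto
        ultimately have "elts x = elts y" by blast
        with n show False by (simp add: elts_inject)
      qed
    qed
    then show ?case by blast
  qed
  with assms show ?thesis by blast
qed

section \<open>Functions that belong to the model\<close>

context transitive_model
begin

text \<open>Replaces \<open>f\<close>, a function of the surrounding logic, by its graph
  \<open>G\<close>, an element of \<open>V\<close> that formulas may use as a parameter.\<close>

lemma fun_inE:
  assumes "fun_in V (elts D) f"
  obtains G where "G \<in> V" "\<And>x y. opair x y \<in> elts G \<longleftrightarrow> x \<in> elts D \<and> y = f x"
    "\<And>x. x \<in> elts D \<Longrightarrow> f x \<in> V"
proof -
  obtain G where G: "G \<in> V" "elts G = (\<lambda>x. opair x (f x)) ` elts D"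
    using assms unfolding fun_in_def is_set_in_def by blast
  have "f x \<in> V" if "x \<in> elts D" for x
    using mem_opairD(2)[OF _ model, of x "f x"] trans_in[OF _ G(1)] that G(2) by blast
  moreover have "opair x y \<in> elts G \<longleftrightarrow> x \<in> elts D \<and> y = f x" for x y
    unfolding G(2) by auto
  ultimately show ?thesis using that[OF G(1)] by blast
qed

lemma fun_in_compose:
  assumes f: "fun_in V (elts D) f" and D: "D \<in> V"
    and P: "definable V (\<lambda>s. P (s 0) (s (Suc 0)))" "definable V (\<lambda>s. P (s (Suc 0)) (s 0))"
    and g: "\<And>i. i \<in> elts D \<Longrightarrow> g (f i) \<in> V"
      "\<And>i y. i \<in> elts D \<Longrightarrow> y \<in> V \<Longrightarrow> P (f i) y \<longleftrightarrow> y = g (f i)"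
  shows "fun_in V (elts D) (\<lambda>i. g (f i))"
proof -
  obtain G where G: "G \<in> V" "\<And>x y. opair x y \<in> elts G \<longleftrightarrow> x \<in> elts D \<and> y = f x"
    "\<And>x. x \<in> elts D \<Longrightarrow> f x \<in> V" using fun_inE[OF f] by blast
  show ?thesis
  proof (rule fun_inI[OF D, where P = "\<lambda>i w. \<exists>y\<in>V. opair i y \<in> elts G \<and> P y w"])
    have "definable V (\<lambda>s. P (s (case_nat 0 (\<lambda>n. n + 2) 0)) (s (case_nat 0 (\<lambda>n. n + 2) (Suc 0))))"
      using P(1) by (rule definable_rename) (auto simp: inj_def split: nat.splits)
    then have "definable V (\<lambda>s. P (s 0) (s (Suc (Suc 0))))" by (simp add: numeral_2_eq_2)
    then show "definable V (\<lambda>s. \<exists>y\<in>V. opair (s 0) y \<in> elts G \<and> P y (s (Suc 0)))"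
      by (intro definable_intros G)
  qed (use g G in auto)
qed

lemma fun_in_image:
  assumes "fun_in V (elts D) f" "D \<in> V"
  shows "is_set_in V (f ` elts D)"
proof -
  obtain G where G: "G \<in> V" "\<And>x y. opair x y \<in> elts G \<longleftrightarrow> x \<in> elts D \<and> y = f x"
    "\<And>x. x \<in> elts D \<Longrightarrow> f x \<in> V" using fun_inE[OF assms(1)] by blast
  show ?thesis
    by (rule replacement[OF assms(2), where P = "\<lambda>x y. opair x y \<in> elts G"],
        intro definable_intros G) (use G in auto)
qed

lemma fun_in_restrict:
  assumes "fun_in V (elts D) f" "E \<in> V" "elts E \<subseteq> elts D"
  shows "fun_in V (elts E) f"
proof -
  obtain G where G: "G \<in> V" "\<And>x y. opair x y \<in> elts G \<longleftrightarrow> x \<in> elts D \<and> y = f x"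
    "\<And>x. x \<in> elts D \<Longrightarrow> f x \<in> V" using fun_inE[OF assms(1)] by blast
  show ?thesis
    by (rule fun_inI[OF assms(2), where P = "\<lambda>x y. opair x y \<in> elts G"],
        intro definable_intros G) (use G assms(3) in auto)
qed

end

section \<open>The algebra of measurable sets\<close>

context structure_space
begin

text \<open>Extensions are used in place of elements of \<open>V\<close>, so that the library on
  algebras of sets applies.\<close>

definition kappa_sets :: "'v set set" where
  "kappa_sets = elts ` sigma_kappa V \<kappa> L X"

lemma sigma_kappaD: "x \<in> sigma_kappa V \<kappa> L X \<Longrightarrow> x \<in> V" "x \<in> sigma_kappa V \<kappa> L X \<Longrightarrow> elts x \<subseteq> Str V L X"
  unfolding sigma_kappa_def by auto

lemma kappa_sets_iff: "A \<in> kappa_sets \<longleftrightarrow> mkset A \<in> sigma_kappa V \<kappa> L X \<and> elts (mkset A) = A"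
  unfolding kappa_sets_def by force

lemma elts_kappa_sets: "x \<in> sigma_kappa V \<kappa> L X \<Longrightarrow> elts x \<in> kappa_sets"
  unfolding kappa_sets_def by blast

lemma kappa_sets_mkset: "A \<in> kappa_sets \<Longrightarrow> mkset A \<in> sigma_kappa V \<kappa> L X"
  and elts_mkset: "A \<in> kappa_sets \<Longrightarrow> elts (mkset A) = A"
  unfolding kappa_sets_iff by blast+

lemma kappa_sets_subset: "A \<in> kappa_sets \<Longrightarrow> A \<subseteq> Str V L X"
  unfolding kappa_sets_def using sigma_kappaD by blast

lemma kappa_setsI:
  assumes "is_set_in V A" "A \<subseteq> Str V L X" "\<And>F. kappa_algebra V \<kappa> L X F \<Longrightarrow> mkset A \<in> elts F"
  shows "A \<in> kappa_sets"
  unfolding kappa_sets_iff sigma_kappa_def using assms is_set_inD[OF assms(1)] by simp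

lemma kappa_sets_compl:
  assumes "A \<in> kappa_sets"
  shows "Str V L X - A \<in> kappa_sets"
proof (rule kappa_setsI)
  have A: "mkset A \<in> V" "elts (mkset A) = A"
    using assms sigma_kappaD unfolding kappa_sets_iff by auto
  have "is_set_in V {M\<in>Str V L X. M \<notin> elts (mkset A)}"
    by (intro is_set_in_Collect_S definable_intros A)
  then show "is_set_in V (Str V L X - A)" unfolding A(2) by (simp add: set_diff_eq)
  fix F assume F: "kappa_algebra V \<kappa> L X F"
  then have "mkset A \<in> elts F" using assms unfolding kappa_sets_iff sigma_kappa_def by blast
  then show "mkset (Str V L X - A) \<in> elts F"
    using F A(2) unfolding kappa_algebra_def by metis
qed blast

lemma kappa_sets_holds:
  assumes "lit_over L (length a) \<phi>" "set a \<subseteq> elts X"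
  shows "{M\<in>Str V L X. holds M a \<phi>} \<in> kappa_sets"
proof (rule kappa_setsI)
  show "is_set_in V {M\<in>Str V L X. holds M a \<phi>}" using holds_fact[OF assms(2,1)] by blast
qed (use assms in \<open>auto simp: kappa_algebra_def\<close>)

text \<open>\<open>kappa_algebra\<close> admits sets of sets that inject into \<kappa>, but an
  indexed family may repeat its members. Sending each member to its least index, which exists by
  well-foundedness and is unique by \<open>Ord_linear\<close>, is such an injection. Domains
  \<open>D\<close> other than \<kappa> serve for pairs and initial segments.\<close>

lemma kappa_sets_UN:
  assumes D: "D \<in> V" "elts D \<subseteq> elts \<kappa>" and f: "fun_in V (elts D) f"
    and sigma: "\<And>i. i \<in> elts D \<Longrightarrow> f i \<in> sigma_kappa V \<kappa> L X"
  shows "(\<Union>i\<in>elts D. elts (f i)) \<in> kappa_sets"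
proof (rule kappa_setsI)
  have im: "is_set_in V (f ` elts D)" by (rule fun_in_image[OF f D(1)])
  then show "is_set_in V (\<Union>i\<in>elts D. elts (f i))" by (rule is_set_in_UN)
  show "(\<Union>i\<in>elts D. elts (f i)) \<subseteq> Str V L X" using sigma sigma_kappaD(2) by blast
  fix F assume F: "kappa_algebra V \<kappa> L X F"
  define E where "E = mkset (f ` elts D)"
  have E: "E \<in> V" "elts E = f ` elts D" unfolding E_def using is_set_inD[OF im] by auto
  obtain G where G: "G \<in> V" "\<And>x y. opair x y \<in> elts G \<longleftrightarrow> x \<in> elts D \<and> y = f x"
    "\<And>x. x \<in> elts D \<Longrightarrow> f x \<in> V" using fun_inE[OF f] by blast
  \<comment> \<open>Stated through the graph \<open>G\<close>, so that the least index is given by a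
    formula.\<close>
  define least where "least A j \<longleftrightarrow> opair j A \<in> elts G \<and> (\<forall>k\<in>elts D. opair k A \<in> elts G \<longrightarrow> k \<notin> elts j)"
    for A j
  have least_iff: "least A j \<longleftrightarrow> j \<in> elts D \<and> f j = A \<and> (\<forall>k\<in>elts D. f k = A \<longrightarrow> k \<notin> elts j)" for A j
    unfolding least_def G(2) by (auto simp: eq_commute)
  have ex: "\<exists>!j. least A j" if "A \<in> elts E" for A
  proof -
    have "\<exists>j0. j0 \<in> {j \<in> elts D. f j = A}" using \<open>A \<in> elts E\<close> E(2) by auto
    then obtain j0 where "j0 \<in> {j \<in> elts D. f j = A}" by (rule exE)
    then obtain j where j: "j \<in> {j \<in> elts D. f j = A}" "\<And>k. k \<in> elts j \<Longrightarrow> k \<notin> {j \<in> elts D. f j = A}"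
      by (rule wfE_min[OF wf_elts]) simp
    show ?thesis
    proof (rule ex1I[of _ j])
      show "least A j" unfolding least_iff using j by auto
      fix i assume i: "least A i"
      have "i \<in> elts \<kappa>" "j \<in> elts \<kappa>" using i j(1) D(2) unfolding least_iff by auto
      moreover have "i \<notin> elts j" "j \<notin> elts i" using i j unfolding least_iff by auto
      ultimately show "i = j" using Ord_linear[OF Ord_\<kappa>] by blast
    qed
  qed
  define h where "h A = (THE j. least A j)" for A
  have h: "least A j \<longleftrightarrow> j = h A" if "A \<in> elts E" for A j
  proof
    show "least A j \<Longrightarrow> j = h A" unfolding h_def using ex[OF that] by (simp add: the1_equality)
    show "j = h A \<Longrightarrow> least A j" unfolding h_def using theI'[OF ex[OF that]] by simp
  qed
  have hD: "h A \<in> elts D" "f (h A) = A" if "A \<in> elts E" for A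
    using h[OF that, of "h A"] unfolding least_iff by auto
  have "fun_in V (elts E) h"
  proof (rule fun_inI[OF E(1), where P = least])
    show "definable V (\<lambda>s. least (s 0) (s (Suc 0)))"
      unfolding least_def by (intro definable_intros G D)
  qed (use h hD trans_in[OF _ D(1)] in auto)
  moreover have "inj_on h (elts E)" using hD(2) by (metis inj_onI)
  moreover have "h ` elts E \<subseteq> elts \<kappa>" using hD(1) D(2) by blast
  moreover have "f i \<in> elts F" if "i \<in> elts D" for i
    using sigma[OF that] F unfolding sigma_kappa_def by simp
  then have "elts E \<subseteq> elts F" unfolding E(2) by blast
  ultimately have "mkset (\<Union>A\<in>elts E. elts A) \<in> elts F"
    using F E(1) unfolding kappa_algebra_def by blast
  then show "mkset (\<Union>i\<in>elts D. elts (f i)) \<in> elts F" unfolding E(2) by simp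
qed

lemma kappa_sets_empty: "{} \<in> kappa_sets"
  using kappa_sets_UN[of "mkset {}" "\<lambda>_. S"] by (simp add: fun_in_def is_set_in_empty)

lemma two_indices: obtains i j where "i \<in> elts \<kappa>" "j \<in> elts \<kappa>" "j \<noteq> i"
proof -
  obtain i where i: "i \<in> elts \<kappa>" using infinite_imp_nonempty[OF infinite_\<kappa>] by blast
  have "infinite (elts \<kappa> - {i})" using infinite_\<kappa> by simp
  from infinite_imp_nonempty[OF this] i that show ?thesis by blast
qed

lemma kappa_sets_Un:
  assumes A: "A \<in> kappa_sets" and B: "B \<in> kappa_sets"
  shows "A \<union> B \<in> kappa_sets"
proof -
  obtain i j where i: "i \<in> elts \<kappa>" and j: "j \<in> elts \<kappa>" "j \<noteq> i"
    using two_indices by blast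
  note ij = trans_in[OF i \<kappa>_in] trans_in[OF j(1) \<kappa>_in]
  define D where "D = mkset {i, j}"
  have D: "D \<in> V" "elts D = {i, j}" unfolding D_def using is_set_inD[OF is_set_in_pair[OF ij]] by auto
  define f where "f k = (if k = i then mkset A else mkset B)" for k
  have AB: "mkset A \<in> V" "mkset B \<in> V"
    using A B kappa_sets_mkset sigma_kappaD(1) by blast+
  have "(\<Union>k\<in>elts D. elts (f k)) \<in> kappa_sets"
  proof (rule kappa_sets_UN[OF D(1)])
    have "definable V (\<lambda>s. s 0 = i \<and> s (Suc 0) = mkset A \<or> s 0 \<noteq> i \<and> s (Suc 0) = mkset B)"
      by (intro definable_intros ij AB)
    then show "fun_in V (elts D) f"
      by (rule fun_inI[OF D(1), where P = "\<lambda>k w. k = i \<and> w = mkset A \<or> k \<noteq> i \<and> w = mkset B"])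
        (use AB in \<open>auto simp: f_def\<close>)
  qed (use D(2) i j A B kappa_sets_mkset in \<open>auto simp: f_def\<close>)
  also have "(\<Union>k\<in>elts D. elts (f k)) = A \<union> B"
    unfolding D(2) f_def using j(2) elts_mkset A B by auto
  finally show ?thesis .
qed

sublocale algebra "Str V L X" kappa_sets
  unfolding algebra_iff_Un
  using kappa_sets_subset kappa_sets_empty kappa_sets_compl kappa_sets_Un by blast

lemma kappa_sets_basic:
  assumes "is_basic L (elts X) \<phi>s a"
  shows "{M\<in>Str V L X. \<forall>\<phi>\<in>set \<phi>s. holds M a \<phi>} \<in> kappa_sets"
  using assms
proof (induction \<phi>s)
  case Nil
  show ?case using top by simp
next
  case (Cons \<phi> \<phi>s)
  then have "{M\<in>Str V L X. holds M a \<phi>} \<inter> {M\<in>Str V L X. \<forall>\<phi>\<in>set \<phi>s. holds M a \<phi>} \<in> kappa_sets"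
    using kappa_sets_holds by (intro Int) (auto simp: is_basic_def)
  also have "{M\<in>Str V L X. holds M a \<phi>} \<inter> {M\<in>Str V L X. \<forall>\<phi>\<in>set \<phi>s. holds M a \<phi>} =
      {M\<in>Str V L X. \<forall>\<phi>\<in>set (\<phi> # \<phi>s). holds M a \<phi>}" by auto
  finally show ?case .
qed

text \<open>The invariant of the induction on codes: the denotation exists, is measurable and is
  recorded by a derivable fact. The last part is what places the interpretations of a family of
  codes in \<open>V\<close> as a family.\<close>

definition meaningful :: "'v \<Rightarrow> bool" where
  "meaningful \<gamma> \<longleftrightarrow> denotes V L X \<gamma> (elts (interp V L X \<gamma>)) \<and> interp V L X \<gamma> \<in> sigma_kappa V \<kappa> L X \<and>
     code_fact \<gamma> 4 (num 0) (interp V L X \<gamma>) \<in> code_facts"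

lemma meaningfulI:
  assumes "denotes V L X \<gamma> A" "A \<in> kappa_sets" "code_fact \<gamma> 4 (num 0) (mkset A) \<in> code_facts"
  shows "meaningful \<gamma>"
  unfolding meaningful_def using assms interp_eq[OF assms(1)] by (simp add: kappa_sets_iff)

lemma interp_fact_iff:
  "meaningful \<gamma> \<Longrightarrow> code_fact \<gamma> 4 (num 0) v \<in> code_facts \<longleftrightarrow> v = interp V L X \<gamma>"
  unfolding meaningful_def using code_facts_unique by blast

lemma fun_in_interp:
  assumes "fun_in V (elts \<kappa>) \<gamma>" "\<And>i. i \<in> elts \<kappa> \<Longrightarrow> meaningful (\<gamma> i)"
  shows "fun_in V (elts \<kappa>) (\<lambda>i. interp V L X (\<gamma> i))"
proof (rule fun_in_compose[OF assms(1) \<kappa>_in, where P = "\<lambda>\<gamma> v. code_fact \<gamma> 4 (num 0) v \<in> code_facts"])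
  show "interp V L X (\<gamma> i) \<in> V" if "i \<in> elts \<kappa>" for i
    using assms(2)[OF that] sigma_kappaD(1) unfolding meaningful_def by blast
qed (use interp_fact_iff[OF assms(2)] in \<open>auto intro!: definable_code_facts S_in definable_intros\<close>)

lemma fun_in_compl:
  assumes "fun_in V (elts \<kappa>) f"
  shows "fun_in V (elts \<kappa>) (\<lambda>i. mkset (Str V L X - elts (f i)))"
proof (rule fun_in_compose[OF assms \<kappa>_in, where P = "\<lambda>x y. y = mkset {M\<in>elts S. M \<notin> elts x}"])
  obtain G where fV: "\<And>x. x \<in> elts \<kappa> \<Longrightarrow> f x \<in> V" using fun_inE[OF assms] by blast
  fix i assume "i \<in> elts \<kappa>"
  have "is_set_in V {M\<in>Str V L X. M \<notin> elts (f i)}"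
    by (intro is_set_in_Collect_S definable_intros fV) fact
  then show "mkset (Str V L X - elts (f i)) \<in> V"
    using is_set_inD by (auto simp: set_diff_eq)
  show "y = mkset {M\<in>elts S. M \<notin> elts (f i)} \<longleftrightarrow> y = mkset (Str V L X - elts (f i))" for y
    by (simp add: elts_S set_diff_eq)
qed (intro definable_intros S_in)+

lemma kappa_sets_UN_interp:
  assumes "fun_in V (elts \<kappa>) \<gamma>" "\<And>i. i \<in> elts \<kappa> \<Longrightarrow> meaningful (\<gamma> i)"
  shows "(\<Union>i\<in>elts \<kappa>. elts (interp V L X (\<gamma> i))) \<in> kappa_sets"
  by (rule kappa_sets_UN[OF \<kappa>_in subset_refl fun_in_interp[OF assms]])
    (use assms(2) in \<open>auto simp: meaningful_def\<close>)

text \<open>De Morgan, stated with \<open>mkset\<close> because the closure properties concern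
  families of elements of \<open>V\<close>.\<close>

lemma INT_eq_compl_UN:
  assumes "\<And>i. i \<in> elts \<kappa> \<Longrightarrow> f i \<in> sigma_kappa V \<kappa> L X"
  shows "Str V L X \<inter> (\<Inter>i\<in>elts \<kappa>. elts (f i)) =
    Str V L X - (\<Union>i\<in>elts \<kappa>. elts (mkset (Str V L X - elts (f i))))"
  using elts_mkset[OF kappa_sets_compl[OF elts_kappa_sets[OF assms]]] by auto

lemma compl_in_sigma: "x \<in> sigma_kappa V \<kappa> L X \<Longrightarrow> mkset (Str V L X - elts x) \<in> sigma_kappa V \<kappa> L X"
  by (intro kappa_sets_mkset kappa_sets_compl elts_kappa_sets)

lemma kappa_sets_INT_interp:
  assumes "fun_in V (elts \<kappa>) \<gamma>" "\<And>i. i \<in> elts \<kappa> \<Longrightarrow> meaningful (\<gamma> i)"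
  shows "Str V L X \<inter> (\<Inter>i\<in>elts \<kappa>. elts (interp V L X (\<gamma> i))) \<in> kappa_sets"
proof -
  have s: "interp V L X (\<gamma> i) \<in> sigma_kappa V \<kappa> L X" if "i \<in> elts \<kappa>" for i
    using assms(2)[OF that] unfolding meaningful_def by blast
  have "Str V L X - (\<Union>i\<in>elts \<kappa>. elts (mkset (Str V L X - elts (interp V L X (\<gamma> i))))) \<in> kappa_sets"
    by (intro kappa_sets_compl kappa_sets_UN[OF \<kappa>_in subset_refl] fun_in_compl fun_in_interp assms
        compl_in_sigma s)
  then show ?thesis using INT_eq_compl_UN[of "\<lambda>i. interp V L X (\<gamma> i)", OF s] by simp
qed

text \<open>Builds the set of premises for the clauses of \<open>code_Or\<close> and
  \<open>code_And\<close>. Replacement runs along the set of codes and not along \<kappa>, as the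
  members of a formal union carry no indices.\<close>

lemma code_fact_family:
  assumes "fun_in V (elts \<kappa>) \<gamma>" "\<And>i. i \<in> elts \<kappa> \<Longrightarrow> meaningful (\<gamma> i)"
  obtains p where "p \<in> V" "elts p = (\<lambda>\<gamma>. code_fact \<gamma> 4 (num 0) (interp V L X \<gamma>)) ` \<gamma> ` elts \<kappa>"
    "elts p \<subseteq> code_facts" "family_of V (mkset (\<gamma> ` elts \<kappa>)) p"
proof -
  let ?f = "\<lambda>\<gamma>. code_fact \<gamma> 4 (num 0) (interp V L X \<gamma>)"
  have im: "is_set_in V (\<gamma> ` elts \<kappa>)" by (rule fun_in_image[OF assms(1) \<kappa>_in])
  have in_V: "interp V L X (\<gamma> i) \<in> V" "?f (\<gamma> i) \<in> code_facts" if "i \<in> elts \<kappa>" for i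
    using assms(2)[OF that] sigma_kappaD(1) unfolding meaningful_def by blast+
  then have fV: "?f (\<gamma> i) \<in> V" if "i \<in> elts \<kappa>" for i
    using that facts_subset by blast
  have "is_set_in V (?f ` elts (mkset (\<gamma> ` elts \<kappa>)))"
  proof (rule replacement[OF is_set_inD(1)[OF im],
        where P = "\<lambda>\<gamma> z. z \<in> code_facts \<and> (\<exists>v\<in>V. z = code_fact \<gamma> 4 (num 0) v)"])
    show "definable V (\<lambda>s. s (Suc 0) \<in> code_facts \<and> (\<exists>v\<in>V. s (Suc 0) = code_fact (s 0) 4 (num 0) v))"
      by (intro definable_intros definable_code_facts S_in num_in)
    fix g z assume "g \<in> elts (mkset (\<gamma> ` elts \<kappa>))"
    then obtain i where i: "i \<in> elts \<kappa>" "g = \<gamma> i" unfolding is_set_inD(2)[OF im] by blast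
    then show "?f g \<in> V" using fV by blast
    show "z \<in> code_facts \<and> (\<exists>v\<in>V. z = code_fact g 4 (num 0) v) \<longleftrightarrow> z = ?f g"
      using interp_fact_iff[OF assms(2)[OF i(1)]] in_V[OF i(1)] unfolding i(2) by metis
  qed
  note p = is_set_inD[OF this[unfolded is_set_inD(2)[OF im]]]
  show ?thesis
  proof (rule that[OF p(1)])
    show "elts (mkset (?f ` \<gamma> ` elts \<kappa>)) = ?f ` \<gamma> ` elts \<kappa>" by (rule p(2))
    show "elts (mkset (?f ` \<gamma> ` elts \<kappa>)) \<subseteq> code_facts"
      unfolding p(2) using in_V by blast
    show "family_of V (mkset (\<gamma> ` elts \<kappa>)) (mkset (?f ` \<gamma> ` elts \<kappa>))"
      unfolding family_of_def p(2) is_set_inD(2)[OF im] using in_V by blast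
  qed
qed

lemma denotes_Or_interp:
  assumes "fun_in V (elts \<kappa>) \<gamma>" "\<And>i. i \<in> elts \<kappa> \<Longrightarrow> meaningful (\<gamma> i)"
  shows "denotes V L X (code_Or (mkset (\<gamma> ` elts \<kappa>))) (\<Union>i\<in>elts \<kappa>. elts (interp V L X (\<gamma> i)))"
proof -
  have im: "elts (mkset (\<gamma> ` elts \<kappa>)) = \<gamma> ` elts \<kappa>"
    using is_set_inD(2)[OF fun_in_image[OF assms(1) \<kappa>_in]] .
  show ?thesis
    using denotes.Or[of "mkset (\<gamma> ` elts \<kappa>)" V L X "\<lambda>\<gamma>. elts (interp V L X \<gamma>)"] assms(2)
    unfolding im meaningful_def by auto
qed

lemma denotes_And_interp:
  assumes "fun_in V (elts \<kappa>) \<gamma>" "\<And>i. i \<in> elts \<kappa> \<Longrightarrow> meaningful (\<gamma> i)"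
  shows "denotes V L X (code_And (mkset (\<gamma> ` elts \<kappa>)))
    (Str V L X \<inter> (\<Inter>i\<in>elts \<kappa>. elts (interp V L X (\<gamma> i))))"
proof -
  have im: "elts (mkset (\<gamma> ` elts \<kappa>)) = \<gamma> ` elts \<kappa>"
    using is_set_inD(2)[OF fun_in_image[OF assms(1) \<kappa>_in]] .
  show ?thesis
    using denotes.And[of "mkset (\<gamma> ` elts \<kappa>)" V L X "\<lambda>\<gamma>. elts (interp V L X \<gamma>)"] assms(2)
    unfolding im meaningful_def by auto
qed

text \<open>The parts of \<open>meaningful\<close> support each other: a formal union has a
  measurable value because the values of its members form a family in \<open>V\<close>, and this
  rests on the facts for the members.\<close>

lemma codes_meaningful:
  assumes "\<gamma> \<in> codes V \<kappa> L Z" "Z \<subseteq> elts X"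
  shows "meaningful \<gamma>"
  using assms(1)
proof induction
  case (basic \<phi>s a)
  then have b: "is_basic L (elts X) \<phi>s a" using assms(2) unfolding is_basic_def by blast
  show ?case
    by (rule meaningfulI[OF denotes.basic kappa_sets_basic[OF b] basic_fact(1)[OF b]])
next
  case (neg \<gamma>)
  let ?A = "elts (interp V L X \<gamma>)"
  have A: "?A \<in> kappa_sets" "denotes V L X \<gamma> ?A" "code_fact \<gamma> 4 (num 0) (interp V L X \<gamma>) \<in> code_facts"
    using neg.IH elts_kappa_sets unfolding meaningful_def by blast+
  have in_V: "\<gamma> \<in> V" "interp V L X \<gamma> \<in> V"
    using A(3) code_factD facts_subset by blast+
  note m = kappa_sets_compl[OF A(1)]
  have v: "mkset (Str V L X - ?A) \<in> V" using kappa_sets_mkset[OF m] sigma_kappaD(1) by blast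
  have "code_rule V S (code_fact (code_neg \<gamma>) 4 (num 0) (mkset (Str V L X - ?A)))
      (mkset {code_fact \<gamma> 4 (num 0) (interp V L X \<gamma>)})"
    unfolding code_rule_def code_neg_def elts_S set_diff_eq using in_V by auto
  then have "code_fact (code_neg \<gamma>) 4 (num 0) (mkset (Str V L X - ?A)) \<in> code_facts"
    by (rule code_facts_intro[OF S_in, rotated 2])
      (use in_V A v in \<open>auto simp: code_neg_def intro!: code_fact_in opair_in num_in is_set_inD
        is_set_in_singleton simp del: num.simps\<close>)
  then show ?case by (rule meaningfulI[OF denotes.neg[OF A(2)] m])
next
  case (Or \<gamma>)
  let ?\<Gamma> = "mkset (\<gamma> ` elts \<kappa>)" and ?v = "mkset (\<Union>i\<in>elts \<kappa>. elts (interp V L X (\<gamma> i)))"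
  obtain p where p: "p \<in> V" "elts p = (\<lambda>\<gamma>. code_fact \<gamma> 4 (num 0) (interp V L X \<gamma>)) ` \<gamma> ` elts \<kappa>"
    "elts p \<subseteq> code_facts" "family_of V ?\<Gamma> p"
    using code_fact_family[OF Or(1) Or.IH] by blast
  have in_V: "?\<Gamma> \<in> V" "\<And>i. i \<in> elts \<kappa> \<Longrightarrow> \<gamma> i \<in> V \<and> interp V L X (\<gamma> i) \<in> V"
    using is_set_inD(1)[OF fun_in_image[OF Or(1) \<kappa>_in]] p(2,3) code_factD facts_subset by blast+
  have m: "(\<Union>i\<in>elts \<kappa>. elts (interp V L X (\<gamma> i))) \<in> kappa_sets"
    by (rule kappa_sets_UN_interp[OF Or(1)]) (rule Or.IH)
  have d: "denotes V L X (code_Or ?\<Gamma>) (\<Union>i\<in>elts \<kappa>. elts (interp V L X (\<gamma> i)))"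
    by (rule denotes_Or_interp[OF Or(1)]) (rule Or.IH)
  have v: "?v \<in> V" using kappa_sets_mkset[OF m] sigma_kappaD(1) by blast
  \<comment> \<open>The same set read off from the premises \<open>p\<close>, in the form that
    \<open>code_rule\<close> prescribes.\<close>
  have "(\<Union>i\<in>elts \<kappa>. elts (interp V L X (\<gamma> i))) =
    {M\<in>elts S. \<exists>y\<in>elts p. \<exists>\<gamma>\<in>V. \<exists>w\<in>V. y = code_fact \<gamma> 4 (num 0) w \<and> M \<in> elts w}"
    using kappa_sets_subset[OF m] in_V unfolding p(2) elts_S by fastforce
  then have "code_rule V S (code_fact (code_Or ?\<Gamma>) 4 (num 0) ?v) p"
    unfolding code_rule_def code_Or_def using p(4) in_V(1) by auto
  then have "code_fact (code_Or ?\<Gamma>) 4 (num 0) ?v \<in> code_facts"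
    by (rule code_facts_intro[OF S_in, rotated 2])
      (use in_V(1) p v in \<open>auto simp: code_Or_def intro!: code_fact_in opair_in num_in simp del: num.simps\<close>)
  then show ?case by (rule meaningfulI[OF d m])
next
  case (And \<gamma>)
  let ?\<Gamma> = "mkset (\<gamma> ` elts \<kappa>)"
    and ?v = "mkset (Str V L X \<inter> (\<Inter>i\<in>elts \<kappa>. elts (interp V L X (\<gamma> i))))"
  obtain p where p: "p \<in> V" "elts p = (\<lambda>\<gamma>. code_fact \<gamma> 4 (num 0) (interp V L X \<gamma>)) ` \<gamma> ` elts \<kappa>"
    "elts p \<subseteq> code_facts" "family_of V ?\<Gamma> p"
    using code_fact_family[OF And(1) And.IH] by blast
  have in_V: "?\<Gamma> \<in> V" "\<And>i. i \<in> elts \<kappa> \<Longrightarrow> \<gamma> i \<in> V \<and> interp V L X (\<gamma> i) \<in> V"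
    using is_set_inD(1)[OF fun_in_image[OF And(1) \<kappa>_in]] p(2,3) code_factD facts_subset by blast+
  have m: "Str V L X \<inter> (\<Inter>i\<in>elts \<kappa>. elts (interp V L X (\<gamma> i))) \<in> kappa_sets"
    by (rule kappa_sets_INT_interp[OF And(1)]) (rule And.IH)
  have d: "denotes V L X (code_And ?\<Gamma>) (Str V L X \<inter> (\<Inter>i\<in>elts \<kappa>. elts (interp V L X (\<gamma> i))))"
    by (rule denotes_And_interp[OF And(1)]) (rule And.IH)
  have v: "?v \<in> V" using kappa_sets_mkset[OF m] sigma_kappaD(1) by blast
  have "Str V L X \<inter> (\<Inter>i\<in>elts \<kappa>. elts (interp V L X (\<gamma> i))) =
    {M\<in>elts S. \<forall>y\<in>elts p. \<forall>\<gamma>\<in>V. \<forall>w\<in>V. y = code_fact \<gamma> 4 (num 0) w \<longrightarrow> M \<in> elts w}"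
    using in_V unfolding p(2) elts_S by fastforce
  then have "code_rule V S (code_fact (code_And ?\<Gamma>) 4 (num 0) ?v) p"
    unfolding code_rule_def code_And_def using p(4) in_V(1) by auto
  then have "code_fact (code_And ?\<Gamma>) 4 (num 0) ?v \<in> code_facts"
    by (rule code_facts_intro[OF S_in, rotated 2])
      (use in_V(1) p v in \<open>auto simp: code_And_def intro!: code_fact_in opair_in num_in simp del: num.simps\<close>)
  then show ?case by (rule meaningfulI[OF d m])
qed

end

section \<open>Measures in a model\<close>

locale kappa_measure = structure_space V \<kappa> L X
  for V :: "'v::set_universe set" and \<kappa> L X :: 'v +
  fixes \<mu> :: "'v \<Rightarrow> real"
  assumes prob: "prob_kappa_measure V \<kappa> L X \<mu>"
begin

section \<open>Finite additivity and monotonicity\<close>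

definition m :: "'v set \<Rightarrow> real" where
  "m A = \<mu> (mkset A)"

lemma m_nonneg: "A \<in> kappa_sets \<Longrightarrow> 0 \<le> m A"
  using prob kappa_sets_mkset unfolding prob_kappa_measure_def m_def by blast

lemma m_space: "m (Str V L X) = 1"
  using prob unfolding prob_kappa_measure_def m_def by blast

lemma m_UN_has_sum:
  assumes "fun_in V (elts \<kappa>) f" "\<And>i. i \<in> elts \<kappa> \<Longrightarrow> f i \<in> sigma_kappa V \<kappa> L X"
    "\<And>i j. i \<in> elts \<kappa> \<Longrightarrow> j \<in> elts \<kappa> \<Longrightarrow> i \<noteq> j \<Longrightarrow> elts (f i) \<inter> elts (f j) = {}"
  shows "((\<lambda>i. m (elts (f i))) has_sum m (\<Union>i\<in>elts \<kappa>. elts (f i))) (elts \<kappa>)"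
  using prob[unfolded prob_kappa_measure_def, THEN conjunct2, THEN conjunct2, THEN conjunct2,
      THEN conjunct2, THEN spec[of _ f]] assms
  unfolding m_def by simp

lemma m_empty: "m {} = 0"
proof -
  have "fun_in V (elts \<kappa>) (\<lambda>_. mkset {})"
    by (rule fun_inI[OF \<kappa>_in, where P = "\<lambda>_ w. w = mkset {}"]) (auto intro!: definable_intros)
  moreover have "mkset {} \<in> sigma_kappa V \<kappa> L X" using kappa_sets_mkset[OF kappa_sets_empty] .
  ultimately have "((\<lambda>i. m (elts (mkset {}))) has_sum m (\<Union>i\<in>elts \<kappa>. elts (mkset {}))) (elts \<kappa>)"
    by (intro m_UN_has_sum) auto
  then have "((\<lambda>i. m {}) has_sum m {}) (elts \<kappa>)" by simp
  then have "(\<Sum>\<^sub>\<infinity>i\<in>elts \<kappa>. m {}) = m {}" by (rule infsumI)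
  \<comment> \<open>\<open>infsum\<close> of a constant over an infinite set is 0, while here it
    equals \<open>m {}\<close>.\<close>
  then show ?thesis using infinite_\<kappa> by simp
qed

text \<open>Additivity is given for families indexed by \<kappa>, so \<open>A\<close> and
  \<open>B\<close> are padded with empty sets, which contribute nothing by
  \<open>m_empty\<close>.\<close>

lemma m_Un:
  assumes A: "A \<in> kappa_sets" and B: "B \<in> kappa_sets" and disj: "A \<inter> B = {}"
  shows "m (A \<union> B) = m A + m B"
proof -
  obtain i j where i: "i \<in> elts \<kappa>" and j: "j \<in> elts \<kappa>" "j \<noteq> i"
    using two_indices by blast
  note ij = trans_in[OF i \<kappa>_in] trans_in[OF j(1) \<kappa>_in]
  define f where "f k = (if k = i then mkset A else if k = j then mkset B else mkset {})" for k
  have AB: "mkset A \<in> V" "mkset B \<in> V"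
    using A B kappa_sets_mkset sigma_kappaD(1) by blast+
  have elts_f: "elts (f k) = (if k = i then A else if k = j then B else {})" for k
    unfolding f_def using elts_mkset A B by simp
  have "fun_in V (elts \<kappa>) f"
    by (rule fun_inI[OF \<kappa>_in, where P = "\<lambda>k w. k = i \<and> w = mkset A \<or> k \<noteq> i \<and> k = j \<and> w = mkset B \<or>
        k \<noteq> i \<and> k \<noteq> j \<and> w = mkset {}"], intro definable_intros ij AB mkset_empty_in)
      (use AB in \<open>auto simp: f_def\<close>)
  then have "((\<lambda>k. m (elts (f k))) has_sum m (\<Union>k\<in>elts \<kappa>. elts (f k))) (elts \<kappa>)"
    by (rule m_UN_has_sum)
      (use disj A B kappa_sets_empty kappa_sets_mkset elts_f in \<open>auto simp: f_def\<close>)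
  moreover have "(\<Union>k\<in>elts \<kappa>. elts (f k)) = A \<union> B"
    unfolding elts_f using i j by auto
  moreover have "((\<lambda>k. m (elts (f k))) has_sum (\<Sum>k\<in>{i, j}. m (elts (f k)))) (elts \<kappa>)"
    by (rule has_sum_finite_neutralI[where B = "{i, j}"]) (use i j elts_f m_empty in auto)
  ultimately have "m (A \<union> B) = (\<Sum>k\<in>{i, j}. m (elts (f k)))"
    using has_sum_unique by metis
  then show ?thesis using j by (simp add: elts_f)
qed

lemma m_Diff:
  assumes "A \<in> kappa_sets" "B \<in> kappa_sets" "B \<subseteq> A"
  shows "m (A - B) = m A - m B"
  using m_Un[of B "A - B"] Diff[of A B] assms by (simp add: Un_absorb1)

lemma m_mono: "A \<in> kappa_sets \<Longrightarrow> B \<in> kappa_sets \<Longrightarrow> A \<subseteq> B \<Longrightarrow> m A \<le> m B"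
  using m_Diff[of B A] m_nonneg[of "B - A"] Diff[of B A] by simp

lemma m_le_1: "A \<in> kappa_sets \<Longrightarrow> m A \<le> 1"
  using m_mono[of A "Str V L X"] m_space kappa_sets_subset by simp

lemma m_subadditive:
  assumes "A \<in> kappa_sets" "B \<in> kappa_sets"
  shows "m (A \<union> B) \<le> m A + m B"
  using m_Un[of A "B - A"] m_mono[of "B - A" B] Diff[of B A] assms by (simp add: Un_Diff_cancel)

lemma m_UN_le:
  assumes "finite I" "\<And>i. i \<in> I \<Longrightarrow> A i \<in> kappa_sets"
  shows "m (\<Union>i\<in>I. A i) \<le> (\<Sum>i\<in>I. m (A i))"
  using assms
proof (induction rule: finite_induct)
  case (insert i I)
  then have "m (A i \<union> (\<Union>i\<in>I. A i)) \<le> m (A i) + m (\<Union>i\<in>I. A i)"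
    by (intro m_subadditive finite_UN) auto
  with insert show ?case by simp
qed (simp add: m_empty)

lemma m_UN_disjoint:
  assumes "finite I" "\<And>i. i \<in> I \<Longrightarrow> A i \<in> kappa_sets"
    "\<And>i j. i \<in> I \<Longrightarrow> j \<in> I \<Longrightarrow> i \<noteq> j \<Longrightarrow> A i \<inter> A j = {}"
  shows "m (\<Union>i\<in>I. A i) = (\<Sum>i\<in>I. m (A i))"
  using assms
proof (induction rule: finite_induct)
  case (insert i I)
  have "m (A i \<union> (\<Union>i\<in>I. A i)) = m (A i) + m (\<Union>i\<in>I. A i)"
    using insert.prems insert.hyps by (intro m_Un finite_UN) auto
  also have "m (\<Union>i\<in>I. A i) = (\<Sum>i\<in>I. m (A i))"
    using insert.prems by (intro insert.IH) auto
  finally show ?case using insert.hyps by simp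
qed (simp add: m_empty)

text \<open>
  Since nonnegative summable families are approximated by finite sums, only finitely many members of
  a union of size \<open>\<kappa>\<close> matter up to \<open>\<epsilon>\<close>. The family is first made disjoint along \<open>\<kappa>\<close>.
\<close>

lemma m_UN_finite_approx:
  assumes f: "fun_in V (elts \<kappa>) f" and sigma: "\<And>i. i \<in> elts \<kappa> \<Longrightarrow> f i \<in> sigma_kappa V \<kappa> L X"
    and "0 < \<epsilon>"
  obtains I where "finite I" "I \<subseteq> elts \<kappa>" "m (\<Union>i\<in>elts \<kappa>. elts (f i)) \<le> m (\<Union>i\<in>I. elts (f i)) + \<epsilon>"
proof -
  obtain G where G: "G \<in> V" "\<And>x y. opair x y \<in> elts G \<longleftrightarrow> x \<in> elts \<kappa> \<and> y = f x"
    "\<And>x. x \<in> elts \<kappa> \<Longrightarrow> f x \<in> V" using fun_inE[OF f] by blast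
  have tr: "elts i \<subseteq> elts \<kappa>" if "i \<in> elts \<kappa>" for i
    using Ord_\<kappa> that unfolding Ord_def by blast
  define D where "D i = elts (f i) - (\<Union>j\<in>elts i. elts (f j))" for i
  have fm: "elts (f i) \<in> kappa_sets" if "i \<in> elts \<kappa>" for i
    using elts_kappa_sets sigma that by blast
  have D: "D i \<in> kappa_sets" if i: "i \<in> elts \<kappa>" for i
    unfolding D_def
  proof (intro Diff fm i)
    \<comment> \<open>The initial segment \<open>i\<close> is an element of \<open>V\<close> and, by
      transitivity, a subset of \<kappa>, hence an admissible domain.\<close>
    show "(\<Union>j\<in>elts i. elts (f j)) \<in> kappa_sets"
      using trans_in[OF i \<kappa>_in] tr[OF i]
      by (intro kappa_sets_UN fun_in_restrict[OF f] sigma) auto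
  qed
  have D_in: "mkset (D i) \<in> V" "elts (mkset (D i)) = D i" if "i \<in> elts \<kappa>" for i
    using kappa_sets_mkset[OF D[OF that]] elts_mkset[OF D[OF that]] sigma_kappaD(1) by auto
  have D_UN: "(\<Union>i\<in>elts \<kappa>. D i) = (\<Union>i\<in>elts \<kappa>. elts (f i))"
  proof (intro equalityI subsetI)
    fix M assume "M \<in> (\<Union>i\<in>elts \<kappa>. elts (f i))"
    then obtain i0 where "i0 \<in> {i \<in> elts \<kappa>. M \<in> elts (f i)}" by auto
    then obtain i where i: "i \<in> {i \<in> elts \<kappa>. M \<in> elts (f i)}"
      "\<And>j. j \<in> elts i \<Longrightarrow> j \<notin> {i \<in> elts \<kappa>. M \<in> elts (f i)}"
      by (rule wfE_min[OF wf_elts]) simp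
    then have "M \<in> D i" unfolding D_def using tr[of i] by auto
    with i(1) show "M \<in> (\<Union>i\<in>elts \<kappa>. D i)" by auto
  qed (auto simp: D_def)
  have D_disj: "D i \<inter> D j = {}" if "i \<in> elts \<kappa>" "j \<in> elts \<kappa>" "i \<noteq> j" for i j
    using Ord_linear[OF Ord_\<kappa> that(1,2)] that(3) unfolding D_def by auto
  \<comment> \<open>The disjoint family must itself belong to \<open>V\<close>. The formula
    describes \<open>D i\<close> through the graph \<open>G\<close> of \<open>f\<close>.\<close>
  have "fun_in V (elts \<kappa>) (\<lambda>i. mkset (D i))"
  proof (rule fun_inI[OF \<kappa>_in, where P = "\<lambda>i w. \<forall>M\<in>V. M \<in> elts w \<longleftrightarrow>
        (\<exists>A\<in>V. opair i A \<in> elts G \<and> M \<in> elts A) \<and>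
        (\<forall>j\<in>elts i. \<forall>B\<in>V. opair j B \<in> elts G \<longrightarrow> M \<notin> elts B)"])
    show "definable V (\<lambda>s. \<forall>M\<in>V. M \<in> elts (s (Suc 0)) \<longleftrightarrow>
        (\<exists>A\<in>V. opair (s 0) A \<in> elts G \<and> M \<in> elts A) \<and>
        (\<forall>j\<in>elts (s 0). \<forall>B\<in>V. opair j B \<in> elts G \<longrightarrow> M \<notin> elts B))"
      by (intro definable_intros G)
    fix i w assume i: "i \<in> elts \<kappa>" and w: "w \<in> V"
    have "(\<exists>A\<in>V. opair i A \<in> elts G \<and> M \<in> elts A) \<and>
        (\<forall>j\<in>elts i. \<forall>B\<in>V. opair j B \<in> elts G \<longrightarrow> M \<notin> elts B) \<longleftrightarrow> M \<in> D i" for M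
      using i G(3) tr[OF i] unfolding G(2) D_def by auto
    moreover have "w = mkset (D i) \<longleftrightarrow> elts w = D i" using D_in(2)[OF i] by (metis mkset_elts)
    moreover have "elts w \<subseteq> V" "D i \<subseteq> V"
      using elts_subset[OF w] elts_subset[OF D_in(1)[OF i]] D_in(2)[OF i] by auto
    ultimately show "(\<forall>M\<in>V. M \<in> elts w \<longleftrightarrow> (\<exists>A\<in>V. opair i A \<in> elts G \<and> M \<in> elts A) \<and>
        (\<forall>j\<in>elts i. \<forall>B\<in>V. opair j B \<in> elts G \<longrightarrow> M \<notin> elts B)) \<longleftrightarrow> w = mkset (D i)"
      by (simp only:) blast
  qed (use D_in in blast)
  then have "((\<lambda>i. m (elts (mkset (D i)))) has_sum m (\<Union>i\<in>elts \<kappa>. elts (mkset (D i)))) (elts \<kappa>)"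
    using D_disj D_in kappa_sets_mkset[OF D] by (intro m_UN_has_sum) auto
  from has_sum_finite_approximation[OF this \<open>0 < \<epsilon>\<close>]
  obtain I where I: "finite I" "I \<subseteq> elts \<kappa>"
    and d: "dist (\<Sum>i\<in>I. m (elts (mkset (D i)))) (m (\<Union>i\<in>elts \<kappa>. elts (mkset (D i)))) \<le> \<epsilon>" by blast
  have "(\<Union>i\<in>elts \<kappa>. elts (mkset (D i))) = (\<Union>i\<in>elts \<kappa>. elts (f i))"
    using D_in(2) D_UN by simp
  moreover have "(\<Sum>i\<in>I. m (elts (mkset (D i)))) = (\<Sum>i\<in>I. m (D i))"
    using D_in(2) I(2) by (intro sum.cong) auto
  moreover have "(\<Sum>i\<in>I. m (D i)) = m (\<Union>i\<in>I. D i)"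
    using I D D_disj by (intro m_UN_disjoint[symmetric]) blast+
  moreover have "m (\<Union>i\<in>I. D i) \<le> m (\<Union>i\<in>I. elts (f i))"
    using I D fm by (intro m_mono finite_UN) (auto simp: D_def)
  ultimately have "m (\<Union>i\<in>elts \<kappa>. elts (f i)) \<le> m (\<Union>i\<in>I. elts (f i)) + \<epsilon>"
    using d by (simp add: dist_real_def abs_le_iff)
  with I show ?thesis by (rule that)
qed

end

section \<open>Basic sets and cylinder sets\<close>

primrec shift_lit :: "nat \<Rightarrow> 'v literal \<Rightarrow> 'v literal" where
  "shift_lit k (Rel R is) = Rel R (map ((+) k) is)"
| "shift_lit k (Eq i j) = Eq (k + i) (k + j)"
| "shift_lit k (Neg \<phi>) = Neg (shift_lit k \<phi>)"

lemma lit_over_shift: "lit_over L n \<phi> \<Longrightarrow> lit_over L (k + n) (shift_lit k \<phi>)"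
  by (induction \<phi>) auto

lemma lit_over_mono: "lit_over L n \<phi> \<Longrightarrow> n \<le> k \<Longrightarrow> lit_over L k \<phi>"
  by (induction \<phi>) auto

lemma holds_shift: "holds M (a @ b) (shift_lit (length a) \<phi>) \<longleftrightarrow> holds M b \<phi>"
  by (induction \<phi>) (auto simp: comp_def)

lemma holds_append: "lit_over L (length a) \<phi> \<Longrightarrow> holds M (a @ b) \<phi> \<longleftrightarrow> holds M a \<phi>"
proof (induction \<phi>)
  case (Rel R "is")
  then have "map (\<lambda>i. (a @ b) ! i) is = map (\<lambda>i. a ! i) is" by (auto simp: nth_append)
  then show ?case by (simp only: holds.simps)
qed (auto simp: nth_append)

definition basic_set :: "'v::set_universe set \<Rightarrow> 'v \<Rightarrow> 'v \<Rightarrow> 'v literal list \<Rightarrow> 'v list \<Rightarrow> 'v set" where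
  "basic_set V L X \<phi>s a = {M\<in>Str V L X. \<forall>\<phi>\<in>set \<phi>s. holds M a \<phi>}"

lemma is_basic_mono: "is_basic L Y \<phi>s a \<Longrightarrow> Y \<subseteq> Z \<Longrightarrow> is_basic L Z \<phi>s a"
  unfolding is_basic_def by blast

lemma is_basic_append:
  assumes "is_basic L Y \<phi>s a" "is_basic L Z \<psi>s b"
  shows "is_basic L (Y \<union> Z) (\<phi>s @ map (shift_lit (length a)) \<psi>s) (a @ b)"
  using assms lit_over_shift[of L "length b" _ "length a"] lit_over_mono[of L "length a" _ "length a + length b"]
  unfolding is_basic_def by auto

text \<open>The concatenated code depends neither on \<open>V\<close> nor on \<open>X\<close>, so
  the intersection of two basic sets is given by the same basic code in both models. This carries
  the product formula from one model to the other.\<close>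

lemma basic_set_append:
  assumes "is_basic L Y \<phi>s a"
  shows "basic_set V L X (\<phi>s @ map (shift_lit (length a)) \<psi>s) (a @ b) =
    basic_set V L X \<phi>s a \<inter> basic_set V L X \<psi>s b"
  using assms holds_append[of L a] unfolding basic_set_def is_basic_def by (auto simp: holds_shift ball_Un)

section \<open>Cylinder sets and their atoms\<close>

definition truth_values :: "'v::set_universe \<Rightarrow> ('v literal \<times> 'v list) list \<Rightarrow> bool list" where
  "truth_values M ts = map (\<lambda>(\<phi>, a). holds M a \<phi>) ts"

definition instances :: "'v::set_universe \<Rightarrow> 'v set \<Rightarrow> ('v literal \<times> 'v list) set" where
  "instances L Z = {(\<phi>, a). lit_over L (length a) \<phi> \<and> set a \<subseteq> Z}"

text \<open>With an arbitrary truth function \<open>P\<close>, Boolean operations require no normal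
  form. As \<open>ts\<close> has only finitely many truth patterns, every \<open>P\<close> yields a
  finite union of atoms.\<close>

definition cylinder :: "'v::set_universe set \<Rightarrow> 'v \<Rightarrow> 'v \<Rightarrow> ('v literal \<times> 'v list) list \<Rightarrow>
    (bool list \<Rightarrow> bool) \<Rightarrow> 'v set" where
  "cylinder V L X ts P = {M\<in>Str V L X. P (truth_values M ts)}"

definition cylinders :: "'v::set_universe set \<Rightarrow> 'v \<Rightarrow> 'v \<Rightarrow> 'v set \<Rightarrow> 'v set set" where
  "cylinders V L X Z = {cylinder V L X ts P | ts P. set ts \<subseteq> instances L Z}"

lemma cylinders_compl:
  assumes "A \<in> cylinders V L X Z"
  shows "Str V L X - A \<in> cylinders V L X Z"
proof -
  obtain ts P where "A = cylinder V L X ts P" "set ts \<subseteq> instances L Z"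
    using assms unfolding cylinders_def by blast
  then have "Str V L X - A = cylinder V L X ts (\<lambda>b. \<not> P b)" "set ts \<subseteq> instances L Z"
    unfolding cylinder_def by auto
  then show ?thesis unfolding cylinders_def by blast
qed

lemma cylinders_empty: "{} \<in> cylinders V L X Z"
proof -
  have "{} = cylinder V L X [] (\<lambda>_. False)" unfolding cylinder_def by simp
  moreover have "set [] \<subseteq> instances L Z" by simp
  ultimately show ?thesis unfolding cylinders_def by blast
qed

lemma cylinders_Un:
  assumes "A \<in> cylinders V L X Z" "B \<in> cylinders V L X Z"
  shows "A \<union> B \<in> cylinders V L X Z"
proof -
  obtain ts P where A: "A = cylinder V L X ts P" "set ts \<subseteq> instances L Z"
    using assms(1) unfolding cylinders_def by blast
  obtain us Q where B: "B = cylinder V L X us Q" "set us \<subseteq> instances L Z"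
    using assms(2) unfolding cylinders_def by blast
  have "A \<union> B = cylinder V L X (ts @ us) (\<lambda>b. P (take (length ts) b) \<or> Q (drop (length ts) b))"
    unfolding A B cylinder_def truth_values_def by auto
  moreover have "set (ts @ us) \<subseteq> instances L Z" using A B by simp
  ultimately show ?thesis unfolding cylinders_def by blast
qed

lemma cylinders_UN:
  "finite I \<Longrightarrow> (\<And>i. i \<in> I \<Longrightarrow> A i \<in> cylinders V L X Z) \<Longrightarrow> (\<Union>i\<in>I. A i) \<in> cylinders V L X Z"
  by (induction rule: finite_induct) (auto intro: cylinders_empty cylinders_Un)

lemma basic_set_in_cylinders:
  assumes "is_basic L Z \<phi>s a"
  shows "basic_set V L X \<phi>s a \<in> cylinders V L X Z"
proof -
  have "basic_set V L X \<phi>s a = cylinder V L X (map (\<lambda>\<phi>. (\<phi>, a)) \<phi>s) (\<lambda>b. \<forall>x\<in>set b. x)"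
    unfolding basic_set_def cylinder_def truth_values_def by auto
  moreover have "set (map (\<lambda>\<phi>. (\<phi>, a)) \<phi>s) \<subseteq> instances L Z"
    using assms unfolding is_basic_def instances_def by auto
  ultimately show ?thesis unfolding cylinders_def by blast
qed

text \<open>Literals are closed under negation, so prescribing all truth values is a conjunction of
  literals. These sets are the atoms into which a cylinder splits.\<close>

lemma cylinder_pattern:
  assumes "set ts \<subseteq> instances L Z" "length b = length ts"
  shows "\<exists>\<phi>s a. is_basic L Z \<phi>s a \<and> cylinder V L X ts (\<lambda>c. c = b) = basic_set V L X \<phi>s a"
  using assms
proof (induction ts arbitrary: b)
  case Nil
  have "cylinder V L X [] (\<lambda>c. c = b) = basic_set V L X [] []" "is_basic L Z [] []"
    using Nil unfolding cylinder_def basic_set_def truth_values_def is_basic_def by auto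
  then show ?case by blast
next
  case (Cons t ts)
  obtain \<phi> a where t: "t = (\<phi>, a)" by fastforce
  obtain x b' where b: "b = x # b'" "length b' = length ts" using Cons.prems(2) by (cases b) auto
  obtain \<psi>s c where c: "is_basic L Z \<psi>s c" "cylinder V L X ts (\<lambda>c. c = b') = basic_set V L X \<psi>s c"
    using Cons.IH[of b'] Cons.prems(1) b by auto
  let ?\<phi> = "if x then \<phi> else Neg \<phi>"
  have \<phi>: "is_basic L Z [?\<phi>] a"
    using Cons.prems(1) unfolding t is_basic_def instances_def by auto
  have "cylinder V L X (t # ts) (\<lambda>c. c = b) = basic_set V L X [?\<phi>] a \<inter> basic_set V L X \<psi>s c"
    unfolding c(2)[symmetric] unfolding cylinder_def basic_set_def truth_values_def b t by auto
  also have "\<dots> = basic_set V L X ([?\<phi>] @ map (shift_lit (length a)) \<psi>s) (a @ c)"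
    by (rule basic_set_append[OF \<phi>, symmetric])
  finally show ?case using is_basic_append[OF \<phi> c(1)] by (metis Un_absorb)
qed

definition sym_diff :: "'a set \<Rightarrow> 'a set \<Rightarrow> 'a set" where
  "sym_diff A B = (A - B) \<union> (B - A)"

context kappa_measure
begin

lemma basic_set_kappa_sets: "is_basic L (elts X) \<phi>s a \<Longrightarrow> basic_set V L X \<phi>s a \<in> kappa_sets"
  unfolding basic_set_def by (rule kappa_sets_basic)

text \<open>Distinct truth patterns give disjoint sets. The set \<open>E\<close> is carried along
  for the product formula; \<open>E = Str V L X\<close> gives the measure of the cylinder
  itself.\<close>

lemma m_cylinder_sum:
  assumes "set ts \<subseteq> instances L Z" "Z \<subseteq> elts X" "E \<in> kappa_sets"
  shows "m (cylinder V L X ts P \<inter> E) =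
      (\<Sum>b | length b = length ts \<and> P b. m (cylinder V L X ts (\<lambda>c. c = b) \<inter> E))"
    "cylinder V L X ts P \<in> kappa_sets"
proof -
  let ?I = "{b. length b = length ts \<and> P b}" and ?C = "\<lambda>b. cylinder V L X ts (\<lambda>c. c = b)"
  have "finite {b :: bool list. length b = length ts}"
    using finite_lists_length_eq[of "UNIV :: bool set" "length ts"] by simp
  then have fin: "finite ?I" by (rule rev_finite_subset) blast
  have C: "?C b \<in> kappa_sets" if "b \<in> ?I" for b
    using cylinder_pattern[OF assms(1), of b V X] basic_set_kappa_sets is_basic_mono[OF _ assms(2)] that
    by force
  have UN: "cylinder V L X ts P = (\<Union>b\<in>?I. ?C b)"
    unfolding cylinder_def truth_values_def by auto
  show "cylinder V L X ts P \<in> kappa_sets"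
    unfolding UN using fin C by (rule finite_UN)
  have "m (\<Union>b\<in>?I. ?C b \<inter> E) = (\<Sum>b\<in>?I. m (?C b \<inter> E))"
  proof (rule m_UN_disjoint[OF fin])
    show "?C b \<inter> E \<in> kappa_sets" if "b \<in> ?I" for b using C[OF that] assms(3) by (rule Int)
  qed (auto simp: cylinder_def)
  then show "m (cylinder V L X ts P \<inter> E) = (\<Sum>b\<in>?I. m (?C b \<inter> E))"
    unfolding UN by (simp add: Int_UN_distrib2)
qed

lemma cylinders_kappa_sets: "A \<in> cylinders V L X Z \<Longrightarrow> Z \<subseteq> elts X \<Longrightarrow> A \<in> kappa_sets"
  unfolding cylinders_def using m_cylinder_sum(2)[OF _ _ top] by blast

text \<open>Both sides are additive over the atoms of \<open>A\<close>, and atoms are basic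
  sets.\<close>

lemma m_cylinder_Int:
  assumes E: "E \<in> kappa_sets" and Z: "Z \<subseteq> elts X"
    and basic: "\<And>\<phi>s a. is_basic L Z \<phi>s a \<Longrightarrow> m (basic_set V L X \<phi>s a \<inter> E) = m (basic_set V L X \<phi>s a) * c"
    and A: "A \<in> cylinders V L X Z"
  shows "m (A \<inter> E) = m A * c"
proof -
  obtain ts P where ts: "A = cylinder V L X ts P" "set ts \<subseteq> instances L Z"
    using A unfolding cylinders_def by blast
  let ?I = "{b. length b = length ts \<and> P b}" and ?C = "\<lambda>b. cylinder V L X ts (\<lambda>c. c = b)"
  have sub: "cylinder V L X ts Q \<inter> Str V L X = cylinder V L X ts Q" for Q
    unfolding cylinder_def by blast
  have "m (A \<inter> E) = (\<Sum>b\<in>?I. m (?C b \<inter> E))"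
    unfolding ts(1) by (rule m_cylinder_sum(1)[OF ts(2) Z E])
  also have "\<dots> = (\<Sum>b\<in>?I. m (?C b) * c)"
  proof (rule sum.cong[OF refl])
    fix b assume "b \<in> ?I"
    then obtain \<phi>s a where "is_basic L Z \<phi>s a" "?C b = basic_set V L X \<phi>s a"
      using cylinder_pattern[OF ts(2), of b V X] by auto
    then show "m (?C b \<inter> E) = m (?C b) * c" using basic by simp
  qed
  also have "\<dots> = (\<Sum>b\<in>?I. m (?C b)) * c" by (rule sum_distrib_right[symmetric])
  also have "(\<Sum>b\<in>?I. m (?C b)) = m A"
    using m_cylinder_sum(1)[OF ts(2) Z top, of P] unfolding sub ts(1) by simp
  finally show ?thesis .
qed

definition product_on_basic :: "'v set \<Rightarrow> 'v set \<Rightarrow> bool" where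
  "product_on_basic Y Z \<longleftrightarrow> (\<forall>\<phi>s a \<psi>s b. is_basic L Y \<phi>s a \<and> is_basic L Z \<psi>s b \<longrightarrow>
     m (basic_set V L X \<phi>s a \<inter> basic_set V L X \<psi>s b) = m (basic_set V L X \<phi>s a) * m (basic_set V L X \<psi>s b))"

text \<open>The two factors are extended from basic sets to cylinders one at a time, each with the
  other set in the role of \<open>E\<close>.\<close>

lemma product_cylinders:
  assumes "product_on_basic Y Z" "Y \<subseteq> elts X" "Z \<subseteq> elts X"
    "A \<in> cylinders V L X Y" "B \<in> cylinders V L X Z"
  shows "m (A \<inter> B) = m A * m B"
proof -
  have "m (B \<inter> A) = m B * m A"
  proof (rule m_cylinder_Int[OF cylinders_kappa_sets[OF assms(4,2)] assms(3) _ assms(5)])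
    fix \<psi>s b assume b: "is_basic L Z \<psi>s b"
    have "m (A \<inter> basic_set V L X \<psi>s b) = m A * m (basic_set V L X \<psi>s b)"
      by (rule m_cylinder_Int[OF basic_set_kappa_sets[OF is_basic_mono[OF b assms(3)]] assms(2) _ assms(4)])
        (use assms(1) b in \<open>simp add: product_on_basic_def\<close>)
    then show "m (basic_set V L X \<psi>s b \<inter> A) = m (basic_set V L X \<psi>s b) * m A"
      by (simp add: Int_commute mult.commute)
  qed
  then show ?thesis by (simp add: Int_commute mult.commute)
qed

section \<open>Approximation in measure\<close>

lemma sym_diff_kappa_sets: "A \<in> kappa_sets \<Longrightarrow> B \<in> kappa_sets \<Longrightarrow> sym_diff A B \<in> kappa_sets"
  unfolding sym_diff_def by (intro Un Diff)

lemma m_sym_diff: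
  assumes "A \<in> kappa_sets" "B \<in> kappa_sets"
  shows "\<bar>m A - m B\<bar> \<le> m (sym_diff A B)"
proof -
  have "m A \<le> m B + m (sym_diff A B)" if "A \<in> kappa_sets" "B \<in> kappa_sets" for A B
  proof -
    have "m A \<le> m (B \<union> sym_diff A B)"
      using that sym_diff_kappa_sets by (intro m_mono Un) (auto simp: sym_diff_def)
    also have "\<dots> \<le> m B + m (sym_diff A B)"
      using that sym_diff_kappa_sets by (intro m_subadditive)
    finally show ?thesis .
  qed
  from this[OF assms] this[OF assms(2,1)] show ?thesis
    by (simp add: sym_diff_def Un_commute abs_le_iff)
qed

text \<open>The closure of the cylinder sets over \<open>Z\<close> in the pseudometric given by the
  measure of the symmetric difference. The approximants stay over the same \<open>Z\<close>, so the
  product formula for cylinders applies to them.\<close>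

definition approximable :: "'v set \<Rightarrow> 'v set \<Rightarrow> bool" where
  "approximable Z A \<longleftrightarrow> A \<in> kappa_sets \<and> (\<forall>\<epsilon>>0. \<exists>B\<in>cylinders V L X Z. m (sym_diff A B) < \<epsilon>)"

lemma approximable_cylinder: "A \<in> cylinders V L X Z \<Longrightarrow> Z \<subseteq> elts X \<Longrightarrow> approximable Z A"
  unfolding approximable_def using cylinders_kappa_sets
  by (auto intro!: bexI[of _ A] simp: sym_diff_def m_empty)

lemma approximable_compl:
  assumes "approximable Z A"
  shows "approximable Z (Str V L X - A)"
  unfolding approximable_def
proof (intro conjI allI impI)
  show "Str V L X - A \<in> kappa_sets" using assms kappa_sets_compl unfolding approximable_def by blast
  fix \<epsilon> :: real assume "0 < \<epsilon>"
  then obtain B where B: "B \<in> cylinders V L X Z" "m (sym_diff A B) < \<epsilon>"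
    using assms unfolding approximable_def by blast
  have "A \<subseteq> Str V L X" "B \<subseteq> Str V L X"
    using assms B(1) kappa_sets_subset unfolding approximable_def cylinders_def cylinder_def by auto
  then have "sym_diff (Str V L X - A) (Str V L X - B) = sym_diff A B"
    unfolding sym_diff_def by blast
  with B show "\<exists>B\<in>cylinders V L X Z. m (sym_diff (Str V L X - A) B) < \<epsilon>"
    using cylinders_compl by metis
qed

text \<open>The error consists of the part of the union that finitely many members miss and of the
  errors in approximating these members. Each is at most \<open>\<epsilon> / 3\<close>, which leaves
  room for the strict inequality.\<close>

lemma approximable_UN:
  assumes f: "fun_in V (elts \<kappa>) f" and Z: "Z \<subseteq> elts X"
    and sigma: "\<And>i. i \<in> elts \<kappa> \<Longrightarrow> f i \<in> sigma_kappa V \<kappa> L X"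
    and approx: "\<And>i. i \<in> elts \<kappa> \<Longrightarrow> approximable Z (elts (f i))"
  shows "approximable Z (\<Union>i\<in>elts \<kappa>. elts (f i))"
  unfolding approximable_def
proof (intro conjI allI impI)
  let ?U = "\<Union>i\<in>elts \<kappa>. elts (f i)"
  show U: "?U \<in> kappa_sets" by (rule kappa_sets_UN[OF \<kappa>_in subset_refl f sigma])
  fix \<epsilon> :: real assume "0 < \<epsilon>"
  then have "0 < \<epsilon> / 3" by simp
  obtain I where I: "finite I" "I \<subseteq> elts \<kappa>" "m ?U \<le> m (\<Union>i\<in>I. elts (f i)) + \<epsilon> / 3"
    using m_UN_finite_approx[OF f sigma \<open>0 < \<epsilon> / 3\<close>] by blast
  \<comment> \<open>The \<open>1 +\<close> keeps the denominator positive when \<open>I\<close> is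
    empty; \<open>card I * \<delta>\<close> is at most \<open>\<epsilon> / 3\<close>.\<close>
  define \<delta> where "\<delta> = \<epsilon> / 3 / (1 + card I)"
  have "0 < \<delta>" unfolding \<delta>_def using \<open>0 < \<epsilon>\<close> by simp
  then have "\<forall>i\<in>I. \<exists>B\<in>cylinders V L X Z. m (sym_diff (elts (f i)) B) < \<delta>"
    using approx I(2) unfolding approximable_def by blast
  then obtain B where B: "\<And>i. i \<in> I \<Longrightarrow> B i \<in> cylinders V L X Z"
    "\<And>i. i \<in> I \<Longrightarrow> m (sym_diff (elts (f i)) (B i)) < \<delta>"
    by metis
  have fm: "elts (f i) \<in> kappa_sets" if "i \<in> I" for i
    using elts_kappa_sets[OF sigma] I(2) that by blast
  have UI: "(\<Union>i\<in>I. elts (f i)) \<in> kappa_sets" using I(1) fm by (rule finite_UN)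
  have sd: "sym_diff (elts (f i)) (B i) \<in> kappa_sets" if "i \<in> I" for i
    by (rule sym_diff_kappa_sets[OF fm[OF that] cylinders_kappa_sets[OF B(1)[OF that] Z]])
  have BI: "(\<Union>i\<in>I. B i) \<in> cylinders V L X Z" using I(1) B(1) by (rule cylinders_UN)
  let ?R = "?U - (\<Union>i\<in>I. elts (f i))" and ?T = "\<Union>i\<in>I. sym_diff (elts (f i)) (B i)"
  have "m (sym_diff ?U (\<Union>i\<in>I. B i)) \<le> m (?R \<union> ?T)"
  proof (rule m_mono)
    show "sym_diff ?U (\<Union>i\<in>I. B i) \<in> kappa_sets"
      by (rule sym_diff_kappa_sets[OF U cylinders_kappa_sets[OF BI Z]])
    show "?R \<union> ?T \<in> kappa_sets" by (intro Un Diff U UI finite_UN I(1) sd)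
    show "sym_diff ?U (\<Union>i\<in>I. B i) \<subseteq> ?R \<union> ?T"
      using I(2) unfolding sym_diff_def by auto
  qed
  also have "\<dots> \<le> m ?R + m ?T"
    by (intro m_subadditive Diff U UI finite_UN I(1) sd)
  also have "m ?R = m ?U - m (\<Union>i\<in>I. elts (f i))"
    using I(2) by (intro m_Diff U UI) auto
  also have "\<dots> \<le> \<epsilon> / 3" using I(3) by simp
  also have "m ?T \<le> (\<Sum>i\<in>I. m (sym_diff (elts (f i)) (B i)))" by (rule m_UN_le[OF I(1) sd])
  also have "\<dots> \<le> (\<Sum>i\<in>I. \<delta>)" using B(2) by (intro sum_mono less_imp_le)
  also have "\<dots> \<le> \<epsilon> / 3" using \<open>0 < \<epsilon>\<close> unfolding \<delta>_def by (simp add: field_simps)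
  finally have "m (sym_diff ?U (\<Union>i\<in>I. B i)) < \<epsilon>" using \<open>0 < \<epsilon>\<close> by simp
  with BI show "\<exists>B\<in>cylinders V L X Z. m (sym_diff ?U B) < \<epsilon>" by blast
qed

lemma interp_basic:
  assumes "is_basic L (elts X) \<phi>s a"
  shows "interp V L X (basic_code \<phi>s a) = mkset (basic_set V L X \<phi>s a)"
  unfolding basic_set_def by (rule interp_eq[OF denotes.basic])

text \<open>Complements reduce \<open>code_And\<close> to the case of unions. The measurability
  contained in \<open>approximable\<close> lets \<open>elts\<close> cancel the \<open>mkset\<close>
  in \<open>interp\<close>.\<close>

lemma approximable_code:
  assumes "\<gamma> \<in> codes V \<kappa> L Z" and Z: "Z \<subseteq> elts X"
  shows "approximable Z (elts (interp V L X \<gamma>))"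
  using assms(1)
proof induction
  case (basic \<phi>s a)
  have "is_basic L (elts X) \<phi>s a" using basic Z by (rule is_basic_mono)
  then have "elts (interp V L X (basic_code \<phi>s a)) = basic_set V L X \<phi>s a"
    using interp_basic elts_mkset[OF basic_set_kappa_sets] by simp
  then show ?case
    using approximable_cylinder[OF basic_set_in_cylinders[OF basic] Z] by simp
next
  case (neg \<gamma>)
  have "meaningful \<gamma>" using codes_meaningful[OF neg.hyps Z] .
  then have d: "denotes V L X \<gamma> (elts (interp V L X \<gamma>))" unfolding meaningful_def by blast
  have a: "approximable Z (Str V L X - elts (interp V L X \<gamma>))"
    using approximable_compl[OF neg.IH] .
  then have "elts (interp V L X (code_neg \<gamma>)) = Str V L X - elts (interp V L X \<gamma>)"
    using interp_eq[OF denotes.neg[OF d]] elts_mkset unfolding approximable_def by simp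
  then show ?case using a by simp
next
  case (Or \<gamma>)
  have mf: "meaningful (\<gamma> i)" if "i \<in> elts \<kappa>" for i using codes_meaningful[OF _ Z] Or.hyps(2) that by blast
  have s: "interp V L X (\<gamma> i) \<in> sigma_kappa V \<kappa> L X" if "i \<in> elts \<kappa>" for i
    using mf[OF that] unfolding meaningful_def by blast
  have a: "approximable Z (\<Union>i\<in>elts \<kappa>. elts (interp V L X (\<gamma> i)))"
    by (rule approximable_UN[OF fun_in_interp[OF Or.hyps(1) mf] Z s Or.IH])
  then have "elts (interp V L X (code_Or (mkset (\<gamma> ` elts \<kappa>)))) = (\<Union>i\<in>elts \<kappa>. elts (interp V L X (\<gamma> i)))"
    using interp_eq[OF denotes_Or_interp[OF Or.hyps(1) mf]] elts_mkset unfolding approximable_def by simp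
  then show ?case using a by simp
next
  case (And \<gamma>)
  have mf: "meaningful (\<gamma> i)" if "i \<in> elts \<kappa>" for i using codes_meaningful[OF _ Z] And.hyps(2) that by blast
  have s: "interp V L X (\<gamma> i) \<in> sigma_kappa V \<kappa> L X" if "i \<in> elts \<kappa>" for i
    using mf[OF that] unfolding meaningful_def by blast
  define f where "f i = mkset (Str V L X - elts (interp V L X (\<gamma> i)))" for i
  have elts_f: "elts (f i) = Str V L X - elts (interp V L X (\<gamma> i))" if "i \<in> elts \<kappa>" for i
    unfolding f_def using elts_mkset[OF kappa_sets_compl[OF elts_kappa_sets[OF s[OF that]]]] .
  have "fun_in V (elts \<kappa>) f"
    unfolding f_def by (rule fun_in_compl[OF fun_in_interp[OF And.hyps(1) mf]])
  then have "approximable Z (\<Union>i\<in>elts \<kappa>. elts (f i))"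
  proof (rule approximable_UN[OF _ Z])
    show "f i \<in> sigma_kappa V \<kappa> L X" if "i \<in> elts \<kappa>" for i
      unfolding f_def by (rule compl_in_sigma[OF s[OF that]])
    show "approximable Z (elts (f i))" if "i \<in> elts \<kappa>" for i
      unfolding elts_f[OF that] by (rule approximable_compl[OF And.IH[OF that]])
  qed
  then have a: "approximable Z (Str V L X \<inter> (\<Inter>i\<in>elts \<kappa>. elts (interp V L X (\<gamma> i))))"
    using approximable_compl INT_eq_compl_UN[of "\<lambda>i. interp V L X (\<gamma> i)"] s unfolding f_def by simp
  then have "elts (interp V L X (code_And (mkset (\<gamma> ` elts \<kappa>)))) =
      Str V L X \<inter> (\<Inter>i\<in>elts \<kappa>. elts (interp V L X (\<gamma> i)))"
    using interp_eq[OF denotes_And_interp[OF And.hyps(1) mf]] elts_mkset unfolding approximable_def by simp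
  then show ?case using a by simp
qed

text \<open>Intersection and multiplication are continuous in the pseudometric, so the formula
  passes from cylinders to their limits.\<close>

lemma product_approximable:
  assumes pr: "product_on_basic Y Z" and YZ: "Y \<subseteq> elts X" "Z \<subseteq> elts X"
    and A: "approximable Y A" and B: "approximable Z B"
  shows "m (A \<inter> B) = m A * m B"
proof -
  have Am: "A \<in> kappa_sets" and Bm: "B \<in> kappa_sets" using A B unfolding approximable_def by auto
  have "\<bar>m (A \<inter> B) - m A * m B\<bar> \<le> \<epsilon>" if "0 < \<epsilon>" for \<epsilon> :: real
  proof -
    \<comment> \<open>Two quarters are spent on replacing the intersection, two on replacing the
      product.\<close>
    have "0 < \<epsilon> / 4" using that by simp
    then obtain A' B' where A': "A' \<in> cylinders V L X Y" "m (sym_diff A A') < \<epsilon> / 4"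
      and B': "B' \<in> cylinders V L X Z" "m (sym_diff B B') < \<epsilon> / 4"
      using A B unfolding approximable_def by blast
    note A'm = cylinders_kappa_sets[OF A'(1) YZ(1)] and B'm = cylinders_kappa_sets[OF B'(1) YZ(2)]
    have dA: "\<bar>m A - m A'\<bar> \<le> \<epsilon> / 4" using m_sym_diff[OF Am A'm] A'(2) by simp
    have dB: "\<bar>m B - m B'\<bar> \<le> \<epsilon> / 4" using m_sym_diff[OF Bm B'm] B'(2) by simp
    have "\<bar>m (A \<inter> B) - m (A' \<inter> B')\<bar> \<le> m (sym_diff (A \<inter> B) (A' \<inter> B'))"
      by (intro m_sym_diff Int Am Bm A'm B'm)
    also have "\<dots> \<le> m (sym_diff A A' \<union> sym_diff B B')"
      by (intro m_mono sym_diff_kappa_sets Un Int Am Bm A'm B'm) (auto simp: sym_diff_def)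
    also have "\<dots> \<le> m (sym_diff A A') + m (sym_diff B B')"
      by (intro m_subadditive sym_diff_kappa_sets Am Bm A'm B'm)
    finally have dAB: "\<bar>m (A \<inter> B) - m (A' \<inter> B')\<bar> \<le> \<epsilon> / 2" using A'(2) B'(2) by simp
    \<comment> \<open>The difference of the products is telescoped; as measures are at most 1, each
      term is bounded by one of the two errors.\<close>
    have "\<bar>m A' * m B' - m A * m B\<bar> = \<bar>m A' * (m B' - m B) + (m A' - m A) * m B\<bar>"
      by (simp add: algebra_simps)
    also have "\<dots> \<le> m A' * \<bar>m B' - m B\<bar> + \<bar>m A' - m A\<bar> * m B"
      using m_nonneg[OF A'm] m_nonneg[OF Bm] by (metis abs_mult abs_of_nonneg abs_triangle_ineq)
    also have "\<dots> \<le> 1 * \<bar>m B' - m B\<bar> + \<bar>m A' - m A\<bar> * 1"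
      using m_le_1[OF A'm] m_le_1[OF Bm] m_nonneg[OF Bm] by (intro add_mono mult_mono) auto
    also have "\<dots> \<le> \<epsilon> / 2" using dA dB by (simp add: abs_minus_commute)
    finally have "\<bar>m (A' \<inter> B') - m A * m B\<bar> \<le> \<epsilon> / 2"
      using product_cylinders[OF pr YZ A'(1) B'(1)] by simp
    with dAB show ?thesis by linarith
  qed
  then have "\<bar>m (A \<inter> B) - m A * m B\<bar> \<le> 0" by (rule field_le_epsilon) simp
  then show ?thesis by simp
qed

text \<open>The binary conjunction is evaluated by \<open>denotes.And\<close> directly, because its
  set of members is given as a pair and not as a family indexed by \<kappa>.\<close>

lemma m_interp_And:
  assumes "meaningful \<gamma>" "meaningful \<delta>"
  shows "\<mu> (interp V L X (code_And (mkset {\<gamma>, \<delta>}))) = m (elts (interp V L X \<gamma>) \<inter> elts (interp V L X \<delta>))"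
proof -
  have "denotes V L X (code_And (mkset {\<gamma>, \<delta>}))
      (Str V L X \<inter> (\<Inter>\<gamma>\<in>elts (mkset {\<gamma>, \<delta>}). elts (interp V L X \<gamma>)))"
    using assms by (intro denotes.And) (auto simp: meaningful_def)
  moreover have "elts (interp V L X \<gamma>) \<subseteq> Str V L X"
    using assms(1) sigma_kappaD(2) unfolding meaningful_def by blast
  ultimately show ?thesis
    using interp_eq unfolding m_def by (auto simp: Int_absorb1 Int_assoc[symmetric] dest!: interp_eq)
qed

lemma dissociated_iff:
  "dissociated V \<kappa> L X \<mu> \<longleftrightarrow>
     (\<forall>Y Z. finite Y \<and> finite Z \<and> Y \<subseteq> elts X \<and> Z \<subseteq> elts X \<and> Y \<inter> Z = {} \<longrightarrow> product_on_basic Y Z)"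
proof (intro iffI allI impI)
  fix Y Z assume d: "dissociated V \<kappa> L X \<mu>"
    and YZ: "finite Y \<and> finite Z \<and> Y \<subseteq> elts X \<and> Z \<subseteq> elts X \<and> Y \<inter> Z = {}"
  show "product_on_basic Y Z"
    unfolding product_on_basic_def
  proof (intro allI impI, elim conjE)
    fix \<phi>s a \<psi>s b assume ab: "is_basic L Y \<phi>s a" "is_basic L Z \<psi>s b"
    have X: "is_basic L (elts X) \<phi>s a" "is_basic L (elts X) \<psi>s b"
      using ab is_basic_mono YZ by blast+
    have c: "basic_code \<phi>s a \<in> codes V \<kappa> L Y" "basic_code \<psi>s b \<in> codes V \<kappa> L Z"
      using ab codes.basic by blast+
    then have "\<mu> (interp V L X (code_And (mkset {basic_code \<phi>s a, basic_code \<psi>s b}))) =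
        \<mu> (interp V L X (basic_code \<phi>s a)) * \<mu> (interp V L X (basic_code \<psi>s b))"
      by (rule d[unfolded dissociated_def, THEN spec, THEN spec, THEN mp, OF YZ, THEN bspec, THEN bspec])
    moreover have "meaningful (basic_code \<phi>s a)" "meaningful (basic_code \<psi>s b)"
      using codes_meaningful[OF c(1)] codes_meaningful[OF c(2)] YZ by auto
    ultimately show "m (basic_set V L X \<phi>s a \<inter> basic_set V L X \<psi>s b) =
        m (basic_set V L X \<phi>s a) * m (basic_set V L X \<psi>s b)"
      using m_interp_And interp_basic[OF X(1)] interp_basic[OF X(2)]
        elts_mkset[OF basic_set_kappa_sets[OF X(1)]] elts_mkset[OF basic_set_kappa_sets[OF X(2)]]
      by (simp add: m_def)
  qed
next
  assume pr: "\<forall>Y Z. finite Y \<and> finite Z \<and> Y \<subseteq> elts X \<and> Z \<subseteq> elts X \<and> Y \<inter> Z = {} \<longrightarrow> product_on_basic Y Z"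
  show "dissociated V \<kappa> L X \<mu>"
    unfolding dissociated_def
  proof (intro allI impI ballI)
    fix Y Z \<gamma> \<delta>
    assume YZ: "finite Y \<and> finite Z \<and> Y \<subseteq> elts X \<and> Z \<subseteq> elts X \<and> Y \<inter> Z = {}"
      and c: "\<gamma> \<in> codes V \<kappa> L Y" "\<delta> \<in> codes V \<kappa> L Z"
    then have YZX: "Y \<subseteq> elts X" "Z \<subseteq> elts X" and "product_on_basic Y Z" using pr by simp_all
    then have "m (elts (interp V L X \<gamma>) \<inter> elts (interp V L X \<delta>)) =
        m (elts (interp V L X \<gamma>)) * m (elts (interp V L X \<delta>))"
      using approximable_code[OF c(1)] approximable_code[OF c(2)] by (intro product_approximable)
    then show "\<mu> (interp V L X (code_And (mkset {\<gamma>, \<delta>}))) =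
        \<mu> (interp V L X \<gamma>) * \<mu> (interp V L X \<delta>)"
      using m_interp_And[OF codes_meaningful[OF c(1) YZX(1)] codes_meaningful[OF c(2) YZX(2)]]
      by (simp add: m_def)
  qed
qed

end

section \<open>Comparison of the two models\<close>

theorem proposition5p18:
  fixes V0 V1 :: "'v::set_universe set"
    and \<kappa> X L :: 'v
    and \<mu> \<nu> :: "'v \<Rightarrow> real"
  assumes "set_model V0" and "set_model V1" and "V0 \<subseteq> V1"
    and "\<kappa> \<in> V0" and "Ord \<kappa>" and "infinite (elts \<kappa>)"
    and "X \<in> V0" and "infinite (elts X)"
    and "L \<in> V0" and "rel_language L"
    and "invariant_measure V0 \<kappa> L X \<mu>"
    and "relativization V0 V1 \<kappa> L X \<mu> \<nu>"
  shows "dissociated V0 \<kappa> L X \<mu> \<longleftrightarrow> dissociated V1 \<kappa> L X \<nu>"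
proof -
  have V1: "\<kappa> \<in> V1" "X \<in> V1" "L \<in> V1" using assms(3,4,7,9) by auto
  have prob: "prob_kappa_measure V0 \<kappa> L X \<mu>" "prob_kappa_measure V1 \<kappa> L X \<nu>"
    by (rule assms(11)[unfolded invariant_measure_def, THEN conjunct1],
        rule assms(12)[unfolded relativization_def, THEN conjunct1])
  interpret M0: kappa_measure V0 \<kappa> L X \<mu>
    by unfold_locales (fact assms prob)+
  interpret M1: kappa_measure V1 \<kappa> L X \<nu>
    by unfold_locales (fact assms prob V1)+
  have m_eq: "M0.m (basic_set V0 L X \<phi>s a) = M1.m (basic_set V1 L X \<phi>s a)"
    if "is_basic L (elts X) \<phi>s a" for \<phi>s a
  proof -
    \<comment> \<open>\<open>relativization\<close> speaks of basic codes in \<open>V0\<close>. A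
      basic code over \<open>X\<close> is a finite object built from elements of \<open>V0\<close>,
      so it lies there.\<close>
    have "\<mu> (interp V0 L X (basic_code \<phi>s a)) = \<nu> (interp V1 L X (basic_code \<phi>s a))"
      by (rule assms(12)[unfolded relativization_def, THEN conjunct2, THEN spec, THEN spec, THEN mp,
            OF conjI[OF that M0.basic_fact(3)[OF that]]])
    then show ?thesis
      unfolding M0.interp_basic[OF that] M1.interp_basic[OF that] M0.m_def M1.m_def .
  qed
  have "M0.product_on_basic Y Z \<longleftrightarrow> M1.product_on_basic Y Z" if YZ: "Y \<subseteq> elts X" "Z \<subseteq> elts X" for Y Z
  proof -
    have "M0.m (basic_set V0 L X \<phi>s a \<inter> basic_set V0 L X \<psi>s b) =
        M0.m (basic_set V0 L X \<phi>s a) * M0.m (basic_set V0 L X \<psi>s b) \<longleftrightarrow>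
      M1.m (basic_set V1 L X \<phi>s a \<inter> basic_set V1 L X \<psi>s b) =
        M1.m (basic_set V1 L X \<phi>s a) * M1.m (basic_set V1 L X \<psi>s b)"
      if "is_basic L Y \<phi>s a" "is_basic L Z \<psi>s b" for \<phi>s a \<psi>s b
    proof -
      have X: "is_basic L (elts X) \<phi>s a" "is_basic L (elts X) \<psi>s b"
        using is_basic_mono[OF that(1) YZ(1)] is_basic_mono[OF that(2) YZ(2)] .
      \<comment> \<open>The intersection is given by a single basic code over \<open>X\<close>, on
        which the two measures agree.\<close>
      have "M0.m (basic_set V0 L X \<phi>s a \<inter> basic_set V0 L X \<psi>s b) =
          M1.m (basic_set V1 L X \<phi>s a \<inter> basic_set V1 L X \<psi>s b)"
        using m_eq[OF is_basic_append[OF X, unfolded Un_absorb]] unfolding basic_set_append[OF X(1)] .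
      then show ?thesis by (simp add: m_eq[OF X(1)] m_eq[OF X(2)])
    qed
    then show ?thesis
      unfolding M0.product_on_basic_def M1.product_on_basic_def by blast
  qed
  then show ?thesis
    unfolding M0.dissociated_iff M1.dissociated_iff by (simp cong: conj_cong)
qed

end
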